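(* For every positive smooth $P$-periodic $L$ on $\mathbb R$, there are $\mu_*>0$, $\delta_0>0$, and a smooth two-parameter family, with parameters $(\mu,\delta)$ near $(\mu_*,0)$, $0<\delta<\delta_0$, of doubly spiral reconstructions with first warp $\ell_1=L$. Their magnitudes and source warps are $P$-periodic. As $\delta\to0$, one has $a\to0$ in $C^\infty$, while both warps $\ell_1,\ell_2$ remain uniformly bounded above and away from zero. The phase-increment map $(\mu,\delta)\mapsto(D_1,D_2)$ has rank two.
   Context: Setting. For $i=1,2$, $(M_i,g_i)$ is a Riemannian manifold of dimension $k_i>0$, and $f_i:(M_i,g_i)\to\mathbb S^{2n_i+1}\subset\mathbb C^{n_i+1}$ (unit round sphere) is an eigenmap: $\Delta f_i=-d_if_i$ with $d_i=|df_i|^2>0$ constant. Reconstruction. Given $c\in\mathbb R$, $\varepsilon>0$, $\sigma\in\{\pm1\}$ and a smooth $a:\mathbb R\to(0,1)$ with $R:=1-a^2-(a')^2>0$, set $Q=1+(c^2-1)a^2$, $b=\sqrt{1-a^2}$, $F=\sqrt{\varepsilon Q/(a^2R)}$, $T=\frac1{a^2Q}-\frac{a+a''}{aR}$; let $(\ell_1,\ell_2)$ be the unique pair of positive functions with $\ell_1^{k_1}\ell_2^{k_2}=F$ and $d_2/\ell_2^2-d_1/\ell_1^2=T$; and choose phases with $s_1'=\sigma\sqrt\varepsilon/(Fa^2)$, $s_2'=\sigma c\sqrt\varepsilon/(Fb^2)$. Then $G=(ae^{is_1}f_1,be^{is_2}f_2)$ is harmonic from $(\mathbb R\times M_1\times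 M_2,\ dt^2+\ell_1^2g_1+\ell_2^2g_2)$ to $\mathbb S^{2n_1+2n_2+3}$ with unit-speed profile. The parameters $c,\varepsilon$ may depend on $(\mu,\delta)$; $\sigma=1$. The reconstruction is doubly spiral if both phases rotate, i.e. $c\ne0$. The phase increments over one period are $D_i=\int_0^Ps_i'\,dt$. *)

theory Defs
  imports "HOL-Analysis.Analysis"
begin

section \<open>Smooth functions\<close>

text \<open>Both notions are meant for open sets \<open>S\<close>.  In finite dimension, continuity of all iterated
  directional derivatives is the usual \<open>C\<^sup>k\<close> condition.\<close>

primrec Ck_on :: "nat \<Rightarrow> 'a set \<Rightarrow> ('a::euclidean_space \<Rightarrow> 'b::real_normed_vector) \<Rightarrow> bool" where
  "Ck_on 0 S f \<longleftrightarrow> continuous_on S f"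
| "Ck_on (Suc k) S f \<longleftrightarrow>
     f differentiable_on S \<and> (\<forall>v. Ck_on k S (\<lambda>x. frechet_derivative f (at x) v))"

definition smooth_on :: "'a set \<Rightarrow> ('a::euclidean_space \<Rightarrow> 'b::real_normed_vector) \<Rightarrow> bool" where
  "smooth_on S f \<longleftrightarrow> (\<forall>k. Ck_on k S f)"


section \<open>Riemannian manifolds and eigenmaps\<close>

text \<open>The manifold is the whole type \<open>'m\<close>; its dimension is \<open>CARD('k)\<close>.  A chart is a pair
  \<open>(U, \<phi>)\<close>, and only the values of \<open>\<phi>\<close> on \<open>U\<close> matter.\<close>

type_synonym ('m, 'k) chart = "'m set \<times> ('m \<Rightarrow> real ^ 'k)"

definition chart_inv :: "('m, 'k) chart \<Rightarrow> real ^ 'k \<Rightarrow> 'm" where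
  "chart_inv C = inv_into (fst C) (snd C)"

definition transition ::
    "('m, 'k) chart \<Rightarrow> ('m, 'k) chart \<Rightarrow> real ^ 'k \<Rightarrow> real ^ 'k" where
  "transition C D = snd D \<circ> chart_inv C"

definition smooth_atlas ::
    "('m::{t2_space, second_countable_topology}, 'k::finite) chart set \<Rightarrow> bool" where
  "smooth_atlas A \<longleftrightarrow>
     (\<Union>C\<in>A. fst C) = UNIV \<and>
     (\<forall>C\<in>A. open (fst C) \<and> open (snd C ` fst C) \<and>
        homeomorphism (fst C) (snd C ` fst C) (snd C) (chart_inv C)) \<and>
     (\<forall>C\<in>A. \<forall>D\<in>A. smooth_on (snd C ` (fst C \<inter> fst D)) (transition C D))"

text \<open>A metric is given by its component matrices in the charts of the atlas: \<open>g C x\<close> is the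
  matrix of the metric at the point with coordinates \<open>x\<close> in the chart \<open>C\<close>.\<close>

type_synonym ('m, 'k) metric_components = "('m, 'k) chart \<Rightarrow> real ^ 'k \<Rightarrow> real ^ 'k ^ 'k"

definition riemannian_manifold ::
    "('m::{t2_space, second_countable_topology}, 'k::finite) chart set \<Rightarrow>
     ('m, 'k) metric_components \<Rightarrow> bool" where
  "riemannian_manifold A g \<longleftrightarrow>
     smooth_atlas A \<and>
     (\<forall>C\<in>A. smooth_on (snd C ` fst C) (g C) \<and>
        (\<forall>x\<in>snd C ` fst C. transpose (g C x) = g C x \<and> (\<forall>v. v \<noteq> 0 \<longrightarrow> v \<bullet> (g C x *v v) > 0))) \<and>
     (\<forall>C\<in>A. \<forall>D\<in>A. \<forall>p\<in>fst C \<inter> fst D.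
        let J = matrix (frechet_derivative (transition C D) (at (snd C p)))
        in g C (snd C p) = transpose J ** g D (snd D p) ** J)"

definition partial :: "'k \<Rightarrow> (real ^ 'k \<Rightarrow> 'b) \<Rightarrow> real ^ 'k::finite \<Rightarrow> 'b::real_normed_vector" where
  "partial i u x = frechet_derivative u (at x) (axis i 1)"

text \<open>The Laplace-Beltrami operator in coordinates, with the sign convention
  \<open>\<Delta> = div grad\<close>, applied componentwise to vector-valued functions.\<close>

definition laplace_beltrami ::
    "(real ^ 'k \<Rightarrow> real ^ 'k ^ 'k) \<Rightarrow> (real ^ 'k \<Rightarrow> 'b) \<Rightarrow> real ^ 'k::finite \<Rightarrow> 'b::real_normed_vector" where
  "laplace_beltrami h u x =
     (1 / sqrt (det (h x))) *\<^sub>R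
       (\<Sum>i\<in>UNIV. partial i
          (\<lambda>y. \<Sum>j\<in>UNIV. (sqrt (det (h y)) * matrix_inv (h y) $ i $ j) *\<^sub>R partial j u y) x)"

text \<open>The squared norm \<open>|du|\<^sup>2\<close> of the differential.\<close>

definition energy_density ::
    "(real ^ 'k \<Rightarrow> real ^ 'k ^ 'k) \<Rightarrow> (real ^ 'k \<Rightarrow> 'b::real_inner) \<Rightarrow> real ^ 'k::finite \<Rightarrow> real" where
  "energy_density h u x =
     (\<Sum>i\<in>UNIV. \<Sum>j\<in>UNIV. matrix_inv (h x) $ i $ j * (partial i u x \<bullet> partial j u x))"

text \<open>Eigenmaps into the unit sphere of \<open>complex ^ 'n\<close>, which is the sphere of dimension
  \<open>2 n + 1\<close> when \<open>CARD('n) = n + 1\<close>.\<close>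

definition eigenmap ::
    "('m::{t2_space, second_countable_topology}, 'k::finite) chart set \<Rightarrow>
     ('m, 'k) metric_components \<Rightarrow> real \<Rightarrow> ('m \<Rightarrow> complex ^ 'n::finite) \<Rightarrow> bool" where
  "eigenmap A g d f \<longleftrightarrow>
     d > 0 \<and> range f \<subseteq> sphere 0 1 \<and>
     (\<forall>C\<in>A. smooth_on (snd C ` fst C) (f \<circ> chart_inv C) \<and>
        (\<forall>p\<in>fst C.
           laplace_beltrami (g C) (f \<circ> chart_inv C) (snd C p) = - d *\<^sub>R f p \<and>
           energy_density (g C) (f \<circ> chart_inv C) (snd C p) = d))"


section \<open>Reconstructions\<close>

definition profile_Q :: "real \<Rightarrow> (real \<Rightarrow> real) \<Rightarrow> real \<Rightarrow> real" where
  "profile_Q c a t = 1 + (c\<^sup>2 - 1) * (a t)\<^sup>2"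

definition profile_R :: "(real \<Rightarrow> real) \<Rightarrow> real \<Rightarrow> real" where
  "profile_R a t = 1 - (a t)\<^sup>2 - (deriv a t)\<^sup>2"

definition profile_b :: "(real \<Rightarrow> real) \<Rightarrow> real \<Rightarrow> real" where
  "profile_b a t = sqrt (1 - (a t)\<^sup>2)"

definition profile_F :: "real \<Rightarrow> real \<Rightarrow> (real \<Rightarrow> real) \<Rightarrow> real \<Rightarrow> real" where
  "profile_F c \<epsilon> a t = sqrt (\<epsilon> * profile_Q c a t / ((a t)\<^sup>2 * profile_R a t))"

definition profile_T :: "real \<Rightarrow> (real \<Rightarrow> real) \<Rightarrow> real \<Rightarrow> real" where
  "profile_T c a t =
     1 / ((a t)\<^sup>2 * profile_Q c a t) - (a t + deriv (deriv a) t) / (a t * profile_R a t)"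

text \<open>The two equations determine the positive pair \<open>(l1 t, l2 t)\<close> uniquely, because on
  the curve where the product is fixed the difference is strictly increasing in \<open>l1 t\<close>.\<close>

definition reconstructed_warps ::
    "nat \<Rightarrow> real \<Rightarrow> nat \<Rightarrow> real \<Rightarrow> real \<Rightarrow> real \<Rightarrow> (real \<Rightarrow> real) \<Rightarrow>
     (real \<Rightarrow> real) \<Rightarrow> (real \<Rightarrow> real) \<Rightarrow> bool" where
  "reconstructed_warps k1 d1 k2 d2 c \<epsilon> a l1 l2 \<longleftrightarrow>
     (\<forall>t. l1 t > 0 \<and> l2 t > 0 \<and>
        l1 t ^ k1 * l2 t ^ k2 = profile_F c \<epsilon> a t \<and>
        d2 / (l2 t)\<^sup>2 - d1 / (l1 t)\<^sup>2 = profile_T c a t)"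

definition reconstructed_phases ::
    "real \<Rightarrow> real \<Rightarrow> real \<Rightarrow> (real \<Rightarrow> real) \<Rightarrow> (real \<Rightarrow> real) \<Rightarrow> (real \<Rightarrow> real) \<Rightarrow> bool" where
  "reconstructed_phases c \<epsilon> \<sigma> a s1 s2 \<longleftrightarrow>
     (\<forall>t. (s1 has_real_derivative \<sigma> * sqrt \<epsilon> / (profile_F c \<epsilon> a t * (a t)\<^sup>2)) (at t) \<and>
          (s2 has_real_derivative
             \<sigma> * c * sqrt \<epsilon> / (profile_F c \<epsilon> a t * (profile_b a t)\<^sup>2)) (at t))"

definition reconstructed_map ::
    "(real \<Rightarrow> real) \<Rightarrow> (real \<Rightarrow> real) \<Rightarrow> (real \<Rightarrow> real) \<Rightarrow>
     ('m1 \<Rightarrow> complex ^ 'n1) \<Rightarrow> ('m2 \<Rightarrow> complex ^ 'n2) \<Rightarrow>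
     real \<times> 'm1 \<times> 'm2 \<Rightarrow> (complex ^ 'n1) \<times> (complex ^ 'n2)" where
  "reconstructed_map a s1 s2 f1 f2 = (\<lambda>(t, x, y).
     ((of_real (a t) * exp (\<i> * of_real (s1 t))) *s f1 x,
      (of_real (profile_b a t) * exp (\<i> * of_real (s2 t))) *s f2 y))"

text \<open>The source of \<open>G\<close> carries the metric \<open>dt\<^sup>2 + l1\<^sup>2 g1 + l2\<^sup>2 g2\<close>.  That \<open>G\<close> is
  then harmonic with unit-speed profile is a consequence of this definition, not part of it.\<close>

definition reconstruction ::
    "nat \<Rightarrow> real \<Rightarrow> ('m1 \<Rightarrow> complex ^ 'n1) \<Rightarrow> nat \<Rightarrow> real \<Rightarrow> ('m2 \<Rightarrow> complex ^ 'n2) \<Rightarrow>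
     real \<Rightarrow> real \<Rightarrow> real \<Rightarrow> (real \<Rightarrow> real) \<Rightarrow> (real \<Rightarrow> real) \<Rightarrow> (real \<Rightarrow> real) \<Rightarrow>
     (real \<Rightarrow> real) \<Rightarrow> (real \<Rightarrow> real) \<Rightarrow>
     (real \<times> 'm1 \<times> 'm2 \<Rightarrow> (complex ^ 'n1) \<times> (complex ^ 'n2)) \<Rightarrow> bool" where
  "reconstruction k1 d1 f1 k2 d2 f2 c \<epsilon> \<sigma> a l1 l2 s1 s2 G \<longleftrightarrow>
     \<epsilon> > 0 \<and> \<sigma> \<in> {1, -1} \<and>
     smooth_on UNIV a \<and> (\<forall>t. 0 < a t \<and> a t < 1) \<and> (\<forall>t. profile_R a t > 0) \<and>
     reconstructed_warps k1 d1 k2 d2 c \<epsilon> a l1 l2 \<and>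
     reconstructed_phases c \<epsilon> \<sigma> a s1 s2 \<and>
     G = reconstructed_map a s1 s2 f1 f2"

definition doubly_spiral :: "real \<Rightarrow> bool" where
  "doubly_spiral c \<longleftrightarrow> c \<noteq> 0"

definition phase_increment :: "real \<Rightarrow> (real \<Rightarrow> real) \<Rightarrow> real" where
  "phase_increment P s = integral {0..P} (deriv s)"

definition periodic :: "real \<Rightarrow> (real \<Rightarrow> real) \<Rightarrow> bool" where
  "periodic P u \<longleftrightarrow> (\<forall>t. u (t + P) = u t)"

end

theory Submission
  imports Defs
begin

text \<open>With \<open>a = \<delta> \<alpha>\<close>, \<open>c = 1 / \<delta>\<^sup>2\<close>, \<open>\<epsilon> = \<delta>\<^sup>4 / \<mu>\<^sup>k\<close> (where \<open>k\<close> is the dimension of the second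
  factor) and \<open>\<eta> = \<delta>\<^sup>2\<close>, prescribing \<open>\<ell>\<^sub>1 = L\<close> amounts to a second-order equation for \<open>\<alpha>\<close> that stays
  smooth at \<open>\<eta> = 0\<close>.  There it is the Ermakov equation \<open>\<alpha>'' + V \<alpha> = 1 / \<alpha>\<^sup>3\<close> with
  \<open>V = \<mu> w + 1 - d\<^sub>1 / L\<^sup>2\<close> and a positive periodic weight \<open>w\<close>.  For a large nonresonant \<open>\<mu>\<close>, the WKB
  substitution and a rotation of the phase plane turn it into an antiperiodic first-order system with
  small Lipschitz constant, so that a periodic solution exists and persists, smoothly in
  \<open>(\<mu>, \<eta>)\<close>, on a full neighbourhood of \<open>\<eta> = 0\<close>.

  At \<open>\<eta> = 0\<close> one has \<open>D\<^sub>2 = P\<close> for all \<open>\<mu>\<close>; the virial identity gives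
  \<open>\<partial>D\<^sub>2 / \<partial>\<eta> = \<integral> (1 - V) \<alpha>\<^sup>2 / 2 < 0\<close>, and the Wronskian of the solutions for two values of \<open>\<mu>\<close> gives
  \<open>\<partial>D\<^sub>1 / \<partial>\<mu> = \<integral> w \<alpha>\<^sup>2 / 2 > 0\<close>.  So \<open>(\<mu>, \<eta>) \<mapsto> (D\<^sub>1, D\<^sub>2)\<close> is a local immersion, and
  \<open>\<delta> \<mapsto> \<delta>\<^sup>2\<close> preserves this for \<open>\<delta> > 0\<close>.\<close>

section \<open>Calculus of smooth functions\<close>

text \<open>The scale \<open>c = 1 / \<delta>\<^sup>2\<close> is forced by
  \<open>a\<^sup>2 Q = a\<^sup>2 + (c\<^sup>2 - 1) a ^ 4\<close>: there the second term keeps order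
  one as \<open>a\<close> shrinks. With \<epsilon> of order \<open>\<delta> ^ 4\<close>,
  \<open>F\<close> and \<open>T\<close> have finite limits, so the warps neither blow up nor
  collapse. Antiperiodicity makes the perturbation argument unconditional. For a periodic system
  with small right-hand side the constants form a kernel of \<open>d/dt\<close> and cost a
  solvability condition; on antiperiodic functions \<open>d/dt\<close> is invertible, its inverse
  bounded by \<open>P / 2\<close>, and the same bound governs existence, uniqueness and dependence
  on parameters. A large \<mu> serves twice: the WKB error becomes small, and \<open>1 - V\<close>
  becomes negative, which decides the sign of the second phase derivative. As
  \<open>D\<^sub>2\<close> is constant along \<eta> = 0, the rank has to come from the first order
  in \<eta>.\<close>

lemma Ck_on_cong:
  assumes "open S" "\<And>x. x \<in> S \<Longrightarrow> f x = g x" "Ck_on k S f"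
  shows "Ck_on k S g"
  using assms(2,3)
proof (induction k arbitrary: f g)
  case 0
  then show ?case by (auto cong: continuous_on_cong)
next
  case (Suc k)
  have diff: "f differentiable_on S" using Suc.prems by simp
  have f_at: "f differentiable (at x)" if "x \<in> S" for x
    using diff that \<open>open S\<close> by (simp add: differentiable_on_eq_differentiable_at)
  have eq: "frechet_derivative f (at x) = frechet_derivative g (at x)" if "x \<in> S" for x
    using frechet_derivative_transform_within_open[OF f_at[OF that] \<open>open S\<close> that] Suc.prems(1) by blast
  have "g differentiable_on S"
    using diff Suc.prems(1) by (metis differentiable_on_def differentiable_transform_within zero_less_one)
  moreover have "Ck_on k S (\<lambda>x. frechet_derivative g (at x) v)" for v
    by (rule Suc.IH[of "\<lambda>x. frechet_derivative f (at x) v"]) (use eq Suc.prems in auto)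
  ultimately show ?case by simp
qed

text \<open>Most later differentiability proofs enter here: the derivative may be given by an
  explicit formula, so the choice operator inside \<open>frechet_derivative\<close> stays
  hidden.\<close>

lemma Ck_on_SucI:
  assumes "open S" "\<And>x. x \<in> S \<Longrightarrow> (f has_derivative f' x) (at x)"
    and "\<And>v. Ck_on k S (\<lambda>x. f' x v)"
  shows "Ck_on (Suc k) S f"
proof -
  have "Ck_on k S (\<lambda>x. frechet_derivative f (at x) v)" for v
    by (rule Ck_on_cong[OF \<open>open S\<close> _ assms(3)[of v]])
       (use assms(2) frechet_derivative_at in metis)
  moreover have "f differentiable_on S"
    using assms(2) by (meson differentiable_at_imp_differentiable_on differentiable_def)
  ultimately show ?thesis by simp
qed

lemma Ck_on_Suc_has_derivative:
  assumes "Ck_on (Suc k) S f" "open S" "x \<in> S"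
  shows "(f has_derivative frechet_derivative f (at x)) (at x)"
  using assms frechet_derivative_works
  by (auto simp: differentiable_on_eq_differentiable_at)

lemma Ck_on_SucD: "Ck_on (Suc k) S f \<Longrightarrow> Ck_on k S f"
proof (induction k arbitrary: f)
  case 0
  then show ?case by (simp add: differentiable_imp_continuous_on)
qed auto

lemma Ck_on_imp_continuous_on: "Ck_on k S f \<Longrightarrow> continuous_on S f"
  by (induction k) (auto intro: differentiable_imp_continuous_on)

lemma Ck_on_subset:
  assumes "Ck_on k S f" "T \<subseteq> S"
  shows "Ck_on k T f"
  using assms(1)
  by (induction k arbitrary: f)
     (use assms(2) in \<open>auto intro: continuous_on_subset differentiable_on_subset\<close>)

lemma Ck_on_const: "open S \<Longrightarrow> Ck_on k S (\<lambda>x. c)"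
proof (induction k arbitrary: c)
  case (Suc k)
  show ?case by (rule Ck_on_SucI[where f' = "\<lambda>x v. 0"]) (use Suc in auto)
qed auto

lemma Ck_on_bounded_linear_compose:
  assumes "bounded_linear L" "open S" "Ck_on k S f"
  shows "Ck_on k S (\<lambda>x. L (f x))"
  using assms(3)
proof (induction k arbitrary: f)
  case 0
  then show ?case using bounded_linear.continuous_on[OF assms(1)] by auto
next
  case (Suc k)
  show ?case
  proof (rule Ck_on_SucI[where f' = "\<lambda>x v. L (frechet_derivative f (at x) v)"])
    fix x assume "x \<in> S"
    then show "((\<lambda>x. L (f x)) has_derivative (\<lambda>v. L (frechet_derivative f (at x) v))) (at x)"
      using bounded_linear.has_derivative[OF assms(1)] Ck_on_Suc_has_derivative[OF Suc.prems assms(2)] by blast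
  qed (use Suc assms in auto)
qed

lemma Ck_on_ident: "open S \<Longrightarrow> Ck_on k S (\<lambda>x. x)"
  by (induction k) (auto intro!: Ck_on_SucI[where f' = "\<lambda>x v. v"] Ck_on_const)

lemma Ck_on_add:
  assumes "open S" "Ck_on k S f" "Ck_on k S g"
  shows "Ck_on k S (\<lambda>x. f x + g x)"
  using assms(2,3)
proof (induction k arbitrary: f g)
  case (Suc k)
  show ?case
    by (rule Ck_on_SucI[where f' = "\<lambda>x v. frechet_derivative f (at x) v + frechet_derivative g (at x) v"])
       (use Suc assms(1) in \<open>auto intro!: has_derivative_add Ck_on_Suc_has_derivative\<close>)
qed (auto intro: continuous_intros)

lemma Ck_on_sum:
  assumes "open S" "\<And>i. i \<in> I \<Longrightarrow> Ck_on k S (f i)"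
  shows "Ck_on k S (\<lambda>x. \<Sum>i\<in>I. f i x)"
  using assms(2)
  by (induction I rule: infinite_finite_induct) (auto intro: assms(1) Ck_on_const Ck_on_add)

text \<open>The Leibniz rule pairs each derivative with an undifferentiated factor, whose order is
  lowered by \<open>Ck_on_SucD\<close>. Scalar multiples and products are instances.\<close>

lemma Ck_on_bounded_bilinear:
  assumes B: "bounded_bilinear m" and "open S" "Ck_on k S f" "Ck_on k S g"
  shows "Ck_on k S (\<lambda>x. m (f x) (g x))"
  using assms(3,4)
proof (induction k arbitrary: f g)
  case 0
  then show ?case using bounded_bilinear.continuous_on[OF B] by auto
next
  case (Suc k)
  show ?case
  proof (rule Ck_on_SucI[where f' = "\<lambda>x v. m (f x) (frechet_derivative g (at x) v)
                                        + m (frechet_derivative f (at x) v) (g x)"])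
    show "Ck_on k S (\<lambda>x. m (f x) (frechet_derivative g (at x) v)
                                        + m (frechet_derivative f (at x) v) (g x))" for v
      by (intro Ck_on_add Suc.IH) (use Suc.prems assms(2) Ck_on_SucD in auto)
  qed (use Suc.prems assms in \<open>auto intro!: bounded_bilinear.FDERIV[OF B] Ck_on_Suc_has_derivative\<close>)
qed

lemmas Ck_on_scaleR = Ck_on_bounded_bilinear[OF bounded_bilinear_scaleR]
lemmas Ck_on_mult = Ck_on_bounded_bilinear[OF bounded_bilinear_mult]

lemma Ck_on_Pair:
  assumes "open S" "Ck_on k S f" "Ck_on k S g"
  shows "Ck_on k S (\<lambda>x. (f x, g x))"
proof -
  have "bounded_linear (\<lambda>y. (y, 0))" "bounded_linear (\<lambda>y. (0, y))"
    by (auto intro!: bounded_linear_intros)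
  then have "Ck_on k S (\<lambda>x. (f x, 0) + (0, g x))"
    using assms by (intro Ck_on_add) (auto intro: Ck_on_bounded_linear_compose)
  then show ?thesis by simp
qed

text \<open>The chain rule alone gives a derivative of \<open>g\<close> in a direction that varies
  with the point. Expanding that direction in \<open>Basis\<close> leaves derivatives of
  \<open>g\<close> in fixed directions, composed with \<open>f\<close>, and these are covered by the
  induction hypothesis.\<close>

lemma Ck_on_compose:
  fixes f :: "'a::euclidean_space \<Rightarrow> 'b::euclidean_space" and g :: "'b \<Rightarrow> 'c::real_normed_vector"
  assumes "open S" "open T" "f ` S \<subseteq> T" "Ck_on k S f" "Ck_on k T g"
  shows "Ck_on k S (\<lambda>x. g (f x))"
  using assms(4,5)
proof (induction k arbitrary: g)
  case 0
  then show ?case using assms(3) by (auto intro: continuous_on_compose2)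
next
  case (Suc k)
  let ?D = "\<lambda>x v. \<Sum>b\<in>Basis. (frechet_derivative f (at x) v \<bullet> b) *\<^sub>R frechet_derivative g (at (f x)) b"
  show ?case
  proof (rule Ck_on_SucI[where f' = ?D])
    fix x assume "x \<in> S"
    then have f: "(f has_derivative frechet_derivative f (at x)) (at x)"
      and g: "(g has_derivative frechet_derivative g (at (f x))) (at (f x))"
      using Ck_on_Suc_has_derivative Suc.prems assms by (blast, fast)
    have "linear (frechet_derivative g (at (f x)))"
      using g has_derivative_linear by blast
    then have "(\<Sum>b\<in>Basis. (w \<bullet> b) *\<^sub>R frechet_derivative g (at (f x)) b)
        = frechet_derivative g (at (f x)) (\<Sum>b\<in>Basis. (w \<bullet> b) *\<^sub>R b)" for w
      by (simp add: linear_sum linear_scale)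
    then show "((\<lambda>x. g (f x)) has_derivative ?D x) (at x)"
      using diff_chain_at[OF f g] by (simp add: o_def euclidean_representation)
  next
    fix v
    have "Ck_on k S (\<lambda>x. frechet_derivative g (at (f x)) b)" for b
      using Suc.IH[of "\<lambda>y. frechet_derivative g (at y) b"] Suc.prems Ck_on_SucD by auto
    moreover have "Ck_on k S (\<lambda>x. frechet_derivative f (at x) v \<bullet> b)" for b
      using Suc.prems by (intro Ck_on_bounded_linear_compose[OF bounded_linear_inner_left \<open>open S\<close>]) auto
    ultimately show "Ck_on k S (\<lambda>x. ?D x v)"
      by (intro Ck_on_sum Ck_on_scaleR \<open>open S\<close>) auto
  qed fact
qed

lemma Ck_on_real_SucI:
  fixes f :: "real \<Rightarrow> 'b::real_normed_vector"
  assumes "open S" "\<And>x. x \<in> S \<Longrightarrow> (f has_vector_derivative f' x) (at x)" "Ck_on k S f'"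
  shows "Ck_on (Suc k) S f"
  by (rule Ck_on_SucI[where f' = "\<lambda>x v. v *\<^sub>R f' x"])
     (use assms in \<open>auto simp: has_vector_derivative_def intro: Ck_on_scaleR Ck_on_const\<close>)

lemma smooth_on_real_derivativeI:
  fixes f :: "real \<Rightarrow> 'b::real_normed_vector"
  assumes "open S" "\<And>x. x \<in> S \<Longrightarrow> (f has_vector_derivative f' x) (at x)" "smooth_on S f'"
  shows "smooth_on S f"
  using Ck_on_real_SucI[OF assms(1,2)] assms(3) Ck_on_SucD unfolding smooth_on_def by blast

section \<open>Closure properties of smooth maps, including real powers and
  \<open>cis\<close>\<close>

lemma smooth_on_cong:
  assumes "smooth_on S f" "open S" "\<And>x. x \<in> S \<Longrightarrow> f x = g x"
  shows "smooth_on S g"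
  using assms Ck_on_cong unfolding smooth_on_def by metis

lemma smooth_on_subset: "smooth_on S f \<Longrightarrow> T \<subseteq> S \<Longrightarrow> smooth_on T f"
  unfolding smooth_on_def using Ck_on_subset by blast

lemma smooth_on_imp_continuous_on: "smooth_on S f \<Longrightarrow> continuous_on S f"
  unfolding smooth_on_def using Ck_on_imp_continuous_on by blast

lemma smooth_on_has_derivative:
  assumes "smooth_on S f" "open S" "x \<in> S"
  shows "(f has_derivative frechet_derivative f (at x)) (at x)"
  using assms Ck_on_Suc_has_derivative unfolding smooth_on_def by blast

lemma smooth_on_frechet_derivative:
  "smooth_on S f \<Longrightarrow> smooth_on S (\<lambda>x. frechet_derivative f (at x) v)"
  unfolding smooth_on_def by (metis Ck_on.simps(2))

lemma smooth_on_const: "open S \<Longrightarrow> smooth_on S (\<lambda>x. c)"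
  by (simp add: smooth_on_def Ck_on_const)

lemma smooth_on_ident: "open S \<Longrightarrow> smooth_on S (\<lambda>x. x)"
  by (simp add: smooth_on_def Ck_on_ident)

lemma smooth_on_bounded_linear_compose:
  "bounded_linear L \<Longrightarrow> open S \<Longrightarrow> smooth_on S f \<Longrightarrow> smooth_on S (\<lambda>x. L (f x))"
  by (simp add: smooth_on_def Ck_on_bounded_linear_compose)

lemmas smooth_on_fst = smooth_on_bounded_linear_compose[OF bounded_linear_fst]
lemmas smooth_on_snd = smooth_on_bounded_linear_compose[OF bounded_linear_snd]
lemmas smooth_on_minus = smooth_on_bounded_linear_compose[OF bounded_linear_minus[OF bounded_linear_ident]]
lemmas smooth_on_of_real = smooth_on_bounded_linear_compose[OF bounded_linear_of_real]
lemmas smooth_on_Re = smooth_on_bounded_linear_compose[OF bounded_linear_Re]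
lemmas smooth_on_Im = smooth_on_bounded_linear_compose[OF bounded_linear_Im]

lemma smooth_on_add: "open S \<Longrightarrow> smooth_on S f \<Longrightarrow> smooth_on S g \<Longrightarrow> smooth_on S (\<lambda>x. f x + g x)"
  by (simp add: smooth_on_def Ck_on_add)

lemma smooth_on_diff: "open S \<Longrightarrow> smooth_on S f \<Longrightarrow> smooth_on S g \<Longrightarrow> smooth_on S (\<lambda>x. f x - g x)"
  using smooth_on_add[of S f "\<lambda>x. - g x"] smooth_on_minus[of S g] by simp

lemma smooth_on_mult:
  fixes f g :: "_ \<Rightarrow> 'b::real_normed_algebra"
  shows "open S \<Longrightarrow> smooth_on S f \<Longrightarrow> smooth_on S g \<Longrightarrow> smooth_on S (\<lambda>x. f x * g x)"
  by (simp add: smooth_on_def Ck_on_mult)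

lemma smooth_on_Pair: "open S \<Longrightarrow> smooth_on S f \<Longrightarrow> smooth_on S g \<Longrightarrow> smooth_on S (\<lambda>x. (f x, g x))"
  by (simp add: smooth_on_def Ck_on_Pair)

lemma smooth_on_compose:
  fixes f :: "'a::euclidean_space \<Rightarrow> 'b::euclidean_space" and g :: "'b \<Rightarrow> 'c::real_normed_vector"
  assumes "smooth_on T g" "open S" "open T" "smooth_on S f" "\<And>x. x \<in> S \<Longrightarrow> f x \<in> T"
  shows "smooth_on S (\<lambda>x. g (f x))"
  using assms unfolding smooth_on_def by (blast intro: Ck_on_compose)

lemma smooth_on_power:
  fixes f :: "_ \<Rightarrow> 'b::real_normed_algebra_1"
  shows "open S \<Longrightarrow> smooth_on S f \<Longrightarrow> smooth_on S (\<lambda>x. f x ^ n)"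
  by (induction n) (auto intro: smooth_on_const smooth_on_mult)

text \<open>Differentiation stays within the family of powers, so the exponent varies in the
  induction. Roots and quotients of positive functions are obtained below from the exponents 1/2 and
  -1.\<close>

lemma Ck_on_powr: "Ck_on k {0<..} (\<lambda>x::real. x powr r)"
proof (induction k arbitrary: r)
  case 0
  show ?case by (auto intro!: continuous_intros)
next
  case (Suc k)
  show ?case
  proof (rule Ck_on_real_SucI[where f' = "\<lambda>x. r * x powr (r - 1)"])
    fix x :: real assume "x \<in> {0<..}"
    then show "((\<lambda>x. x powr r) has_vector_derivative r * x powr (r - 1)) (at x)"
      by (auto simp: has_real_derivative_iff_has_vector_derivative[symmetric] intro!: derivative_eq_intros)
  qed (auto intro!: Ck_on_mult Ck_on_const Suc)
qed

lemma smooth_on_powr: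
  assumes "open S" "smooth_on S f" "\<And>x. x \<in> S \<Longrightarrow> (0::real) < f x"
  shows "smooth_on S (\<lambda>x. f x powr r)"
  by (rule smooth_on_compose[where T = "{0<..}"]) (use assms Ck_on_powr in \<open>auto simp: smooth_on_def\<close>)

lemma smooth_on_sqrt:
  assumes "open S" "smooth_on S f" "\<And>x. x \<in> S \<Longrightarrow> (0::real) < f x"
  shows "smooth_on S (\<lambda>x. sqrt (f x))"
  by (rule smooth_on_cong[OF smooth_on_powr[OF assms, of "1/2"]])
    (use assms in \<open>auto simp: powr_half_sqrt less_imp_le\<close>)

lemma smooth_on_divide:
  assumes "open S" "smooth_on S f" "smooth_on S g" "\<And>x. x \<in> S \<Longrightarrow> (0::real) < g x"
  shows "smooth_on S (\<lambda>x. f x / g x)"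
  by (rule smooth_on_cong[OF smooth_on_mult[OF assms(1,2) smooth_on_powr[OF assms(1,3,4), of "-1"]]])
    (use assms in \<open>auto simp: powr_minus_divide less_imp_le\<close>)

lemma has_vector_derivative_cis: "(cis has_vector_derivative \<i> * cis x) (at x)"
proof -
  have cis: "cis = (\<lambda>x. exp (\<i> * of_real x))" by (simp add: cis_conv_exp fun_eq_iff)
  have "((\<lambda>z. exp (\<i> * z)) has_field_derivative \<i> * exp (\<i> * of_real x)) (at (of_real x))"
    by (auto intro!: derivative_eq_intros)
  from has_vector_derivative_real_field[OF this] show ?thesis
    unfolding cis .
qed

lemma Ck_on_cis: "Ck_on k UNIV cis"
proof (induction k)
  case 0
  show ?case by (auto intro!: continuous_intros)
next
  case (Suc k)
  show ?case
    by (intro Ck_on_real_SucI[where f' = "\<lambda>x. \<i> * cis x"] has_vector_derivative_cis) (auto intro!: Ck_on_mult Ck_on_const Suc)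
qed

lemma smooth_on_cis:
  assumes "open S" "smooth_on S f"
  shows "smooth_on S (\<lambda>x. cis (f x))"
  by (rule smooth_on_compose[where T = UNIV]) (use assms Ck_on_cis in \<open>auto simp: smooth_on_def\<close>)

text \<open>\<open>Ck_on\<close> speaks about one direction at a time. In finite dimension,
  continuity of all directional derivatives is continuity in operator norm, the form required by
  uniform estimates and by differentiation under the integral.\<close>

lemma Ck_on_continuous_blinfun:
  fixes f :: "'a::euclidean_space \<Rightarrow> 'b::real_normed_vector"
  assumes "Ck_on (Suc k) S f" "open S"
  obtains F where "continuous_on S F"
    "\<And>x. x \<in> S \<Longrightarrow> (f has_derivative blinfun_apply (F x)) (at x)"
    "\<And>v. Ck_on k S (\<lambda>x. blinfun_apply (F x) v)"
proof
  define F where "F x = Blinfun (frechet_derivative f (at x))" for x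
  have F: "blinfun_apply (F x) = frechet_derivative f (at x)" if "x \<in> S" for x
    unfolding F_def using Ck_on_Suc_has_derivative[OF assms that]
    by (simp add: bounded_linear_Blinfun_apply has_derivative_bounded_linear)
  show C: "Ck_on k S (\<lambda>x. blinfun_apply (F x) v)" for v
    by (rule Ck_on_cong[of _ "\<lambda>x. frechet_derivative f (at x) v"]) (use assms F in auto)
  show "continuous_on S F"
    by (rule continuous_on_blinfun_componentwise) (use C Ck_on_imp_continuous_on in blast)
  show "(f has_derivative blinfun_apply (F x)) (at x)" if "x \<in> S" for x
    using Ck_on_Suc_has_derivative[OF assms that] F[OF that] by simp
qed

section \<open>Time derivatives and integrals depending on a parameter\<close>

lemma smooth_on_vector_derivative_snd:
  fixes f :: "'a::euclidean_space \<times> real \<Rightarrow> 'b::real_normed_vector"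
  assumes "open S" "smooth_on (S \<times> UNIV) f" "p \<in> S"
  shows "((\<lambda>t. f (p, t)) has_vector_derivative frechet_derivative f (at (p, t)) (0, 1)) (at t)"
proof -
  let ?D = "frechet_derivative f (at (p, t))"
  have f: "(f has_derivative ?D) (at (p, t))"
    using assms by (intro smooth_on_has_derivative) (auto intro: open_Times)
  have "((\<lambda>t. (p, t)) has_derivative (\<lambda>h. (0, h))) (at t)"
    by (auto intro!: derivative_eq_intros)
  from diff_chain_at[OF this f] have "((\<lambda>t. f (p, t)) has_derivative (\<lambda>h. ?D (0, h))) (at t)"
    by (simp add: o_def)
  moreover have "(\<lambda>h. ?D (0, h)) = (\<lambda>h. h *\<^sub>R ?D (0, 1))"
  proof
    fix h
    have eq: "(0, h) = h *\<^sub>R (0 :: 'a, 1 :: real)" by simp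
    show "?D (0, h) = h *\<^sub>R ?D (0, 1)"
      by (subst eq) (rule linear_scale[OF has_derivative_linear[OF f]])
  qed
  ultimately show ?thesis by (simp only: has_vector_derivative_def)
qed

text \<open>Time ranges over all of \<open>UNIV\<close>, so the domain is open and \<open>f\<close>
  has a full derivative at the end points of \<open>{a..b}\<close> too; composing it with
  \<open>v \<mapsto> (v, 0)\<close> isolates the parameter direction.\<close>

lemma has_derivative_parametric_integral:
  fixes f :: "'a::euclidean_space \<times> real \<Rightarrow> 'b::euclidean_space"
  assumes "Ck_on (Suc 0) (S \<times> UNIV) f" "open S" "x \<in> S"
  shows "((\<lambda>x. integral {a..b} (\<lambda>s. f (x, s))) has_derivative
      (\<lambda>v. integral {a..b} (\<lambda>s. frechet_derivative f (at (x, s)) (v, 0)))) (at x)"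
proof -
  have op: "open (S \<times> (UNIV::real set))" using assms by (auto intro: open_Times)
  obtain F where F: "continuous_on (S \<times> UNIV) F"
    "\<And>y. y \<in> S \<times> UNIV \<Longrightarrow> (f has_derivative blinfun_apply (F y)) (at y)"
    using Ck_on_continuous_blinfun[OF assms(1) op] by metis
  obtain J :: "'a \<Rightarrow>\<^sub>L ('a \<times> real)" where J: "\<And>v. blinfun_apply J v = (v, 0)"
    by (rule that[of "Blinfun (\<lambda>v. (v, 0))"], subst bounded_linear_Blinfun_apply)
      (auto intro!: bounded_linear_intros)
  obtain e where e: "e > 0" "ball x e \<subseteq> S" using assms openE by blast
  let ?F = "\<lambda>x s. F (x, s) o\<^sub>L J"
  have cont: "continuous_on (S \<times> UNIV) f" using assms(1) Ck_on_imp_continuous_on by blast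
  have cs: "continuous_on {a..b} (\<lambda>s. ?F x s)" if "x \<in> S" for x
    by (intro continuous_intros continuous_on_compose2[OF F(1)]) (use that in auto)
  have "((\<lambda>x. integral (cbox a b) (\<lambda>s. f (x, s))) has_derivative integral (cbox a b) (?F x)) (at x within ball x e)"
  proof (rule leibniz_rule)
    fix y t assume "y \<in> ball x e"
    then have "(f has_derivative blinfun_apply (F (y, t))) (at (y, t))" using F(2) e by auto
    moreover have "((\<lambda>y. (y, t)) has_derivative (\<lambda>v. (v, 0))) (at y within ball x e)"
      by (auto intro!: derivative_eq_intros)
    ultimately show "((\<lambda>y. f (y, t)) has_derivative blinfun_apply (?F y t)) (at y within ball x e)"
      using has_derivative_compose[of "\<lambda>y. (y,t)" _ y "ball x e" f] by (auto simp: J o_def blinfun_compose.rep_eq)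
  next
    show "(\<lambda>s. f (y, s)) integrable_on cbox a b" if "y \<in> ball x e" for y
      by (rule integrable_continuous, rule continuous_on_compose2[OF cont])
        (use that e in \<open>auto intro!: continuous_intros\<close>)
    show "continuous_on (ball x e \<times> cbox a b) (\<lambda>(x, t). ?F x t)"
      unfolding split_beta
      by (intro continuous_intros continuous_on_compose2[OF F(1)]) (use e in auto)
  qed (use e in auto)
  then have D: "((\<lambda>x. integral {a..b} (\<lambda>s. f (x, s))) has_derivative integral {a..b} (?F x)) (at x)"
    unfolding cbox_interval at_within_open[OF _ open_ball, of x x e, unfolded centre_in_ball, OF e(1)] .
  have "blinfun_apply (integral {a..b} (?F x)) v
      = integral {a..b} (\<lambda>s. frechet_derivative f (at (x, s)) (v, 0))" for v
  proof -
    have "blinfun_apply (integral {a..b} (?F x)) v = integral {a..b} (\<lambda>s. ?F x s v)"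
      using integral_linear[OF integrable_continuous_real[OF cs[OF \<open>x \<in> S\<close>]] blinfun.bounded_linear_left[of v]]
      by (simp add: o_def)
    also have "\<dots> = integral {a..b} (\<lambda>s. frechet_derivative f (at (x, s)) (v, 0))"
    proof (rule integral_cong)
      fix s
      have "blinfun_apply (F (x, s)) = frechet_derivative f (at (x, s))"
        using F(2) assms(3) by (intro frechet_derivative_at) auto
      then show "blinfun_apply (?F x s) v = frechet_derivative f (at (x, s)) (v, 0)"
        by (simp add: J)
    qed
    finally show ?thesis .
  qed
  then have "blinfun_apply (integral {a..b} (?F x))
      = (\<lambda>v. integral {a..b} (\<lambda>s. frechet_derivative f (at (x, s)) (v, 0)))" by blast
  with D show ?thesis by simp
qed

text \<open>The derivative of a parametric integral is again one, with the integrand differentiated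
  in the direction \<open>(v, 0)\<close>; the induction therefore ranges over all
  integrands.\<close>

lemma Ck_on_parametric_integral:
  fixes f :: "'a::euclidean_space \<times> real \<Rightarrow> 'b::euclidean_space"
  assumes "open S" "Ck_on k (S \<times> UNIV) f"
  shows "Ck_on k S (\<lambda>x. integral {a..b} (\<lambda>s. f (x, s)))"
  using assms(2)
proof (induction k arbitrary: f)
  case 0
  have "continuous_on S (\<lambda>x. integral (cbox a b) (\<lambda>s. f (x, s)))"
    by (rule integral_continuous_on_param)
      (use 0 in \<open>auto intro: continuous_on_subset\<close>)
  then show ?case by simp
next
  case (Suc k)
  show ?case
  proof (rule Ck_on_SucI[OF assms(1) has_derivative_parametric_integral[OF _ assms(1)]])
    show "Ck_on (Suc 0) (S \<times> UNIV) f" using Suc.prems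
      by (metis Ck_on.simps Ck_on_imp_continuous_on)
    show "Ck_on k S (\<lambda>x. integral {a..b} (\<lambda>s. frechet_derivative f (at (x, s)) (v, 0)))" for v
      using Suc.IH[of "\<lambda>y. frechet_derivative f (at y) (v, 0)"] Suc.prems by simp
  qed
qed

lemma smooth_on_parametric_integral:
  fixes f :: "'a::euclidean_space \<times> real \<Rightarrow> 'b::euclidean_space"
  assumes "open S" "smooth_on (S \<times> UNIV) f"
  shows "smooth_on S (\<lambda>x. integral {a..b} (\<lambda>s. f (x, s)))"
  using assms Ck_on_parametric_integral unfolding smooth_on_def by blast

section \<open>Antiperiodic solutions of parameter-dependent equations\<close>

text \<open>Stated for predicates because it is also applied to whole collections of estimates. The
  equivalence between \<open>t\<close> and \<open>t + P\<close> allows an arbitrary \<open>t\<close>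
  to be moved in either direction.\<close>

lemma periodic_predicate:
  fixes P :: real
  assumes "P > 0" "\<And>t. Q (t + P) \<longleftrightarrow> Q t" "\<And>t. t \<in> {0..P} \<Longrightarrow> Q t"
  shows "Q t"
proof -
  have per: "Q (t + of_int n * P) \<longleftrightarrow> Q t" for n
  proof (induction n rule: int_induct[where k = 0])
    case (step1 i)
    have eq: "t + of_int (i + 1) * P = (t + of_int i * P) + P" by (simp add: algebra_simps)
    show ?case unfolding eq using step1 by (simp add: assms(2))
  next
    case (step2 i)
    have eq: "t + of_int i * P = (t + of_int (i - 1) * P) + P" by (simp add: algebra_simps)
    show ?case using step2 unfolding eq by (simp add: assms(2))
  qed simp
  define n where "n = \<lfloor>t / P\<rfloor>"
  have "of_int n \<le> t / P" "t / P < of_int n + 1" unfolding n_def by linarith+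
  then have "t + of_int (- n) * P \<in> {0..P}" using \<open>P > 0\<close> by (auto simp: field_simps)
  from assms(3)[OF this] per[of "- n"] show ?thesis by simp
qed

text \<open>Periodicity is asked of the norm, so periodic and antiperiodic functions are treated
  alike.\<close>

lemma norm_periodic_attains_sup:
  fixes \<phi> :: "real \<Rightarrow> 'a::real_normed_vector"
  assumes "P > 0" "continuous_on UNIV \<phi>" "\<And>t. norm (\<phi> (t + P)) = norm (\<phi> t)"
  obtains t0 where "t0 \<in> {0..P}" "\<And>t. norm (\<phi> t) \<le> norm (\<phi> t0)"
proof -
  have "continuous_on {0..P} (\<lambda>t. norm (\<phi> t))"
    using assms(2) continuous_on_norm continuous_on_subset by blast
  then obtain t0 where t0: "t0 \<in> {0..P}" "\<And>t. t \<in> {0..P} \<Longrightarrow> norm (\<phi> t) \<le> norm (\<phi> t0)"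
    using continuous_attains_sup[of "{0..P}" "\<lambda>t. norm (\<phi> t)"] \<open>P > 0\<close> by auto
  have "norm (\<phi> t) \<le> norm (\<phi> t0)" for t
    by (rule periodic_predicate[OF assms(1)]) (use t0(2) assms(3) in auto)
  with t0(1) show ?thesis using that by blast
qed

text \<open>Takes the place of a Gronwall estimate, which would start from an initial value. It is
  applied to differences of solutions and to remainders of linearizations: as long as \<kappa> P <
  2, a small defect \<open>m\<close> forces a small function. The point \<open>t0\<close> lies in
  the first period, hence the interval \<open>{0..2*P}\<close>.\<close>

lemma antiperiodic_norm_bound:
  fixes \<phi> :: "real \<Rightarrow> 'a::real_normed_vector"
  assumes "P > 0" "\<And>t. (\<phi> has_vector_derivative \<phi>' t) (at t)" "\<And>t. \<phi> (t + P) = - \<phi> t"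
    and bd: "\<And>t. t \<in> {0..2*P} \<Longrightarrow> norm (\<phi>' t) \<le> \<kappa> * norm (\<phi> t) + m"
    and "0 \<le> \<kappa>" "\<kappa> * P < 2"
  shows "(2 - \<kappa> * P) * norm (\<phi> t) \<le> m * P"
proof -
  have cont: "continuous_on UNIV \<phi>"
    using assms(2) by (meson continuous_at_imp_continuous_on has_vector_derivative_continuous)
  obtain t0 where t0: "t0 \<in> {0..P}" and max: "\<And>t. norm (\<phi> t) \<le> norm (\<phi> t0)"
    using norm_periodic_attains_sup[OF \<open>P > 0\<close> cont] assms(3) by auto
  have "norm (\<phi> (t0 + P) - \<phi> t0) \<le> (\<kappa> * norm (\<phi> t0) + m) * norm (t0 + P - t0)"
  proof (rule differentiable_bound)
    show "convex {t0..t0 + P}" by simp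
    show "(\<phi> has_derivative (\<lambda>h. h *\<^sub>R \<phi>' x)) (at x within {t0..t0 + P})" for x
      using assms(2) has_vector_derivative_def has_derivative_at_withinI by blast
    fix x assume x: "x \<in> {t0..t0 + P}"
    have "norm (\<phi>' x) \<le> \<kappa> * norm (\<phi> x) + m" using bd x t0(1) by auto
    also have "\<dots> \<le> \<kappa> * norm (\<phi> t0) + m" using max[of x] \<open>0 \<le> \<kappa>\<close> by (simp add: mult_left_mono)
    finally have "norm (h *\<^sub>R \<phi>' x) \<le> (\<kappa> * norm (\<phi> t0) + m) * norm h" for h
      by (simp add: mult.commute mult_left_mono)
    then show "onorm (\<lambda>h. h *\<^sub>R \<phi>' x) \<le> \<kappa> * norm (\<phi> t0) + m" by (rule onorm_le)
  qed (use \<open>P > 0\<close> in auto)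
  \<comment> \<open>antiperiodicity turns the mean value inequality over one period into a bound on \<open>\<phi>\<close> itself\<close>
  moreover have "norm (\<phi> (t0 + P) - \<phi> t0) = 2 * norm (\<phi> t0)"
  proof -
    have "\<phi> (t0 + P) - \<phi> t0 = - (2 *\<^sub>R \<phi> t0)" by (simp add: assms(3) scaleR_2)
    then show ?thesis by simp
  qed
  ultimately have "(2 - \<kappa> * P) * norm (\<phi> t0) \<le> m * P" using \<open>P > 0\<close> by (simp add: algebra_simps)
  moreover have "(2 - \<kappa> * P) * norm (\<phi> t) \<le> (2 - \<kappa> * P) * norm (\<phi> t0)"
    using max[of t] \<open>\<kappa> * P < 2\<close> by (intro mult_left_mono) auto
  ultimately show ?thesis by linarith
qed

lemma continuous_has_antiderivative:
  fixes g :: "real \<Rightarrow> 'a::banach"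
  assumes g: "continuous_on UNIV g"
  obtains G where "\<And>t. (G has_vector_derivative g t) (at t)"
proof
  \<comment> \<open>One of the two integrals is over an empty or degenerate interval and vanishes,
    so this is the signed integral from 0 to \<open>t\<close>.\<close>
  define G where "G t = integral {0..t} g - integral {t..0} g" for t
  fix t :: real
  define b where "b = \<bar>t\<bar> + 1"
  have c: "continuous_on S g" for S using g continuous_on_subset by blast
  have "((\<lambda>u. integral {-b..u} g) has_vector_derivative g t) (at t within {-b..b})"
    by (rule integral_has_vector_derivative[OF c]) (auto simp: b_def)
  moreover have "at t within {-b..b} = at t" by (rule at_within_interior) (auto simp: b_def)
  ultimately have "((\<lambda>u. integral {-b..u} g - integral {-b..0} g) has_vector_derivative g t) (at t)"
    by (auto intro!: derivative_eq_intros)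
  then show "(G has_vector_derivative g t) (at t)"
  proof (rule has_vector_derivative_transform_within_open[where S = "{-b<..<b}"])
    fix u assume u: "u \<in> {-b<..<b}"
    have int: "g integrable_on {c..d}" for c d using c integrable_continuous_real by blast
    show "integral {-b..u} g - integral {-b..0} g = G u"
    proof (cases "u \<ge> 0")
      case True
      then have "integral {u..0} g = 0" by (cases "u = 0") auto
      with True show ?thesis
        using Henstock_Kurzweil_Integration.integral_combine[OF _ True int, of "-b"] by (simp add: G_def b_def algebra_simps)
    next
      case False
      then show ?thesis
        using Henstock_Kurzweil_Integration.integral_combine[of "-b" u 0, OF _ _ int] u by (simp add: G_def b_def algebra_simps)
    qed
  qed (auto simp: b_def)
qed

lemma antiperiodic_solution_exists:
  fixes h :: "real \<times> 'a::euclidean_space \<Rightarrow> 'a"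
  assumes "P > 0" "r \<ge> 0" and cont: "continuous_on (UNIV \<times> cball 0 r) h"
    and Lip: "\<And>t x y. norm x \<le> r \<Longrightarrow> norm y \<le> r \<Longrightarrow> norm (h (t, x) - h (t, y)) \<le> norm (x - y) / P"
    and small: "\<And>t. norm (h (t, 0)) \<le> r / P"
    and per: "\<And>t x. norm x \<le> r \<Longrightarrow> h (t + P, - x) = - h (t, x)"
  obtains f where "\<And>t. norm (f t) \<le> r" "\<And>t. (f has_vector_derivative h (t, f t)) (at t)"
    "\<And>t. f (t + P) = - f t"
proof -
  define S where "S = {f :: real \<Rightarrow>\<^sub>C 'a. \<forall>t. apply_bcontfun f t \<in> cball 0 r}"
  have S: "norm (apply_bcontfun f t) \<le> r" if "f \<in> S" for f t using that by (auto simp: S_def)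
  have hS: "continuous_on UNIV (\<lambda>s. h (s, apply_bcontfun f s))" if "f \<in> S" for f
    by (rule continuous_on_compose2[OF cont]) (use S[OF that] in \<open>auto intro!: continuous_intros\<close>)
  \<comment> \<open>The factor 2 is compensated by the weight 1/2 in the integral operator
    \<open>T\<close>, which thus maps the ball of radius \<open>r\<close> into itself.\<close>
  have hb: "norm (h (s, x)) \<le> 2 * r / P" if "norm x \<le> r" for s x
  proof -
    have "norm (h (s, x)) \<le> norm (h (s, x) - h (s, 0)) + norm (h (s, 0))"
      by (metis add.commute norm_triangle_sub)
    also have "\<dots> \<le> norm x / P + r / P" using Lip[of x 0 s] small[of s] that \<open>r \<ge> 0\<close> by simp
    also have "\<dots> \<le> 2 * r / P" using that \<open>P > 0\<close> by (simp add: field_simps)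
    finally show ?thesis .
  qed
  \<comment> \<open>An antiperiodic solution satisfies \<open>f (t + P) - f t = - 2 * f t\<close>,
    so integrating the equation over one period expresses \<open>f\<close> by its own right-hand
    side. The weight 1/2 turns the Lipschitz constant \<open>1 / P\<close> into the contraction
    factor 1/2.\<close>
  define T where "T f t = - (integral {t..t+P} (\<lambda>s. h (s, apply_bcontfun f s)) /\<^sub>R 2)" for f t
  have T_der: "(T f has_vector_derivative - ((h (t + P, apply_bcontfun f (t + P)) - h (t, apply_bcontfun f t)) /\<^sub>R 2)) (at t)"
    if f: "f \<in> S" for f t
  proof -
    obtain G where G: "\<And>t. (G has_vector_derivative h (t, apply_bcontfun f t)) (at t)"
      using continuous_has_antiderivative[OF hS[OF f]] by blast
    have "T f t = - ((G (t + P) - G t) /\<^sub>R 2)" for t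
    proof -
      have "((\<lambda>s. h (s, apply_bcontfun f s)) has_integral (G (t + P) - G t)) {t..t+P}"
        by (rule fundamental_theorem_of_calculus) (use \<open>P > 0\<close> in \<open>auto intro: has_vector_derivative_at_within G\<close>)
      then show ?thesis by (simp add: T_def integral_unique)
    qed
    then have T_eq: "T f = (\<lambda>t. - ((G (t + P) - G t) /\<^sub>R 2))" by blast
    have shift: "((\<lambda>t. t + P) has_vector_derivative 1) (at t)"
      by (auto intro!: derivative_eq_intros)
    have "((\<lambda>t. G (t + P)) has_vector_derivative h (t + P, apply_bcontfun f (t + P))) (at t)"
      using vector_diff_chain_at[OF shift G] by (simp add: o_def)
    then show ?thesis unfolding T_eq using G[of t]
      by (auto intro!: derivative_eq_intros)
  qed
  have T_bound: "norm (integral {t..t+P} k) \<le> c * P"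
    if "continuous_on UNIV k" "\<And>s. norm (k s) \<le> c" for k :: "real \<Rightarrow> 'a" and t c
    using integral_bound[of t "t + P" k c] that \<open>P > 0\<close> continuous_on_subset[OF that(1)] by simp
  have T_norm: "norm (T f t) \<le> r" if "f \<in> S" for f t
    using T_bound[OF hS[OF that], of "2 * r / P" t] hb S[OF that] \<open>P > 0\<close> by (auto simp: T_def)
  have T_cont: "continuous_on UNIV (T f)" if "f \<in> S" for f
    using T_der[OF that] by (meson continuous_at_imp_continuous_on has_vector_derivative_continuous)
  have T_bc: "T f \<in> bcontfun" if "f \<in> S" for f
    using T_cont[OF that] T_norm[OF that] by (auto simp: bcontfun_def bounded_iff)
  have Tap: "apply_bcontfun (Bcontfun (T f)) = T f" if "f \<in> S" for f
    using T_bc[OF that] by (simp add: Bcontfun_inverse)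
  have "\<exists>!f. f \<in> S \<and> Bcontfun (T f) = f"
  proof (rule Banach_fix[where c = "1/2"])
    have "closed S"
    proof -
      have "S = PiC UNIV (\<lambda>_. cball 0 r)" by (auto simp: S_def mem_PiC_iff Pi_iff)
      then show ?thesis by (simp add: closed_PiC)
    qed
    then show "complete S" by (simp add: complete_eq_closed)
    show "S \<noteq> {}" using \<open>r \<ge> 0\<close> by (auto simp: S_def intro!: exI[of _ 0] simp: zero_bcontfun.rep_eq)
    show "(\<lambda>f. Bcontfun (T f)) ` S \<subseteq> S" using T_norm Tap by (auto simp: S_def)
    fix f g assume f: "f \<in> S" and g: "g \<in> S"
    have "dist (T f t) (T g t) \<le> 1/2 * dist f g" for t
    proof -
      have "norm (h (s, apply_bcontfun f s) - h (s, apply_bcontfun g s)) \<le> dist f g / P" for s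
        using Lip[OF S[OF f] S[OF g], of s s] dist_bounded[of f s g] \<open>P > 0\<close>
        by (smt (verit) dist_norm divide_right_mono)
      moreover have "continuous_on UNIV (\<lambda>s. h (s, apply_bcontfun f s) - h (s, apply_bcontfun g s))"
        using hS f g by (auto intro: continuous_intros)
      ultimately have "norm (integral {t..t+P} (\<lambda>s. h (s, apply_bcontfun f s) - h (s, apply_bcontfun g s))) \<le> dist f g"
        using T_bound[of _ "dist f g / P" t] \<open>P > 0\<close> by fastforce
      moreover have "integral {t..t+P} (\<lambda>s. h (s, apply_bcontfun f s) - h (s, apply_bcontfun g s))
         = integral {t..t+P} (\<lambda>s. h (s, apply_bcontfun f s)) - integral {t..t+P} (\<lambda>s. h (s, apply_bcontfun g s))"
        using hS f g by (intro integral_diff integrable_continuous_real) (auto intro: continuous_on_subset)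
      moreover have "T f t - T g t = - ((integral {t..t+P} (\<lambda>s. h (s, apply_bcontfun f s))
           - integral {t..t+P} (\<lambda>s. h (s, apply_bcontfun g s))) /\<^sub>R 2)"
        by (simp add: T_def algebra_simps)
      ultimately show ?thesis by (simp add: dist_norm)
    qed
    then show "dist (Bcontfun (T f)) (Bcontfun (T g)) \<le> 1/2 * dist f g"
      by (intro dist_bound) (simp add: Tap f g)
  qed auto
  then obtain f where f: "f \<in> S" "Bcontfun (T f) = f"
    and uniq: "\<And>g. g \<in> S \<Longrightarrow> Bcontfun (T g) = g \<Longrightarrow> g = f" by blast
  have fT: "apply_bcontfun f = T f" using Tap[OF f(1)] f(2) by simp
  \<comment> \<open>the reflected translate of \<open>f\<close> is a fixed point too, so uniqueness makes \<open>f\<close> antiperiodic\<close>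
  define g where "g = Bcontfun (\<lambda>t. - apply_bcontfun f (t + P))"
  have "(\<lambda>t. - apply_bcontfun f (t + P)) \<in> bcontfun"
  proof (rule bcontfun_normI)
    show "continuous_on UNIV (\<lambda>t. - apply_bcontfun f (t + P))"
      by (intro continuous_on_minus continuous_on_compose2[OF continuous_on_apply_bcontfun[of UNIV f]])
        (auto intro!: continuous_intros)
  qed (use S[OF f(1)] in simp)
  then have g: "apply_bcontfun g t = - apply_bcontfun f (t + P)" for t
    by (simp add: g_def Bcontfun_inverse)
  have gS: "g \<in> S" using S[OF f(1)] by (auto simp: S_def g)
  have "T g t = apply_bcontfun g t" for t
  proof -
    have "h (s, apply_bcontfun g s) = - h (s + P, apply_bcontfun f (s + P))" for s
      using per[of "apply_bcontfun g s" s] S[OF gS, of s] by (simp add: g)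
    then have "T g t = integral {t..t+P} (\<lambda>s. h (s + P, apply_bcontfun f (s + P))) /\<^sub>R 2"
      by (simp add: T_def)
    also have "integral {t..t+P} (\<lambda>s. h (s + P, apply_bcontfun f (s + P)))
        = integral {t+P..t+P+P} (\<lambda>s. h (s, apply_bcontfun f s))"
      using integral_shift_Icc_real[of t "t + P" "\<lambda>s. h (s, apply_bcontfun f s)" P]
      by (simp add: o_def add.commute)
    finally have "T g t = - T f (t + P)" by (simp add: T_def)
    then show ?thesis unfolding g fT .
  qed
  then have "Bcontfun (T g) = g" by (intro bcontfun_eqI) (simp add: Tap[OF gS])
  then have "g = f" using uniq gS by blast
  then have anti: "apply_bcontfun f (t + P) = - apply_bcontfun f t" for t
    using g[of t] by simp
  \<comment> \<open>For a mere fixed point the derivative is half the difference of the right-hand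
    sides at \<open>t\<close> and \<open>t + P\<close>. By antiperiodicity these are opposite, so
    half their difference is the value at \<open>t\<close>.\<close>
  have "(apply_bcontfun f has_vector_derivative h (t, apply_bcontfun f t)) (at t)" for t
  proof -
    have "h (t + P, apply_bcontfun f (t + P)) = - h (t, apply_bcontfun f t)"
      using per[of "apply_bcontfun f t" t] S[OF f(1)] anti by simp
    then have "- ((h (t + P, apply_bcontfun f (t + P)) - h (t, apply_bcontfun f t)) /\<^sub>R 2) = h (t, apply_bcontfun f t)"
      by (simp add: scaleR_diff_right flip: scaleR_add_left)
    then show ?thesis using T_der[OF f(1), of t] unfolding fT[symmetric] by metis
  qed
  then show ?thesis using that[of "apply_bcontfun f"] S[OF f(1)] anti by blast
qed

section \<open>Uniform estimates near compact sets\<close>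

lemma uniformly_continuous_near_compact:
  fixes f :: "'a::euclidean_space \<Rightarrow> 'b::metric_space"
  assumes "open W" "continuous_on W f" "compact K" "K \<subseteq> W" "e > 0"
  obtains d where "d > 0" "\<And>x y. x \<in> K \<Longrightarrow> dist y x < d \<Longrightarrow> y \<in> W \<and> dist (f y) (f x) < e"
proof (cases "K = {}")
  case True
  then show ?thesis using that[of 1] by auto
next
  case False
  \<comment> \<open>A closed neighbourhood of \<open>K\<close> inside \<open>W\<close> is still
    compact, so uniform continuity also reaches points \<open>y\<close> outside
    \<open>K\<close>.\<close>
  obtain e0 where e0: "e0 > 0" "{x. infdist x K \<le> e0} \<subseteq> W"
    using compact_in_open_separated[OF False \<open>compact K\<close> \<open>open W\<close> \<open>K \<subseteq> W\<close>] by blast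
  define K' where "K' = {x. infdist x K \<le> e0}"
  have "compact K'" unfolding K'_def using compact_infdist_le[OF False \<open>compact K\<close> e0(1)] .
  moreover have "continuous_on K' f"
    using assms(2) e0(2) unfolding K'_def by (rule continuous_on_subset)
  ultimately have "uniformly_continuous_on K' f" using compact_uniformly_continuous by blast
  then obtain d where d: "d > 0" "\<And>x y. x \<in> K' \<Longrightarrow> y \<in> K' \<Longrightarrow> dist y x < d \<Longrightarrow> dist (f y) (f x) < e"
    using \<open>e > 0\<close> unfolding uniformly_continuous_on_def by metis
  show ?thesis
  proof (rule that[of "min d e0"])
    fix x y assume x: "x \<in> K" and y: "dist y x < min d e0"
    have "infdist y K \<le> dist y x" using infdist_le x by blast
    then have "y \<in> K'" using y by (simp add: K'_def)
    moreover have "x \<in> K'" using x e0(1) by (simp add: K'_def)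
    ultimately show "y \<in> W \<and> dist (f y) (f x) < e" using d(2) y e0(2) by (auto simp: K'_def)
  qed (use d e0 in auto)
qed

text \<open>The mean value inequality is used on the segment from \<open>x\<close> to
  \<open>y\<close>, where the derivative differs from \<open>F x\<close> by less than
  \<open>e\<close>; the gain is that \<open>d\<close> does not depend on \<open>x\<close>.\<close>

lemma uniform_linearization_near_compact:
  fixes f :: "'a::euclidean_space \<Rightarrow> 'b::real_normed_vector" and F :: "'a \<Rightarrow> 'a \<Rightarrow>\<^sub>L 'b"
  assumes "open W" "continuous_on W F" "\<And>x. x \<in> W \<Longrightarrow> (f has_derivative blinfun_apply (F x)) (at x)"
    and "compact K" "K \<subseteq> W" "e > 0"
  obtains d where "d > 0" "\<And>x y. x \<in> K \<Longrightarrow> norm (y - x) < d \<Longrightarrow>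
     y \<in> W \<and> norm (f y - f x - F x (y - x)) \<le> e * norm (y - x)"
proof -
  obtain d where d: "d > 0" "\<And>x y. x \<in> K \<Longrightarrow> dist y x < d \<Longrightarrow> y \<in> W \<and> dist (F y) (F x) < e"
    using uniformly_continuous_near_compact[OF assms(1,2,4,5,6)] by blast
  show ?thesis
  proof (rule that[OF d(1)])
    fix x y assume x: "x \<in> K" and y: "norm (y - x) < d"
    have "norm (f y - f x - F x (y - x)) \<le> norm (y - x) * e"
    proof (rule differentiable_bound_linearization[where S = "ball x d"])
      show "x + t *\<^sub>R (y - x) \<in> ball x d" if "t \<in> {0..1}" for t
        using that y mult_right_mono[of t 1 "norm (y - x)"] by (auto simp: dist_norm)
      fix z assume "z \<in> ball x d"
      then have z: "z \<in> W" "dist (F z) (F x) < e" using d(2)[OF x, of z] by (simp_all add: dist_commute)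
      show "(f has_derivative blinfun_apply (F z)) (at z within ball x d)"
        using assms(3)[OF z(1)] has_derivative_at_withinI by blast
      have "blinfun_apply (F z) - blinfun_apply (F x) = blinfun_apply (F z - F x)"
        by (auto simp: blinfun.diff_left)
      then show "onorm (blinfun_apply (F z) - blinfun_apply (F x)) \<le> e"
        using z(2) by (simp add: dist_norm norm_blinfun.rep_eq)
    qed (use d in auto)
    then show "y \<in> W \<and> norm (f y - f x - F x (y - x)) \<le> e * norm (y - x)"
      using d(2)[OF x, of y] y by (simp add: dist_norm mult.commute)
  qed
qed

text \<open>Converse of the mean value inequality. It carries a Lipschitz bound of the nonlinear
  system over to its linearization.\<close>

lemma has_derivative_norm_le_Lipschitz:
  fixes f :: "'a::real_normed_vector \<Rightarrow> 'b::real_normed_vector"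
  assumes "(f has_derivative D) (at x)" "open S" "x \<in> S"
    and Lip: "\<And>y. y \<in> S \<Longrightarrow> norm (f y - f x) \<le> c * norm (y - x)"
  shows "norm (D v) \<le> c * norm v"
proof (cases "v = 0")
  case True
  then show ?thesis using assms(1) by (simp add: linear_0 has_derivative_linear)
next
  case False
  obtain e where e: "e > 0" "ball x e \<subseteq> S" using assms openE by blast
  have "norm (D v) \<le> c * norm v + \<epsilon>" if "\<epsilon> > 0" for \<epsilon>
  proof -
    define \<epsilon>' where "\<epsilon>' = \<epsilon> / norm v"
    have "\<epsilon>' > 0" using that False by (simp add: \<epsilon>'_def)
    then obtain d where d: "d > 0" "\<And>y. norm (y - x) < d \<Longrightarrow> norm (f y - f x - D (y - x)) \<le> \<epsilon>' * norm (y - x)"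
      using assms(1) unfolding has_derivative_at_alt by blast
    define s where "s = min d e / (2 * norm v)"
    have s: "s > 0" "s * norm v < d" "s * norm v < e" using d e False by (auto simp: s_def)
    have "norm (f (x + s *\<^sub>R v) - f x - D (s *\<^sub>R v)) \<le> \<epsilon>' * (s * norm v)"
      using d(2)[of "x + s *\<^sub>R v"] s by simp
    moreover have "norm (f (x + s *\<^sub>R v) - f x) \<le> c * (s * norm v)"
      using Lip[of "x + s *\<^sub>R v"] s e(2) by (auto simp: dist_norm subset_eq)
    moreover have "norm (D (s *\<^sub>R v)) = s * norm (D v)"
      using linear_scale[OF has_derivative_linear[OF assms(1)]] s by simp
    moreover have "norm (D (s *\<^sub>R v)) \<le> norm (f (x + s *\<^sub>R v) - f x) + norm (f (x + s *\<^sub>R v) - f x - D (s *\<^sub>R v))"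
      by (metis norm_minus_commute norm_triangle_sub)
    ultimately have "s * norm (D v) \<le> s * (c * norm v + \<epsilon>' * norm v)" by (simp add: algebra_simps)
    then show ?thesis using s False by (simp add: \<epsilon>'_def)
  qed
  then show ?thesis using field_le_epsilon by blast
qed

section \<open>Dependence of antiperiodic solutions on parameters\<close>

lemma antiperiodic_solutions_continuous:
  fixes H :: "('p::euclidean_space \<times> real) \<times> 'a::euclidean_space \<Rightarrow> 'a" and \<zeta> :: "'p \<times> real \<Rightarrow> 'a"
  assumes "P > 0" "open U" "open W" "continuous_on W H"
    and W: "\<And>p t. p \<in> U \<Longrightarrow> ((p, t), \<zeta> (p, t)) \<in> W"
    and ode: "\<And>p t. p \<in> U \<Longrightarrow> ((\<lambda>t. \<zeta> (p, t)) has_vector_derivative H ((p, t), \<zeta> (p, t))) (at t)"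
    and anti: "\<And>p t. p \<in> U \<Longrightarrow> \<zeta> (p, t + P) = - \<zeta> (p, t)"
    and Lip: "\<And>p t x y. p \<in> U \<Longrightarrow> ((p, t), x) \<in> W \<Longrightarrow> ((p, t), y) \<in> W \<Longrightarrow>
       norm (H ((p, t), x) - H ((p, t), y)) \<le> norm (x - y) / P"
    and "p \<in> U" "e > 0"
  obtains d where "d > 0" "\<And>q t. norm (q - p) < d \<Longrightarrow> q \<in> U \<and> norm (\<zeta> (q, t) - \<zeta> (p, t)) \<le> e"
proof -
  have cont: "continuous_on S (\<lambda>t. \<zeta> (p, t))" for S
    using ode[OF \<open>p \<in> U\<close>] by (meson continuous_at_imp_continuous_on has_vector_derivative_continuous)
  define K where "K = (\<lambda>t. ((p, t), \<zeta> (p, t))) ` {0..2*P}"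
  have "compact K" unfolding K_def
    by (intro compact_continuous_image continuous_intros cont) auto
  moreover have "K \<subseteq> W" using W \<open>p \<in> U\<close> by (auto simp: K_def)
  moreover have "e / P > 0" using \<open>e > 0\<close> \<open>P > 0\<close> by simp
  ultimately obtain d where d: "d > 0" "\<And>x y. x \<in> K \<Longrightarrow> dist y x < d \<Longrightarrow> y \<in> W \<and> dist (H y) (H x) < e / P"
    using uniformly_continuous_near_compact[OF \<open>open W\<close> \<open>continuous_on W H\<close>] by metis
  obtain d0 where d0: "d0 > 0" "ball p d0 \<subseteq> U" using \<open>open U\<close> \<open>p \<in> U\<close> openE by blast
  show ?thesis
  proof (rule that[of "min d d0"])
    fix q t assume q: "norm (q - p) < min d d0"
    then have qU: "q \<in> U" using d0 by (auto simp: dist_norm norm_minus_commute subset_eq)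
    \<comment> \<open>The difference of two solutions obeys an antiperiodic problem with \<kappa> =
      1 / P: changing the state costs the Lipschitz constant, changing the parameter costs
      \<open>e / P\<close>, measured along the compact arc \<open>K\<close>. The factor
      \<open>2 - 1\<close> makes the resulting bound exactly \<open>e\<close>.\<close>
    have "(2 - 1 / P * P) * norm (\<zeta> (q, t) - \<zeta> (p, t)) \<le> e / P * P"
    proof (rule antiperiodic_norm_bound[OF \<open>P > 0\<close>])
      show "((\<lambda>t. \<zeta> (q, t) - \<zeta> (p, t)) has_vector_derivative
          H ((q, t), \<zeta> (q, t)) - H ((p, t), \<zeta> (p, t))) (at t)" for t
        by (intro has_vector_derivative_diff ode qU \<open>p \<in> U\<close>)
      show "\<zeta> (q, t + P) - \<zeta> (p, t + P) = - (\<zeta> (q, t) - \<zeta> (p, t))" for t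
        by (simp add: anti qU \<open>p \<in> U\<close>)
      fix t assume "t \<in> {0..2*P}"
      then have "((p, t), \<zeta> (p, t)) \<in> K" by (simp add: K_def)
      moreover have "dist ((q, t), \<zeta> (p, t)) ((p, t), \<zeta> (p, t)) < d" using q by (simp add: dist_Pair_Pair dist_norm)
      ultimately have a: "((q, t), \<zeta> (p, t)) \<in> W" "norm (H ((q, t), \<zeta> (p, t)) - H ((p, t), \<zeta> (p, t))) < e / P"
        using d(2) unfolding dist_norm by blast+
      have "norm (H ((q, t), \<zeta> (q, t)) - H ((p, t), \<zeta> (p, t))) \<le> 
        norm (H ((q, t), \<zeta> (q, t)) - H ((q, t), \<zeta> (p, t))) + norm (H ((q, t), \<zeta> (p, t)) - H ((p, t), \<zeta> (p, t)))"
        using norm_triangle_ineq[of "H ((q, t), \<zeta> (q, t)) - H ((q, t), \<zeta> (p, t))" "H ((q, t), \<zeta> (p, t)) - H ((p, t), \<zeta> (p, t))"] by simp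
      then show "norm (H ((q, t), \<zeta> (q, t)) - H ((p, t), \<zeta> (p, t))) \<le> 1 / P * norm (\<zeta> (q, t) - \<zeta> (p, t)) + e / P"
        using Lip[OF qU W[OF qU] a(1)] a(2) by simp
    qed (use \<open>P > 0\<close> in auto)
    then show "q \<in> U \<and> norm (\<zeta> (q, t) - \<zeta> (p, t)) \<le> e" using qU \<open>P > 0\<close> by simp
  qed (use d d0 in auto)
qed

lemma antiperiodic_linear_solution_exists:
  fixes A :: "real \<Rightarrow> 'a::euclidean_space \<Rightarrow>\<^sub>L 'a" and b :: "real \<Rightarrow> 'a"
  assumes "P > 0" "continuous_on UNIV A" "continuous_on UNIV b"
    and A: "\<And>t x. norm (A t x) \<le> norm x / P" "\<And>t. A (t + P) = A t" and b: "\<And>t. b (t + P) = - b t"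
  obtains f where "\<And>t. (f has_vector_derivative A t (f t) + b t) (at t)" "\<And>t. f (t + P) = - f t"
proof -
  obtain t0 where t0: "\<And>t. norm (b t) \<le> norm (b t0)"
    using norm_periodic_attains_sup[OF assms(1,3)] b by (metis norm_minus_cancel)
  define h where "h x = A (fst x) (snd x) + b (fst x)" for x
  have "continuous_on (UNIV \<times> cball 0 (P * norm (b t0))) h"
    unfolding h_def
    by (intro continuous_intros continuous_on_compose2[OF assms(2)] continuous_on_compose2[OF assms(3)]) auto
  moreover have "norm (h (t, x) - h (t, y)) \<le> norm (x - y) / P" for t x y
    using A(1)[of t "x - y"] by (simp add: h_def blinfun.diff_right)
  moreover have "norm (h (t, 0)) \<le> P * norm (b t0) / P" for t
    using t0 \<open>P > 0\<close> by (simp add: h_def)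
  moreover have "h (t + P, - x) = - h (t, x)" for t x
    using A(2) b by (simp add: h_def blinfun.minus_right)
  ultimately obtain f where f: "\<And>t. (f has_vector_derivative h (t, f t)) (at t)" "\<And>t. f (t + P) = - f t"
    using antiperiodic_solution_exists[OF \<open>P > 0\<close>, of "P * norm (b t0)" h] \<open>P > 0\<close>
    by (metis mult_nonneg_nonneg norm_ge_zero less_imp_le)
  show ?thesis by (rule that[of f]) (use f in \<open>auto simp: h_def\<close>)
qed

lemma Ck_on_blinfun_apply_compose:
  fixes F :: "'b::euclidean_space \<Rightarrow> 'c::euclidean_space \<Rightarrow>\<^sub>L 'd::real_normed_vector"
    and f :: "'a::euclidean_space \<Rightarrow> 'b"
  assumes "open S" "open T" "\<And>v. Ck_on k T (\<lambda>x. F x v)" "Ck_on k S f" "\<And>x. x \<in> S \<Longrightarrow> f x \<in> T" "Ck_on k S g"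
  shows "Ck_on k S (\<lambda>x. F (f x) (g x))"
proof -
  have "Ck_on k S (\<lambda>x. \<Sum>i\<in>Basis. (g x \<bullet> i) *\<^sub>R F (f x) i)"
    by (intro Ck_on_sum Ck_on_scaleR Ck_on_bounded_linear_compose[OF bounded_linear_inner_left]
        Ck_on_compose[OF assms(1,2) _ assms(4,3)] assms) (use assms(5) in auto)
  moreover have "(\<Sum>i\<in>Basis. (g x \<bullet> i) *\<^sub>R F (f x) i) = F (f x) (g x)" for x
  proof -
    have "(\<Sum>i\<in>Basis. (g x \<bullet> i) *\<^sub>R F (f x) i) = F (f x) (\<Sum>i\<in>Basis. (g x \<bullet> i) *\<^sub>R i)"
      by (simp add: blinfun.sum_right blinfun.scaleR_right)
    then show ?thesis by (simp add: euclidean_representation)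
  qed
  ultimately show ?thesis by simp
qed

text \<open>The derivative of the solution in a parameter direction solves the linearized equation, which is
  again an antiperiodic problem for the same state space.  The induction on the order of
  differentiability therefore quantifies over all equations \<open>H\<close>.\<close>

lemma Ck_on_antiperiodic_solutions:
  fixes H :: "('p::euclidean_space \<times> real) \<times> 'a::euclidean_space \<Rightarrow> 'a" and \<zeta> :: "'p \<times> real \<Rightarrow> 'a"
  assumes P: "P > 0" and U: "open U" and "open W" "Ck_on k W H"
    and "\<And>p t. p \<in> U \<Longrightarrow> ((p, t), \<zeta> (p, t)) \<in> W"
    and "\<And>p t. p \<in> U \<Longrightarrow> ((\<lambda>t. \<zeta> (p, t)) has_vector_derivative H ((p, t), \<zeta> (p, t))) (at t)"
    and "\<And>p t. p \<in> U \<Longrightarrow> \<zeta> (p, t + P) = - \<zeta> (p, t)"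
    and "\<And>p t x. ((p, t), x) \<in> W \<Longrightarrow> ((p, t + P), - x) \<in> W \<and> H ((p, t + P), - x) = - H ((p, t), x)"
    and "\<And>p t x y. p \<in> U \<Longrightarrow> ((p, t), x) \<in> W \<Longrightarrow> ((p, t), y) \<in> W \<Longrightarrow>
       norm (H ((p, t), x) - H ((p, t), y)) \<le> norm (x - y) / P"
  shows "Ck_on k (U \<times> UNIV) \<zeta>"
  using assms(3-)
proof (induction k arbitrary: H W \<zeta>)
  case (0 H W \<zeta>)
  have "continuous (at (p, t)) \<zeta>" if pU: "p \<in> U" for p t
    unfolding continuous_at_eps_delta
  proof (intro allI impI)
    fix e :: real assume "e > 0"
    \<comment> \<open>Moving the parameter is controlled uniformly in time, so it can be done at the
      new time \<open>s\<close>; the time is then changed at the fixed parameter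
      \<open>p\<close>.\<close>
    obtain d1 where d1: "d1 > 0" "\<And>q t. norm (q - p) < d1 \<Longrightarrow> q \<in> U \<and> norm (\<zeta> (q, t) - \<zeta> (p, t)) \<le> e / 3"
      using antiperiodic_solutions_continuous[OF P U 0(1) _ 0(3,4,5) 0(7) pU, of "e / 3"] 0(2) \<open>e > 0\<close> by auto
    have "isCont (\<lambda>t. \<zeta> (p, t)) t" using 0(4)[OF pU] has_vector_derivative_continuous by blast
    then obtain d2 where d2: "d2 > 0" "\<And>s. dist s t < d2 \<Longrightarrow> dist (\<zeta> (p, s)) (\<zeta> (p, t)) < e / 3"
      unfolding continuous_at_eps_delta using \<open>e > 0\<close> by (metis divide_pos_pos zero_less_numeral)
    show "\<exists>d>0. \<forall>x'. dist x' (p, t) < d \<longrightarrow> dist (\<zeta> x') (\<zeta> (p, t)) < e"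
    proof (intro exI[of _ "min d1 d2"] conjI allI impI)
      fix x' assume x': "dist x' (p, t) < min d1 d2"
      obtain q s where qs: "x' = (q, s)" by (cases x')
      have "dist q p < d1" "dist s t < d2"
        using x' dist_fst_le[of x' "(p, t)"] dist_snd_le[of x' "(p, t)"] by (auto simp: qs)
      then have "dist (\<zeta> (q, s)) (\<zeta> (p, s)) \<le> e / 3" "dist (\<zeta> (p, s)) (\<zeta> (p, t)) < e / 3"
        using d1(2)[of q s] d2(2) by (auto simp: dist_norm)
      then show "dist (\<zeta> x') (\<zeta> (p, t)) < e"
        using dist_triangle[of "\<zeta> (q, s)" "\<zeta> (p, t)" "\<zeta> (p, s)"] \<open>e > 0\<close> by (simp add: qs)
    qed (use d1 d2 in auto)
  qed
  then show ?case by (auto intro: continuous_at_imp_continuous_on)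
next
  case (Suc k H W \<zeta>)
  note W = Suc.prems(3) and ode = Suc.prems(4) and anti = Suc.prems(5) and per = Suc.prems(6) and Lip = Suc.prems(7)
  have op: "open (U \<times> (UNIV :: real set))" using U by (auto intro: open_Times)
  \<comment> \<open>The induction hypothesis already gives order \<open>k\<close> for \<zeta>
    itself, which enters the coefficients of the linearized equation.\<close>
  have \<zeta>k: "Ck_on k (U \<times> UNIV) \<zeta>"
    by (rule Suc.IH[OF Suc.prems(1) Ck_on_SucD[OF Suc.prems(2)] Suc.prems(3-7)])
  have \<zeta>_cont: "continuous_on (U \<times> UNIV) \<zeta>" using \<zeta>k Ck_on_imp_continuous_on by blast
  obtain DH where DH_cont: "continuous_on W DH"
    and DH: "\<And>x. x \<in> W \<Longrightarrow> (H has_derivative blinfun_apply (DH x)) (at x)"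
    and DH_Ck: "\<And>v. Ck_on k W (\<lambda>x. DH x v)"
    using Ck_on_continuous_blinfun[OF Suc.prems(2,1)] by blast
  \<comment> \<open>The linearized equation inherits the Lipschitz constant \<open>1 / P\<close>, so
    solvability and the induction hypothesis apply to it without loss.\<close>
  have DH_le: "norm (DH ((p, t), \<zeta> (p, t)) (0, x)) \<le> norm x / P" if "p \<in> U" for p t x
  proof -
    have "((\<lambda>x. ((p, t), x)) has_derivative (\<lambda>x. (0, x))) (at (\<zeta> (p, t)))"
      by (auto intro!: derivative_eq_intros simp: zero_prod_def)
    from diff_chain_at[OF this DH[OF W[OF that]]]
    have "((\<lambda>x. H ((p, t), x)) has_derivative (\<lambda>x. DH ((p, t), \<zeta> (p, t)) (0, x))) (at (\<zeta> (p, t)))"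
      by (simp add: o_def)
    moreover have "open ((\<lambda>x. ((p, t), x)) -` W)"
      by (rule open_vimage[OF Suc.prems(1)]) (auto intro!: continuous_intros)
    ultimately have "norm (DH ((p, t), \<zeta> (p, t)) (0, x)) \<le> 1 / P * norm x"
      by (rule has_derivative_norm_le_Lipschitz) (use W Lip that in auto)
    then show ?thesis by simp
  qed
  \<comment> \<open>Differentiate the symmetry \<open>H (\<sigma> X) = - H X\<close>, where the
    linear part of \<sigma> is \<open>(v, w) \<mapsto> (v, - w)\<close>.\<close>
  have DH_per: "DH ((p, t + P), - x) (v, - w) = - DH ((p, t), x) (v, w)" if "((p, t), x) \<in> W" for p t x v w
  proof -
    define \<sigma> where "\<sigma> X = ((fst (fst X), snd (fst X) + P), - snd X)" for X :: "('p \<times> real) \<times> 'a"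
    have W': "((p, t + P), - x) \<in> W" using per that by blast
    have "(\<sigma> has_derivative (\<lambda>V. (fst V, - snd V))) (at ((p, t), x))"
      unfolding \<sigma>_def by (rule has_derivative_eq_rhs, (rule derivative_intros)+) (auto simp: fun_eq_iff)
    from diff_chain_at[OF this, of H "DH ((p, t + P), - x)"] DH[OF W']
    have "((\<lambda>X. H (\<sigma> X)) has_derivative (\<lambda>V. DH ((p, t + P), - x) (fst V, - snd V))) (at ((p, t), x))"
      by (simp add: o_def \<sigma>_def)
    then have "((\<lambda>X. - H X) has_derivative (\<lambda>V. DH ((p, t + P), - x) (fst V, - snd V))) (at ((p, t), x))"
      by (rule has_derivative_transform_within_open[OF _ Suc.prems(1) that]) (use per in \<open>auto simp: \<sigma>_def\<close>)
    moreover have "((\<lambda>X. - H X) has_derivative (\<lambda>V. - DH ((p, t), x) V)) (at ((p, t), x))"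
      using DH[OF that] by (rule has_derivative_minus)
    ultimately have "(\<lambda>V. DH ((p, t + P), - x) (fst V, - snd V)) = (\<lambda>V. - DH ((p, t), x) V)"
      by (rule has_derivative_unique)
    from fun_cong[OF this, of "(v, w)"] show ?thesis by simp
  qed
  \<comment> \<open>Right-hand side of the equation for the derivative of \<zeta> in the parameter
    direction \<open>b\<close>; a single application of \<open>DH\<close> contains both the forcing
    \<open>(b, 0)\<close> and the linear part.\<close>
  define G where "G b Z = DH (fst Z, \<zeta> (fst Z)) ((b, 0), snd Z)" for b and Z :: "('p \<times> real) \<times> 'a"
  have \<zeta>p_cont: "continuous_on S (\<lambda>t. \<zeta> (p, t))" if "p \<in> U" for p S
    using ode[OF that] by (meson continuous_at_imp_continuous_on has_vector_derivative_continuous)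
  have ex: "\<exists>f. (\<forall>t. (f has_vector_derivative G b ((p, t), f t)) (at t)) \<and> (\<forall>t. f (t + P) = - f t)" if "p \<in> U" for b p
  proof -
    define J :: "'a \<Rightarrow>\<^sub>L (('p \<times> real) \<times> 'a)" where "J = Blinfun (\<lambda>x. (0, x))"
    have J: "blinfun_apply J x = (0, x)" for x
      unfolding J_def by (subst bounded_linear_Blinfun_apply) (auto intro!: bounded_linear_intros)
    have c: "continuous_on UNIV (\<lambda>t. DH ((p, t), \<zeta> (p, t)))"
      by (rule continuous_on_compose2[OF DH_cont]) (use W that in \<open>auto intro!: continuous_intros \<zeta>p_cont\<close>)
    have c1: "continuous_on UNIV (\<lambda>t. DH ((p, t), \<zeta> (p, t)) o\<^sub>L J)"
      by (intro continuous_intros c)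
    have c2: "continuous_on UNIV (\<lambda>t. DH ((p, t), \<zeta> (p, t)) ((b, 0), 0))"
      by (intro continuous_intros c)
    have "DH ((p, t + P), \<zeta> (p, t + P)) o\<^sub>L J = DH ((p, t), \<zeta> (p, t)) o\<^sub>L J" for t
    proof (rule blinfun_eqI)
      fix x
      have "DH ((p, t + P), - \<zeta> (p, t)) (0, - (- x)) = - DH ((p, t), \<zeta> (p, t)) (0, - x)"
        by (rule DH_per) (use W that in auto)
      also have "\<dots> = DH ((p, t), \<zeta> (p, t)) (0, x)"
        using blinfun.minus_right[of "DH ((p, t), \<zeta> (p, t))" "(0, - x)"] by simp
      finally show "(DH ((p, t + P), \<zeta> (p, t + P)) o\<^sub>L J) x = (DH ((p, t), \<zeta> (p, t)) o\<^sub>L J) x"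
        by (simp add: J anti that)
    qed
    moreover have "DH ((p, t + P), \<zeta> (p, t + P)) ((b, 0), 0) = - DH ((p, t), \<zeta> (p, t)) ((b, 0), 0)" for t
      using DH_per[OF W[OF that], of t "(b, 0)" 0] by (simp add: anti that)
    moreover have "norm ((DH ((p, t), \<zeta> (p, t)) o\<^sub>L J) x) \<le> norm x / P" for t x
      using DH_le[OF that] by (simp add: J)
    ultimately obtain f where f: "\<And>t. (f has_vector_derivative (DH ((p, t), \<zeta> (p, t)) o\<^sub>L J) (f t) + DH ((p, t), \<zeta> (p, t)) ((b, 0), 0)) (at t)"
       "\<And>t. f (t + P) = - f t"
      using antiperiodic_linear_solution_exists[OF P c1 c2] by metis
    have "(DH ((p, t), \<zeta> (p, t)) o\<^sub>L J) (f t) + DH ((p, t), \<zeta> (p, t)) ((b, 0), 0) = G b ((p, t), f t)" for t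
      by (simp add: G_def J flip: blinfun.add_right)
    with f show ?thesis by auto
  qed
  define f where "f p b = (SOME f. (\<forall>t. (f has_vector_derivative G b ((p, t), f t)) (at t)) \<and> (\<forall>t. f (t + P) = - f t))" for p b
  have f: "(\<forall>t. (f p b has_vector_derivative G b ((p, t), f p b t)) (at t)) \<and> (\<forall>t. f p b (t + P) = - f p b t)"
    if "p \<in> U" for p b
    unfolding f_def by (rule someI_ex[OF ex[OF that]])
  define Y where "Y b x = f (fst x) b (snd x)" for b x
  have Y: "((\<lambda>t. Y b (p, t)) has_vector_derivative G b ((p, t), Y b (p, t))) (at t)"
    and Y_anti: "Y b (p, t + P) = - Y b (p, t)" if "p \<in> U" for b p t
    using f[OF that] by (auto simp: Y_def)
  have G_Ck: "Ck_on k ((U \<times> UNIV) \<times> UNIV) (G b)" for b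
    unfolding G_def
    by (intro Ck_on_blinfun_apply_compose[OF _ Suc.prems(1) DH_Ck] Ck_on_Pair Ck_on_const
          Ck_on_compose[OF _ op _ _ \<zeta>k] Ck_on_bounded_linear_compose[OF bounded_linear_fst]
          Ck_on_bounded_linear_compose[OF bounded_linear_snd] Ck_on_ident)
      (use op W in \<open>auto intro!: open_Times\<close>)
  have Y_Ck: "Ck_on k (U \<times> UNIV) (Y b)" for b
  proof (rule Suc.IH[OF _ G_Ck _ Y Y_anti])
    show "open ((U \<times> (UNIV :: real set)) \<times> (UNIV :: 'a set))" using op by (auto intro: open_Times)
    show "((p, t + P), - x) \<in> (U \<times> UNIV) \<times> UNIV \<and> G b ((p, t + P), - x) = - G b ((p, t), x)"
      if "((p, t), x) \<in> (U \<times> UNIV) \<times> UNIV" for p t x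
      using that DH_per[OF W, of p t "(b, 0)" x] anti by (auto simp: G_def)
    show "norm (G b ((p, t), x) - G b ((p, t), y)) \<le> norm (x - y) / P" if "p \<in> U" for p t x y
      using DH_le[OF that, of t "x - y"] by (simp add: G_def flip: blinfun.diff_right)
  qed auto
  \<comment> \<open>Candidate for the derivative in the parameter. Assembling it from the basis
    directions makes it linear in \<open>v\<close> by construction; solutions chosen separately for
    every \<open>v\<close> would be linear only by uniqueness.\<close>
  define D where "D p t v = (\<Sum>b\<in>Basis. (v \<bullet> b) *\<^sub>R Y b (p, t))" for p t v
  have D_der: "((\<lambda>t. D p t v) has_vector_derivative DH ((p, t), \<zeta> (p, t)) ((v, 0), D p t v)) (at t)" if "p \<in> U" for p t v
  proof -
    have "((\<lambda>t. D p t v) has_vector_derivative (\<Sum>b\<in>Basis. (v \<bullet> b) *\<^sub>R G b ((p, t), Y b (p, t)))) (at t)"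
      unfolding D_def
      by (intro has_vector_derivative_sum bounded_linear.has_vector_derivative[OF bounded_linear_scaleR_right] Y that)
    moreover have "(\<Sum>b\<in>Basis. (v \<bullet> b) *\<^sub>R G b ((p, t), Y b (p, t)))
        = DH ((p, t), \<zeta> (p, t)) (\<Sum>b\<in>Basis. (v \<bullet> b) *\<^sub>R ((b, 0), Y b (p, t)))"
      by (simp only: G_def blinfun.sum_right blinfun.scaleR_right fst_conv snd_conv)
    moreover have "(\<Sum>b\<in>Basis. (v \<bullet> b) *\<^sub>R ((b, 0 :: real), Y b (p, t))) = ((v, 0), D p t v)"
      by (simp add: prod_eq_iff fst_sum snd_sum D_def euclidean_representation)
    ultimately show ?thesis by simp
  qed
  have D_lin: "D p t (v + w) = D p t v + D p t w" "D p t (c *\<^sub>R v) = c *\<^sub>R D p t v" for p t v w c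
    by (simp_all add: D_def inner_add_left scaleR_add_left sum.distrib scaleR_sum_right)
  have partial_p: "((\<lambda>q. \<zeta> (q, t)) has_derivative D p t) (at p)" if pU: "p \<in> U" for p t
  proof -
    have "\<exists>M. \<forall>t. norm (Y b (p, t)) \<le> M" for b
    proof -
      have "continuous_on UNIV (\<lambda>t. Y b (p, t))"
        using Y[OF pU] by (meson continuous_at_imp_continuous_on has_vector_derivative_continuous)
      then show ?thesis
        using norm_periodic_attains_sup[OF P, of "\<lambda>t. Y b (p, t)"] Y_anti[OF pU] by (metis norm_minus_cancel)
    qed
    then obtain M where M: "\<And>b t. norm (Y b (p, t)) \<le> M b" by metis
    define C where "C = (\<Sum>b\<in>(Basis :: 'p set). M b)"
    have "0 \<le> C" unfolding C_def using M by (intro sum_nonneg) (meson norm_ge_zero order_trans)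
    have D_le: "norm (D p t v) \<le> C * norm v" for t v
    proof -
      have "norm (D p t v) \<le> (\<Sum>b\<in>Basis. norm v * M b)"
        unfolding D_def by (intro sum_norm_le) (use M Basis_le_norm in \<open>auto intro!: mult_mono\<close>)
      then show ?thesis by (simp add: C_def sum_distrib_right mult.commute sum_distrib_left)
    qed
    define K where "K = (\<lambda>t. ((p, t), \<zeta> (p, t))) ` {0..2*P}"
    have "compact K" unfolding K_def
      by (intro compact_continuous_image continuous_intros \<zeta>p_cont[OF pU]) auto
    moreover have "K \<subseteq> W" using W pU by (auto simp: K_def)
    ultimately have lin: "\<exists>d>0. \<forall>x y. x \<in> K \<longrightarrow> norm (y - x) < d \<longrightarrow>
         y \<in> W \<and> norm (H y - H x - DH x (y - x)) \<le> \<epsilon> * norm (y - x)" if "\<epsilon> > 0" for \<epsilon>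
      using uniform_linearization_near_compact[OF Suc.prems(1) DH_cont DH _ _ that] by metis
    show ?thesis
      unfolding has_derivative_at_alt
    proof (intro conjI allI impI)
      show "bounded_linear (D p t)"
        by (rule bounded_linear_intro[of _ C]) (use D_lin D_le in \<open>auto simp: mult.commute\<close>)
      fix e :: real assume "e > 0"
      \<comment> \<open>The first bound keeps \<open>2 - (1 / P + \<epsilon>) * P\<close> at least
        1/2; the second makes the resulting constant \<open>2 * P * \<epsilon> * (1 + C)\<close> at
        most \<open>e\<close>.\<close>
      define \<epsilon> where "\<epsilon> = min (1 / (2 * P)) (e / (2 * P * (1 + C)))"
      have \<epsilon>: "\<epsilon> > 0" "\<epsilon> * P \<le> 1 / 2" "2 * P * \<epsilon> * (1 + C) \<le> e"
      proof -
        show "\<epsilon> > 0" using P \<open>e > 0\<close> \<open>0 \<le> C\<close> by (simp add: \<epsilon>_def)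
        have "\<epsilon> \<le> 1 / (2 * P)" "\<epsilon> \<le> e / (2 * P * (1 + C))" by (simp_all add: \<epsilon>_def)
        moreover have "2 * P * (1 + C) > 0" using P \<open>0 \<le> C\<close> by simp
        ultimately show "\<epsilon> * P \<le> 1 / 2" "2 * P * \<epsilon> * (1 + C) \<le> e"
          using P by (simp_all only: pos_le_divide_eq) (simp_all add: algebra_simps)
      qed
      obtain d where d: "d > 0" "\<And>x y. x \<in> K \<Longrightarrow> norm (y - x) < d \<Longrightarrow>
         y \<in> W \<and> norm (H y - H x - DH x (y - x)) \<le> \<epsilon> * norm (y - x)"
        using lin[OF \<epsilon>(1)] by blast
      obtain d2 where d2: "d2 > 0" "\<And>q t. norm (q - p) < d2 \<Longrightarrow> q \<in> U \<and> norm (\<zeta> (q, t) - \<zeta> (p, t)) \<le> d / 2"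
        using antiperiodic_solutions_continuous[OF P U Suc.prems(1) Ck_on_imp_continuous_on[OF Suc.prems(2)] W ode anti Lip pU, of "d / 2"] d(1)
        by auto
      show "\<exists>d>0. \<forall>q. norm (q - p) < d \<longrightarrow> norm (\<zeta> (q, t) - \<zeta> (p, t) - D p t (q - p)) \<le> e * norm (q - p)"
      proof (intro exI[of _ "min d2 (d / 2)"] conjI allI impI)
        fix q assume q: "norm (q - p) < min d2 (d / 2)"
        then have qU: "q \<in> U" and \<zeta>_near: "\<And>t. norm (\<zeta> (q, t) - \<zeta> (p, t)) \<le> d / 2" using d2(2) by auto
        define \<phi> where "\<phi> t = \<zeta> (q, t) - \<zeta> (p, t) - D p t (q - p)" for t
        have "(2 - (1 / P + \<epsilon>) * P) * norm (\<phi> t) \<le> (\<epsilon> * (1 + C) * norm (q - p)) * P"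
        proof (rule antiperiodic_norm_bound[OF P])
          show "(\<phi> has_vector_derivative H ((q, t), \<zeta> (q, t)) - H ((p, t), \<zeta> (p, t))
              - DH ((p, t), \<zeta> (p, t)) ((q - p, 0), D p t (q - p))) (at t)" for t
            unfolding \<phi>_def by (intro has_vector_derivative_diff ode D_der qU pU)
          show "\<phi> (t + P) = - \<phi> t" for t
            by (simp add: \<phi>_def anti qU pU D_def Y_anti sum_negf)
          fix t assume "t \<in> {0..2*P}"
          then have K: "((p, t), \<zeta> (p, t)) \<in> K" by (simp add: K_def)
          define \<Delta> where "\<Delta> = ((q - p, 0 :: real), \<zeta> (q, t) - \<zeta> (p, t))"
          have \<Delta>: "((q, t), \<zeta> (q, t)) - ((p, t), \<zeta> (p, t)) = \<Delta>" by (simp add: \<Delta>_def)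
          have n: "norm \<Delta> \<le> norm (q - p) + norm (\<zeta> (q, t) - \<zeta> (p, t))"
            unfolding \<Delta>_def using norm_Pair_le[of "(q - p, 0 :: real)" "\<zeta> (q, t) - \<zeta> (p, t)"] by (simp add: norm_Pair)
          also have "\<dots> < d" using q \<zeta>_near[of t] by simp
          finally have r: "norm (H ((q, t), \<zeta> (q, t)) - H ((p, t), \<zeta> (p, t)) - DH ((p, t), \<zeta> (p, t)) \<Delta>) \<le> \<epsilon> * norm \<Delta>"
            using d(2)[OF K, of "((q, t), \<zeta> (q, t))"] unfolding \<Delta> by blast
          have "\<zeta> (q, t) - \<zeta> (p, t) = \<phi> t + D p t (q - p)" by (simp add: \<phi>_def)
          then have "norm (\<zeta> (q, t) - \<zeta> (p, t)) \<le> norm (\<phi> t) + C * norm (q - p)"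
            using norm_triangle_ineq[of "\<phi> t" "D p t (q - p)"] D_le[of t "q - p"] by simp
          then have "\<epsilon> * norm \<Delta> \<le> \<epsilon> * (norm (q - p) + (norm (\<phi> t) + C * norm (q - p)))"
            using n \<epsilon>(1) by (intro mult_left_mono) auto
          moreover have "H ((q, t), \<zeta> (q, t)) - H ((p, t), \<zeta> (p, t)) - DH ((p, t), \<zeta> (p, t)) ((q - p, 0), D p t (q - p))
             = (H ((q, t), \<zeta> (q, t)) - H ((p, t), \<zeta> (p, t)) - DH ((p, t), \<zeta> (p, t)) \<Delta>) + DH ((p, t), \<zeta> (p, t)) (0, \<phi> t)"
          proof -
            have "\<Delta> = ((q - p, 0), D p t (q - p)) + (0, \<phi> t)" by (simp add: \<Delta>_def \<phi>_def)
            then have "DH ((p, t), \<zeta> (p, t)) \<Delta>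
                = DH ((p, t), \<zeta> (p, t)) ((q - p, 0), D p t (q - p)) + DH ((p, t), \<zeta> (p, t)) (0, \<phi> t)"
              by (simp only: blinfun.add_right)
            then show ?thesis by simp
          qed
          ultimately show "norm (H ((q, t), \<zeta> (q, t)) - H ((p, t), \<zeta> (p, t)) - DH ((p, t), \<zeta> (p, t)) ((q - p, 0), D p t (q - p)))
              \<le> (1 / P + \<epsilon>) * norm (\<phi> t) + \<epsilon> * (1 + C) * norm (q - p)"
            using norm_triangle_ineq[of "H ((q, t), \<zeta> (q, t)) - H ((p, t), \<zeta> (p, t)) - DH ((p, t), \<zeta> (p, t)) \<Delta>" "DH ((p, t), \<zeta> (p, t)) (0, \<phi> t)"]
              r DH_le[OF pU, of t "\<phi> t"] by (simp add: algebra_simps)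
        qed (use P \<epsilon> in \<open>auto simp: algebra_simps\<close>)
        moreover have "1 / 2 * norm (\<phi> t) \<le> (2 - (1 / P + \<epsilon>) * P) * norm (\<phi> t)"
          using \<epsilon>(2) P by (intro mult_right_mono) (auto simp: algebra_simps)
        ultimately have "norm (\<phi> t) \<le> 2 * P * \<epsilon> * (1 + C) * norm (q - p)" by (simp add: algebra_simps)
        also have "\<dots> \<le> e * norm (q - p)" using \<epsilon>(3) by (intro mult_right_mono) auto
        finally show "norm (\<zeta> (q, t) - \<zeta> (p, t) - D p t (q - p)) \<le> e * norm (q - p)" by (simp add: \<phi>_def)
      qed (use d d2 in auto)
    qed
  qed
  have \<zeta>H: "Ck_on k (U \<times> UNIV) (\<lambda>x. H (x, \<zeta> x))"
    by (rule Ck_on_compose[OF op Suc.prems(1) _ _ Ck_on_SucD[OF Suc.prems(2)]])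
      (use W in \<open>auto intro!: Ck_on_Pair op Ck_on_ident \<zeta>k\<close>)
  show ?case
  proof (rule Ck_on_SucI[OF op])
    fix x assume x: "x \<in> U \<times> (UNIV :: real set)"
    then obtain p t where pt: "x = (p, t)" "p \<in> U" by auto
    \<comment> \<open>Partial derivatives combine to a total one if one of them is continuous. The
      time derivative is the convenient choice, being \<open>H\<close> along the solution.\<close>
    have "((\<lambda>(p, t). \<zeta> (p, t)) has_derivative
       (\<lambda>(v, \<tau>). D p t v + blinfun_scaleR_left (H ((p, t), \<zeta> (p, t))) \<tau>)) (at (p, t) within U \<times> UNIV)"
    proof (rule has_derivative_partialsI)
      show "((\<lambda>q. \<zeta> (q, t)) has_derivative D p t) (at p within U)"
        using partial_p[OF pt(2)] by (rule has_derivative_at_withinI)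
      show "((\<lambda>t. \<zeta> (q, t)) has_derivative blinfun_apply (blinfun_scaleR_left (H ((q, s), \<zeta> (q, s))))) (at s)" if "q \<in> U" for q s
        using ode[OF that] by (simp add: has_vector_derivative_def)
      have "continuous_on (U \<times> UNIV) (\<lambda>x. blinfun_scaleR_left (H (x, \<zeta> x)))"
        by (intro bounded_linear.continuous_on[OF bounded_linear_blinfun_scaleR_left] Ck_on_imp_continuous_on[OF \<zeta>H])
      moreover have "(\<lambda>x. blinfun_scaleR_left (H (x, \<zeta> x))) = (\<lambda>(q, s). blinfun_scaleR_left (H ((q, s), \<zeta> (q, s))))"
        by auto
      ultimately show "continuous (at (p, t) within U \<times> UNIV) (\<lambda>(q, s). blinfun_scaleR_left (H ((q, s), \<zeta> (q, s))))"
        using x pt by (simp add: continuous_on_eq_continuous_within)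
    qed auto
    moreover have "(\<lambda>(v, \<tau>). D p t v + blinfun_scaleR_left (H ((p, t), \<zeta> (p, t))) \<tau>)
        = (\<lambda>w. (\<Sum>b\<in>Basis. (fst w \<bullet> b) *\<^sub>R Y b x) + snd w *\<^sub>R H (x, \<zeta> x))"
      by (auto simp: pt(1) D_def)
    ultimately show "(\<zeta> has_derivative (\<lambda>w. (\<Sum>b\<in>Basis. (fst w \<bullet> b) *\<^sub>R Y b x) + snd w *\<^sub>R H (x, \<zeta> x))) (at x)"
      using x by (simp add: pt(1) at_within_open[OF _ op])
  next
    show "Ck_on k (U \<times> UNIV) (\<lambda>x. (\<Sum>b\<in>Basis. (fst w \<bullet> b) *\<^sub>R Y b x) + snd w *\<^sub>R H (x, \<zeta> x))" for w
      by (intro Ck_on_add Ck_on_sum Ck_on_scaleR Ck_on_const op Y_Ck \<zeta>H)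
  qed
qed

text \<open>The bounds are imposed at the single parameter \<open>p0\<close>, with constants half as
  large as the fixed-point argument asks for. The other half absorbs the variation of
  \<open>H\<close> and of its derivative near a compact set, and this determines \<rho>.\<close>

theorem antiperiodic_solution_family:
  fixes H :: "('p::euclidean_space \<times> real) \<times> 'a::euclidean_space \<Rightarrow> 'a"
  assumes P: "P > 0" and W: "open W" and H: "smooth_on W H"
    and W_per: "\<And>p t x. ((p, t + P), - x) \<in> W \<longleftrightarrow> ((p, t), x) \<in> W"
    and H_per: "\<And>p t x. ((p, t), x) \<in> W \<Longrightarrow> H ((p, t + P), - x) = - H ((p, t), x)"
    and r: "0 < r" "r < r0"
    and base: "\<And>t x. norm x < r0 \<Longrightarrow> ((p0, t), x) \<in> W"
    and Lip: "\<And>t x y. norm x < r0 \<Longrightarrow> norm y < r0 \<Longrightarrow>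
      norm (H ((p0, t), x) - H ((p0, t), y)) \<le> norm (x - y) / (2 * P)"
    and small: "\<And>t. norm (H ((p0, t), 0)) \<le> r / (2 * P)"
  obtains \<rho> \<zeta> where "\<rho> > 0" "smooth_on (ball p0 \<rho> \<times> UNIV) \<zeta>"
    "\<And>p t. p \<in> ball p0 \<rho> \<Longrightarrow> ((p, t), \<zeta> (p, t)) \<in> W"
    "\<And>p t. p \<in> ball p0 \<rho> \<Longrightarrow> ((\<lambda>t. \<zeta> (p, t)) has_vector_derivative H ((p, t), \<zeta> (p, t))) (at t)"
    "\<And>p t. p \<in> ball p0 \<rho> \<Longrightarrow> \<zeta> (p, t + P) = - \<zeta> (p, t)"
proof -
  \<comment> \<open>Solutions stay in the ball of radius \<open>r\<close>, the estimates have to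
    hold on a neighbourhood of it, and the compact set \<open>K\<close> must lie in
    \<open>W\<close>: hence a radius strictly between \<open>r\<close> and
    \<open>r0\<close>.\<close>
  define r1 where "r1 = (r + r0) / 2"
  have r1: "r < r1" "r1 < r0" using r by (auto simp: r1_def)
  have "Ck_on (Suc 0) W H" using H unfolding smooth_on_def by blast
  then obtain DH where DH_cont: "continuous_on W DH"
    and DH: "\<And>x. x \<in> W \<Longrightarrow> (H has_derivative blinfun_apply (DH x)) (at x)"
    using Ck_on_continuous_blinfun[OF _ W] by metis
  define K where "K = ({p0} \<times> {0..P}) \<times> cball (0::'a) r1"
  have K: "compact K" "K \<subseteq> W"
    unfolding K_def using base r1(2) by (auto intro!: compact_Times)
  have "1 / (2 * P) > 0" "r / (2 * P) > 0" using P r by auto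
  then obtain \<rho>1 \<rho>2 where \<rho>1: "\<rho>1 > 0" "\<And>x y. x \<in> K \<Longrightarrow> dist y x < \<rho>1 \<Longrightarrow> y \<in> W \<and> dist (DH y) (DH x) < 1 / (2 * P)"
    and \<rho>2: "\<rho>2 > 0" "\<And>x y. x \<in> K \<Longrightarrow> dist y x < \<rho>2 \<Longrightarrow> y \<in> W \<and> dist (H y) (H x) < r / (2 * P)"
    using uniformly_continuous_near_compact[OF W DH_cont K]
      uniformly_continuous_near_compact[OF W smooth_on_imp_continuous_on[OF H] K] by metis
  define \<rho> where "\<rho> = min \<rho>1 \<rho>2"
  have "\<rho> > 0" using \<rho>1 \<rho>2 by (simp add: \<rho>_def)
  define U where "U = ball p0 \<rho>"
  have "open U" by (simp add: U_def)
  have slice: "((\<lambda>x. H ((p, t), x)) has_derivative (\<lambda>v. DH ((p, t), x) (0, v))) (at x)"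
    if "((p, t), x) \<in> W" for p t x
  proof -
    have "((\<lambda>x. ((p, t), x)) has_derivative (\<lambda>x. (0, x))) (at x)"
      by (auto intro!: derivative_eq_intros simp: zero_prod_def)
    from diff_chain_at[OF this DH[OF that]] show ?thesis by (simp add: o_def)
  qed
  have DH_base: "norm (DH ((p0, t), x) (0, v)) \<le> 1 / (2 * P) * norm v" if "norm x \<le> r1" for t x v
  proof (rule has_derivative_norm_le_Lipschitz[OF slice, of _ _ _ "ball 0 r0"])
    show "((p0, t), x) \<in> W" using base that r1 by auto
    show "norm (H ((p0, t), y) - H ((p0, t), x)) \<le> 1 / (2 * P) * norm (y - x)" if "y \<in> ball 0 r0" for y
      using Lip[of y x t] that \<open>norm x \<le> r1\<close> r1(2) by simp
  qed (use that r1 in auto)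
  \<comment> \<open>Invariant under \<open>t + P\<close> in both directions, so that compactness of
    one period suffices; the equivalence \<open>W_per\<close> serves the same purpose.\<close>
  define Q where "Q p t \<longleftrightarrow> (\<forall>x. norm x \<le> r1 \<longrightarrow> ((p, t), x) \<in> W) \<and>
      (\<forall>x y. norm x \<le> r1 \<longrightarrow> norm y \<le> r1 \<longrightarrow> norm (H ((p, t), x) - H ((p, t), y)) \<le> norm (x - y) / P) \<and>
      norm (H ((p, t), 0)) \<le> r / P" for p t
  have Q: "Q p t" if "p \<in> U" for p t
  proof (rule periodic_predicate[OF P])
    have half: "Q p (t + P)" if "Q p t" for t
    proof -
      have H': "H ((p, t + P), x) = - H ((p, t), - x)" "((p, t + P), x) \<in> W" if "norm x \<le> r1" for x
        using H_per[of p t "- x"] W_per[of p t "- x"] \<open>Q p t\<close> that by (auto simp: Q_def)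
      show ?thesis unfolding Q_def
      proof (intro conjI allI impI)
        show "norm (H ((p, t + P), x) - H ((p, t + P), y)) \<le> norm (x - y) / P" if "norm x \<le> r1" "norm y \<le> r1" for x y
        proof -
          have "norm (H ((p, t), - y) - H ((p, t), - x)) \<le> norm (- y - (- x)) / P"
            using \<open>Q p t\<close> that unfolding Q_def by (metis norm_minus_cancel)
          then show ?thesis using that by (simp add: H'(1) norm_minus_commute)
        qed
        show "norm (H ((p, t + P), 0)) \<le> r / P"
          using \<open>Q p t\<close> r1 r by (simp add: H'(1) Q_def)
      qed (use H' in auto)
    qed
    moreover have "Q p t" if "Q p (t + P)" for t
    proof -
      have H': "H ((p, t), x) = - H ((p, t + P), - x)" "((p, t), x) \<in> W" if "norm x \<le> r1" for x
        using H_per[of p t x] W_per[of p t x] \<open>Q p (t + P)\<close> that by (auto simp: Q_def)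
      show ?thesis unfolding Q_def
      proof (intro conjI allI impI)
        show "norm (H ((p, t), x) - H ((p, t), y)) \<le> norm (x - y) / P" if "norm x \<le> r1" "norm y \<le> r1" for x y
        proof -
          have "norm (H ((p, t + P), - y) - H ((p, t + P), - x)) \<le> norm (- y - (- x)) / P"
            using \<open>Q p (t + P)\<close> that unfolding Q_def by (metis norm_minus_cancel)
          then show ?thesis using that by (simp add: H'(1) norm_minus_commute)
        qed
        show "norm (H ((p, t), 0)) \<le> r / P"
          using \<open>Q p (t + P)\<close> r1 r by (simp add: H'(1) Q_def)
      qed (use H' in auto)
    qed
    ultimately show "Q p (t + P) \<longleftrightarrow> Q p t" for t by blast
  next
    fix t assume t: "t \<in> {0..P}"
    have near: "((p0, t), x) \<in> K" "dist ((p, t), x) ((p0, t), x) < \<rho>" if "norm x \<le> r1" for x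
      using that t \<open>p \<in> U\<close> by (auto simp: K_def U_def dist_Pair_Pair dist_commute)
    have inW: "((p, t), x) \<in> W" if "norm x \<le> r1" for x
      using near[OF that] \<rho>1(2)[of "((p0, t), x)" "((p, t), x)"] by (simp add: \<rho>_def)
    have D_le: "norm (DH ((p, t), x) (0, v)) \<le> 1 / P * norm v" if "norm x \<le> r1" for x v
    proof -
      have "norm (DH ((p, t), x) - DH ((p0, t), x)) \<le> 1 / (2 * P)"
        using near[OF that] \<rho>1(2)[of "((p0, t), x)" "((p, t), x)"] by (auto simp: \<rho>_def dist_norm)
      then have "norm ((DH ((p, t), x) - DH ((p0, t), x)) (0, v)) \<le> 1 / (2 * P) * norm v"
        using P by (intro order_trans[OF norm_blinfun] mult_mono) (auto simp: norm_Pair)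
      then have "norm (DH ((p, t), x) (0, v) - DH ((p0, t), x) (0, v)) \<le> 1 / (2 * P) * norm v"
        by (simp add: blinfun.diff_left)
      with DH_base[OF that, of t v] norm_triangle_sub[of "DH ((p, t), x) (0, v)" "DH ((p0, t), x) (0, v)"]
      have "norm (DH ((p, t), x) (0, v)) \<le> 1 / (2 * P) * norm v + 1 / (2 * P) * norm v" by linarith
      then show ?thesis using P by (simp add: field_simps)
    qed
    show "Q p t" unfolding Q_def
    proof (intro conjI allI impI inW)
      fix x y :: 'a assume xy: "norm x \<le> r1" "norm y \<le> r1"
      have "norm (H ((p, t), x) - H ((p, t), y)) \<le> 1 / P * norm (x - y)"
      proof (rule differentiable_bound)
        show "convex (cball (0::'a) r1)" by simp
        show "((\<lambda>x. H ((p, t), x)) has_derivative (\<lambda>v. DH ((p, t), z) (0, v))) (at z within cball 0 r1)"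
          if "z \<in> cball 0 r1" for z
          using slice[OF inW, of z] that by (auto intro: has_derivative_at_withinI)
        show "onorm (\<lambda>v. DH ((p, t), z) (0, v)) \<le> 1 / P" if "z \<in> cball 0 r1" for z
          by (rule onorm_le) (use D_le that in auto)
      qed (use xy in auto)
      then show "norm (H ((p, t), x) - H ((p, t), y)) \<le> norm (x - y) / P" by simp
    next
      have "norm (0::'a) \<le> r1" using r r1 by simp
      from near[OF this] have "dist (H ((p, t), 0)) (H ((p0, t), 0)) < r / (2 * P)"
        using \<rho>2(2)[of "((p0, t), 0)" "((p, t), 0)"] by (auto simp: \<rho>_def)
      then have "norm (H ((p, t), 0)) \<le> r / (2 * P) + r / (2 * P)"
        using small[of t] norm_triangle_sub[of "H ((p, t), 0)" "H ((p0, t), 0)"] by (simp add: dist_norm)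
      then show "norm (H ((p, t), 0)) \<le> r / P" using P by (simp add: field_simps)
    qed
  qed
  have ex: "\<exists>f. (\<forall>t. norm (f t) \<le> r) \<and> (\<forall>t. (f has_vector_derivative H ((p, t), f t)) (at t)) \<and> (\<forall>t. f (t + P) = - f t)"
    if pU: "p \<in> U" for p
  proof -
    define h where "h z = H ((p, fst z), snd z)" for z
    have "continuous_on (UNIV \<times> cball 0 r) h"
      unfolding h_def
      by (rule continuous_on_compose2[OF smooth_on_imp_continuous_on[OF H]])
        (use Q[OF pU] r1 in \<open>auto intro!: continuous_intros simp: Q_def\<close>)
    moreover have "norm (h (t, x) - h (t, y)) \<le> norm (x - y) / P" if "norm x \<le> r" "norm y \<le> r" for t x y
      using Q[OF pU, of t] that r1 by (auto simp: Q_def h_def)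
    moreover have "norm (h (t, 0)) \<le> r / P" for t
      using Q[OF pU, of t] by (auto simp: Q_def h_def)
    moreover have "h (t + P, - x) = - h (t, x)" if "norm x \<le> r" for t x
      using H_per[of p t x] Q[OF pU, of t] that r1 by (auto simp: Q_def h_def)
    ultimately obtain f where "\<And>t. norm (f t) \<le> r" "\<And>t. (f has_vector_derivative h (t, f t)) (at t)"
      "\<And>t. f (t + P) = - f t"
      using antiperiodic_solution_exists[OF P less_imp_le[OF r(1)], of h] by metis
    then show ?thesis by (auto simp: h_def)
  qed
  define \<zeta> where "\<zeta> x = (SOME f. (\<forall>t. norm (f t) \<le> r) \<and>
      (\<forall>t. (f has_vector_derivative H ((fst x, t), f t)) (at t)) \<and> (\<forall>t. f (t + P) = - f t)) (snd x)" for x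
  have \<zeta>: "(\<forall>t. norm (\<zeta> (p, t)) \<le> r) \<and> (\<forall>t. ((\<lambda>t. \<zeta> (p, t)) has_vector_derivative H ((p, t), \<zeta> (p, t))) (at t))
      \<and> (\<forall>t. \<zeta> (p, t + P) = - \<zeta> (p, t))" if "p \<in> U" for p
    using someI_ex[OF ex[OF that]] by (simp add: \<zeta>_def)
  \<comment> \<open>The regularity result expects an open domain on all of which the Lipschitz bound
    holds; this is secured only for states of norm at most \<open>r1\<close>.\<close>
  define W' where "W' = W \<inter> {z. norm (snd z) < r1}"
  have W': "open W'" unfolding W'_def by (intro open_Int W open_Collect_less continuous_intros)
  have "Ck_on k (U \<times> UNIV) \<zeta>" for k
  proof (rule Ck_on_antiperiodic_solutions[OF P \<open>open U\<close> W'])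
    show "Ck_on k W' H" using H Ck_on_subset unfolding smooth_on_def W'_def by blast
    show "((p, t), \<zeta> (p, t)) \<in> W'" if "p \<in> U" for p t
    proof -
      have "norm (\<zeta> (p, t)) < r1" using \<zeta>[OF that] r1(1) by (meson le_less_trans)
      then show ?thesis using Q[OF that, of t] by (simp add: W'_def Q_def)
    qed
    show "((p, t + P), - x) \<in> W' \<and> H ((p, t + P), - x) = - H ((p, t), x)" if "((p, t), x) \<in> W'" for p t x
      using that W_per H_per by (auto simp: W'_def)
    show "norm (H ((p, t), x) - H ((p, t), y)) \<le> norm (x - y) / P"
      if "p \<in> U" "((p, t), x) \<in> W'" "((p, t), y) \<in> W'" for p t x y
      using Q[OF that(1), of t] that by (auto simp: Q_def W'_def)
  qed (use \<zeta> in auto)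
  then have "smooth_on (U \<times> UNIV) \<zeta>" by (simp add: smooth_on_def)
  moreover have "((p, t), \<zeta> (p, t)) \<in> W" if "p \<in> U" for p t
  proof -
    have "norm (\<zeta> (p, t)) \<le> r1" using \<zeta>[OF that] r1(1) by (meson less_imp_le order_trans)
    then show ?thesis using Q[OF that, of t] by (simp add: Q_def)
  qed
  ultimately show ?thesis
    using that[of \<rho> \<zeta>] \<open>\<rho> > 0\<close> \<zeta> by (auto simp: U_def)
qed

section \<open>Derivatives and bounds of periodic real functions\<close>

lemma smooth_on_UNIV_real_derivative:
  fixes f :: "real \<Rightarrow> real"
  assumes "smooth_on UNIV f"
  obtains f' where "smooth_on UNIV f'" "\<And>t. (f has_real_derivative f' t) (at t)"
proof (rule that)
  let ?D = "\<lambda>t. frechet_derivative f (at t)"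
  show "smooth_on UNIV (\<lambda>t. ?D t 1)" using assms by (rule smooth_on_frechet_derivative)
  fix t
  have D: "(f has_derivative ?D t) (at t)" using smooth_on_has_derivative[OF assms] by simp
  moreover have "?D t = (*) (?D t 1)"
  proof
    fix h show "?D t h = ?D t 1 * h"
      using linear_scale[OF has_derivative_linear[OF D], of h 1] by simp
  qed
  ultimately show "(f has_real_derivative ?D t 1) (at t)"
    by (simp add: has_field_derivative_def)
qed

lemma periodic_real_derivative:
  assumes "periodic P f" "\<And>t. (f has_real_derivative f' t) (at t)"
  shows "periodic P f'"
  unfolding periodic_def
proof
  fix t
  have "((\<lambda>t. f (t + P)) has_real_derivative f' (t + P)) (at t)"
    using assms(2)[of "t + P"] by (simp add: DERIV_shift)
  then have "(f has_real_derivative f' (t + P)) (at t)"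
    using assms(1) by (simp add: periodic_def)
  then show "f' (t + P) = f' t" using assms(2) DERIV_unique by blast
qed

lemma periodic_bounded:
  fixes f :: "real \<Rightarrow> real"
  assumes "P > 0" "periodic P f" "continuous_on UNIV f"
  obtains M where "M > 0" "\<And>t. \<bar>f t\<bar> \<le> M"
proof -
  obtain t0 where "\<And>t. norm (f t) \<le> norm (f t0)"
    using norm_periodic_attains_sup[OF assms(1,3)] assms(2) by (metis periodic_def)
  then show ?thesis using that[of "norm (f t0) + 1"] by (metis abs_ge_zero add_nonneg_pos less_add_one less_imp_le order_le_less_trans real_norm_def zero_less_one)
qed

section \<open>The reduced profile equation\<close>

text \<open>If \<open>a = \<delta> x\<close>, \<open>a' = \<delta> y\<close>, \<open>c = 1 / \<delta>\<^sup>2\<close> and \<open>\<eta> = \<delta>\<^sup>2\<close>, then \<open>R\<close> and \<open>a\<^sup>2 Q\<close> are the functions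
  \<open>reduced_R\<close> and \<open>reduced_Z\<close> below, and \<open>\<ell>\<^sub>1 = L\<close> holds iff \<open>a'' / \<delta>\<close> equals \<open>reduced_force\<close>.  The
  parameter \<open>p\<close> is the pair \<open>(\<mu>, \<eta>)\<close>.\<close>

definition reduced_R :: "real \<Rightarrow> real \<Rightarrow> real \<Rightarrow> real" where
  "reduced_R \<eta> x y = 1 - \<eta> * (x\<^sup>2 + y\<^sup>2)"

definition reduced_Z :: "real \<Rightarrow> real \<Rightarrow> real" where
  "reduced_Z \<eta> x = x ^ 4 + \<eta> * x\<^sup>2 - \<eta>\<^sup>2 * x ^ 4"

text \<open>Eliminating the second warp: with \<nu> = 1 / k2, \<open>q = d1 / L\<^sup>2\<close> and
  \<open>w = d2 * L powr (2 * k1 / k2)\<close>, the product equation expresses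
  \<open>d2 / l2\<^sup>2\<close> as \<mu> times \<open>w\<close> times the power occurring here.
  Solving the difference equation for the second derivative gives the rest.\<close>

definition reduced_force :: "real \<Rightarrow> real \<Rightarrow> real \<Rightarrow> real \<times> real \<Rightarrow> real \<Rightarrow> real \<Rightarrow> real" where
  "reduced_force \<nu> w q p x y = - x + x * reduced_R (snd p) x y *
     (1 / reduced_Z (snd p) x + q - fst p * w * (reduced_R (snd p) x y * x ^ 4 / reduced_Z (snd p) x) powr \<nu>)"

lemma reduced_R_0 [simp]: "reduced_R 0 x y = 1" and reduced_Z_0 [simp]: "reduced_Z 0 x = x ^ 4"
  by (simp_all add: reduced_R_def reduced_Z_def)

lemma smooth_on_reduced_R:
  "open S \<Longrightarrow> smooth_on S \<eta> \<Longrightarrow> smooth_on S x \<Longrightarrow> smooth_on S y \<Longrightarrow> smooth_on S (\<lambda>s. reduced_R (\<eta> s) (x s) (y s))"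
  unfolding reduced_R_def
  by (intro smooth_on_diff smooth_on_const smooth_on_mult smooth_on_add smooth_on_power)

lemma smooth_on_reduced_Z:
  "open S \<Longrightarrow> smooth_on S \<eta> \<Longrightarrow> smooth_on S x \<Longrightarrow> smooth_on S (\<lambda>s. reduced_Z (\<eta> s) (x s))"
  unfolding reduced_Z_def
  by (intro smooth_on_diff smooth_on_const smooth_on_mult smooth_on_add smooth_on_power)

lemma smooth_on_reduced_force:
  assumes S: "open S" and "smooth_on S w" "smooth_on S q" "smooth_on S p" "smooth_on S x" "smooth_on S y"
    and pos: "\<And>s. s \<in> S \<Longrightarrow> 0 < x s" "\<And>s. s \<in> S \<Longrightarrow> 0 < reduced_R (snd (p s)) (x s) (y s)"
      "\<And>s. s \<in> S \<Longrightarrow> 0 < reduced_Z (snd (p s)) (x s)"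
  shows "smooth_on S (\<lambda>s. reduced_force \<nu> (w s) (q s) (p s) (x s) (y s))"
  unfolding reduced_force_def
  by (intro smooth_on_add smooth_on_diff smooth_on_minus smooth_on_mult smooth_on_divide smooth_on_powr
      smooth_on_reduced_R smooth_on_reduced_Z smooth_on_power smooth_on_const smooth_on_fst smooth_on_snd assms)
    (auto simp: pos less_imp_neq[OF pos(1), symmetric] intro!: divide_pos_pos mult_pos_pos)

section \<open>The reduced equation near the WKB amplitude\<close>

lemma inverse_cube_remainder_Lipschitz:
  fixes y1 y2 s k c :: real
  assumes "\<bar>y1\<bar> \<le> s" "\<bar>y2\<bar> \<le> s" "s \<le> 1 / 2" "\<bar>c\<bar> \<le> k"
  shows "\<bar>(inverse (1 + y1) ^ 3 - 1 + 3 * y1 - c * y1) - (inverse (1 + y2) ^ 3 - 1 + 3 * y2 - c * y2)\<bar>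
    \<le> (90 * s + k) * \<bar>y1 - y2\<bar>"
proof -
  let ?f = "\<lambda>y::real. inverse (1 + y) ^ 3 - 1 + 3 * y - c * y"
  have "norm (?f y1 - ?f y2) \<le> (90 * s + k) * norm (y1 - y2)"
  proof (rule field_differentiable_bound)
    show "convex {-s..s}" by simp
    fix y assume y: "y \<in> {-s..s}"
    then have v: "1 / 2 \<le> 1 + y" "\<bar>y\<bar> \<le> s" using assms(3) by auto
    then have nz: "1 + y \<noteq> 0" by linarith
    then show "(?f has_field_derivative (3 - 3 * inverse (1 + y) ^ 4 - c)) (at y within {-s..s})"
      by (auto intro!: derivative_eq_intros simp: power_numeral_reduce)
    define i where "i = inverse (1 + y)"
    have i: "0 < i" "i \<le> 2" "1 - i = y * i"
      using v nz le_imp_inverse_le[of "1 / 2" "1 + y"] by (auto simp: i_def field_simps)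
    \<comment> \<open>The constant 30 is \<open>2 * 15\<close>: in absolute value
      \<open>1 - i\<close> is at most \<open>2 * s\<close>, and its cofactor is at most
      \<open>1 + 2 + 4 + 8\<close>. Three times 30 is the 90 of the conclusion.\<close>
    have "\<bar>1 - i ^ 4\<bar> \<le> 30 * s"
    proof -
      have "1 - i ^ 4 = (1 - i) * (1 + i + i\<^sup>2 + i ^ 3)" by (simp add: algebra_simps power_numeral_reduce)
      also have "\<bar>\<dots>\<bar> = \<bar>y * i\<bar> * (1 + i + i\<^sup>2 + i ^ 3)" using i by (simp add: abs_mult)
      also have "\<dots> \<le> (s * 2) * (1 + 2 + 2\<^sup>2 + 2 ^ 3)"
        unfolding abs_mult by (intro mult_mono add_mono power_mono v) (use i v in auto)
      finally show ?thesis by simp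
    qed
    then show "norm (3 - 3 * inverse (1 + y) ^ 4 - c) \<le> 90 * s + k"
      using assms(4) by (simp add: i_def abs_le_iff)
  qed (use assms in auto)
  then show ?thesis by simp
qed

lemma reduced_force_base:
  assumes "0 < x"
  shows "reduced_force \<nu> w q (l, 0) x y = - x + x * (1 / x ^ 4 + q - l * w)"
  using assms by (simp add: reduced_force_def)

text \<open>The linear part of \<open>inverse v ^ 3 - v\<close> at \<open>v = 1\<close> is
  \<open>- 4 * y\<close>. This rotation term and the leading forcing are moved to the left; what
  remains is quadratic in \<open>y\<close> except for a linear term with the small factor
  \<open>u ^ 4 * e\<close>.\<close>

lemma reduced_force_normal_form:
  fixes u B B2 y q e :: real
  assumes "u > 0" "B > 0" "1 + y > 0" and e: "e = (1 - q) * B ^ 4 + B ^ 3 * B2"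
  shows "u * B * (reduced_force \<nu> (1 / B ^ 4) q (1 / u ^ 4, 0) (u * B * (1 + y)) z - u * B2 * (1 + y))
      + 4 * y / (u * B)\<^sup>2 + u\<^sup>2 * e / B\<^sup>2
    = (inverse (1 + y) ^ 3 - 1 + 3 * y - u ^ 4 * e * y) / (u * B)\<^sup>2"
proof -
  define b v where "b = u * B" and "v = 1 + y"
  have pos: "b > 0" "v > 0" using assms by (auto simp: b_def v_def)
  have F: "reduced_force \<nu> (1 / B ^ 4) q (1 / u ^ 4, 0) (b * v) z = - b * v + b * v * (1 / (b * v) ^ 4 + q - 1 / b ^ 4)"
    using pos by (subst reduced_force_base) (auto simp: b_def power_mult_distrib)
  have e1: "u\<^sup>2 * e / B\<^sup>2 = (1 - q) * b\<^sup>2 + b * u * B2"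
    using assms by (simp add: e b_def field_simps power_numeral_reduce)
  have e2: "u ^ 4 * e * y / b\<^sup>2 = ((1 - q) * b\<^sup>2 + b * u * B2) * y"
    using assms(1,2) by (simp add: e b_def field_simps power_numeral_reduce)
  have "b * (b * v * (1 / (b * v) ^ 4)) = inverse v ^ 3 / b\<^sup>2"
    using pos by (simp add: field_simps power_numeral_reduce)
  moreover have "b * (b * v * (1 / b ^ 4)) = v / b\<^sup>2"
    using pos by (simp add: field_simps power_numeral_reduce)
  ultimately have "b * (- b * v + b * v * (1 / (b * v) ^ 4 + q - 1 / b ^ 4) - u * B2 * v)
     = inverse v ^ 3 / b\<^sup>2 - v / b\<^sup>2 + (q - 1) * b\<^sup>2 * v - b * u * B2 * v"
    by (simp add: algebra_simps power2_eq_square)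
  then have "b * (reduced_force \<nu> (1 / B ^ 4) q (1 / u ^ 4, 0) (b * v) z - u * B2 * v) + 4 * y / b\<^sup>2 + u\<^sup>2 * e / B\<^sup>2
     = inverse v ^ 3 / b\<^sup>2 - v / b\<^sup>2 + (q - 1) * b\<^sup>2 * v - b * u * B2 * v + 4 * y / b\<^sup>2 + ((1 - q) * b\<^sup>2 + b * u * B2)"
    by (simp only: F e1)
  also have "\<dots> = (inverse v ^ 3 - 1 + 3 * y) / b\<^sup>2 - u ^ 4 * e * y / b\<^sup>2"
    unfolding e2 by (simp add: v_def add_divide_distrib diff_divide_distrib algebra_simps)
  finally show ?thesis by (simp add: b_def v_def diff_divide_distrib)
qed

text \<open>The base value is \<open>l = 1 / u ^ 4\<close> for a small \<open>u\<close>. The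
  inequality between \<open>q\<close> and \<open>l / B ^ 4\<close> is recorded because it fixes the
  sign of the \<eta>-derivative of the second phase increment.\<close>

theorem reduced_periodic_family:
  fixes B q :: "real \<Rightarrow> real"
  assumes P: "P > 0" and B: "smooth_on UNIV B" "\<And>t. B t > 0" "periodic P B"
    and q: "smooth_on UNIV q" "periodic P q"
  obtains l \<rho> \<alpha> \<beta> where "l > 0" "\<rho> > 0" "\<And>t. q t < l / B t ^ 4"
    "smooth_on (ball (l, 0) \<rho> \<times> UNIV) \<alpha>" "smooth_on (ball (l, 0) \<rho> \<times> UNIV) \<beta>"
    "\<And>p t. p \<in> ball (l, 0) \<rho> \<Longrightarrow> 0 < \<alpha> (p, t)"
    "\<And>p t. p \<in> ball (l, 0) \<rho> \<Longrightarrow> 0 < reduced_R (snd p) (\<alpha> (p, t)) (\<beta> (p, t))"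
    "\<And>p t. p \<in> ball (l, 0) \<rho> \<Longrightarrow> 0 < reduced_Z (snd p) (\<alpha> (p, t))"
    "\<And>p t. p \<in> ball (l, 0) \<rho> \<Longrightarrow> ((\<lambda>t. \<alpha> (p, t)) has_real_derivative \<beta> (p, t)) (at t)"
    "\<And>p t. p \<in> ball (l, 0) \<rho> \<Longrightarrow> ((\<lambda>t. \<beta> (p, t)) has_real_derivative
        reduced_force \<nu> (1 / B t ^ 4) (q t) p (\<alpha> (p, t)) (\<beta> (p, t))) (at t)"
    "\<And>p t. p \<in> ball (l, 0) \<rho> \<Longrightarrow> \<alpha> (p, t + P) = \<alpha> (p, t)"
    "\<And>p t. p \<in> ball (l, 0) \<rho> \<Longrightarrow> \<beta> (p, t + P) = \<beta> (p, t)"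
proof -
  obtain B1 where B1: "smooth_on UNIV B1" "\<And>t. (B has_real_derivative B1 t) (at t)"
    using smooth_on_UNIV_real_derivative[OF B(1)] by blast
  obtain B2 where B2: "smooth_on UNIV B2" "\<And>t. (B1 has_real_derivative B2 t) (at t)"
    using smooth_on_UNIV_real_derivative[OF B1(1)] by blast
  have B1_per: "periodic P B1" by (rule periodic_real_derivative[OF B(3) B1(2)])
  have B2_per: "periodic P B2" by (rule periodic_real_derivative[OF B1_per B2(2)])
  \<comment> \<open>Measures how far the WKB amplitude is from a solution: inserting
    \<open>u * B\<close> into the equation at \<eta> = 0 leaves the defect
    \<open>u * e / B ^ 3\<close>.\<close>
  define e where "e t = (1 - q t) * B t ^ 4 + B t ^ 3 * B2 t" for t
  have e: "smooth_on UNIV e"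
    unfolding e_def by (intro smooth_on_add smooth_on_mult smooth_on_diff smooth_on_power smooth_on_const B q B2 open_UNIV)
  obtain e1 where e1: "smooth_on UNIV e1" "\<And>t. (e has_real_derivative e1 t) (at t)"
    using smooth_on_UNIV_real_derivative[OF e] by blast
  have e_per: "periodic P e" using B(3) q(2) B2_per by (simp add: periodic_def e_def)
  have e1_per: "periodic P e1" by (rule periodic_real_derivative[OF e_per e1(2)])
  obtain E0 where E0: "E0 > 0" "\<And>t. \<bar>e t\<bar> \<le> E0"
    using periodic_bounded[OF P e_per smooth_on_imp_continuous_on[OF e]] by blast
  obtain E1 where E1: "E1 > 0" "\<And>t. \<bar>e1 t\<bar> \<le> E1"
    using periodic_bounded[OF P e1_per smooth_on_imp_continuous_on[OF e1(1)]] by blast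
  have iB: "smooth_on UNIV (\<lambda>t. 1 / (B t)\<^sup>2)"
    by (intro smooth_on_divide smooth_on_const smooth_on_power B) (use B(2) in \<open>auto simp: less_imp_neq[symmetric]\<close>)
  obtain W where W: "W > 0" "\<And>t. \<bar>1 / (B t)\<^sup>2\<bar> \<le> W"
    using periodic_bounded[OF P _ smooth_on_imp_continuous_on[OF iB]] B(3) by (auto simp: periodic_def)
  have "periodic P (\<lambda>t. q t * B t ^ 4)" using B(3) q(2) by (simp add: periodic_def)
  then obtain M where M: "M > 0" "\<And>t. \<bar>q t * B t ^ 4\<bar> \<le> M"
    using periodic_bounded[OF P, of "\<lambda>t. q t * B t ^ 4"]
      smooth_on_imp_continuous_on[OF smooth_on_mult[OF open_UNIV q(1) smooth_on_power[OF open_UNIV B(1)]]] by blast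
  have "B t \<noteq> 0" for t using B(2)[of t] by simp
  then have "continuous_on UNIV (\<lambda>t. 2 / (B t)\<^sup>2)"
    using smooth_on_imp_continuous_on[OF B(1)] by (auto intro!: continuous_intros)
  \<comment> \<open>The 2 in the rate is the square root of the coefficient 4 in the linearization
    of \<open>inverse v ^ 3 - v\<close>; division by \<open>u\<^sup>2\<close> later gives the
    phase.\<close>
  from continuous_has_antiderivative[OF this] obtain \<tau> where \<tau>: "\<And>t. (\<tau> has_real_derivative 2 / (B t)\<^sup>2) (at t)"
    unfolding has_real_derivative_iff_has_vector_derivative by blast
  define S where "S = \<tau> P - \<tau> 0"
  have \<tau>_per: "\<tau> (t + P) = \<tau> t + S" for t
  proof -
    have "((\<lambda>t. \<tau> (t + P) - \<tau> t) has_real_derivative 0) (at t)" for t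
    proof -
      have "((\<lambda>t. \<tau> (t + P)) has_real_derivative 2 / (B t)\<^sup>2) (at t)"
        using \<tau>[of "t + P"] B(3) by (simp add: DERIV_shift periodic_def)
      then show ?thesis using \<tau>[of t] by (auto intro!: derivative_eq_intros)
    qed
    then have "\<tau> (t + P) - \<tau> t = \<tau> (0 + P) - \<tau> 0" using DERIV_isconst_all[of "\<lambda>t. \<tau> (t + P) - \<tau> t" t 0] by blast
    then show ?thesis by (simp add: S_def)
  qed
  have "S > 0"
  proof -
    have "\<exists>y. (\<tau> has_real_derivative y) (at t) \<and> 0 < y" for t
      using \<tau>[of t] B(2)[of t] by (intro exI[of _ "2 / (B t)\<^sup>2"]) simp
    then have "\<tau> 0 < \<tau> P" using DERIV_pos_imp_increasing[OF P] by blast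
    then show ?thesis by (simp add: S_def)
  qed
  have "((\<lambda>u::real. W * (90 * (u + u * u * E0) + u * u * E0)) \<longlongrightarrow> 0) (at_right 0)"
    "((\<lambda>u::real. 25 * W * E0\<^sup>2 * u ^ 3 + u * E1) \<longlongrightarrow> 0) (at_right 0)"
    "((\<lambda>u::real. u ^ 3 + u ^ 4 * E0) \<longlongrightarrow> 0) (at_right 0)"
    "((\<lambda>u::real. u ^ 4 * M) \<longlongrightarrow> 0) (at_right 0)"
    by (auto intro!: tendsto_eq_intros)
  note lims = this
  \<comment> \<open>In this order the conditions control the Lipschitz constant, the right-hand side
    at the origin, the bound 1/2 for \<open>y\<close>, and the inequality between \<open>q\<close>
    and \<open>l / B ^ 4\<close>.\<close>
  define good where "good u \<longleftrightarrow> W * (90 * (u + u * u * E0) + u * u * E0) < 1 / (2 * P) \<and>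
      25 * W * E0\<^sup>2 * u ^ 3 + u * E1 < 1 / (2 * P) \<and> u ^ 3 + u ^ 4 * E0 < 1 / 2 \<and> u ^ 4 * M < 1" for u :: real
  have "1 / (2 * P) > 0" using P by simp
  then have "\<forall>\<^sub>F u in at_right 0. good u"
    unfolding good_def
    by (intro eventually_conj order_tendstoD(2)[OF lims(1)] order_tendstoD(2)[OF lims(2)]
      order_tendstoD(2)[OF lims(3)] order_tendstoD(2)[OF lims(4)]) auto
  moreover have "filterlim (\<lambda>m. sqrt (S / ((2 * real m + 1) * pi))) (at_right 0) sequentially"
  proof -
    have "filterlim (\<lambda>m. 2 * real m + 1) at_top sequentially"
      by (rule filterlim_at_top_mono[OF filterlim_real_sequentially]) auto
    then have "((\<lambda>m. sqrt (S / pi * inverse (2 * real m + 1))) \<longlongrightarrow> sqrt (S / pi * 0)) sequentially"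
      by (intro tendsto_intros tendsto_inverse_0_at_top)
    then have "((\<lambda>m. sqrt (S / ((2 * real m + 1) * pi))) \<longlongrightarrow> 0) sequentially"
      by (simp add: field_simps)
    moreover have "sqrt (S / ((2 * real m + 1) * pi)) > 0" for m
      using \<open>S > 0\<close> by (auto intro!: divide_pos_pos mult_pos_pos add_nonneg_pos)
    ultimately show ?thesis unfolding filterlim_at by (auto intro!: always_eventually)
  qed
  ultimately have "\<forall>\<^sub>F m in sequentially. good (sqrt (S / ((2 * real m + 1) * pi)))"
    by (rule eventually_compose_filterlim)
  then obtain m where m: "good (sqrt (S / ((2 * real m + 1) * pi)))"
    using eventually_happens'[OF sequentially_bot] by blast
  \<comment> \<open>this \<open>u\<close> makes the WKB phase \<open>\<theta>\<close> grow by an odd multiple of \<open>\<pi>\<close> over a period, the value farthest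
    from resonance\<close>
  define u where "u = sqrt (S / ((2 * real m + 1) * pi))"
  have u: "W * (90 * (u + u * u * E0) + u * u * E0) < 1 / (2 * P)"
      "25 * W * E0\<^sup>2 * u ^ 3 + u * E1 < 1 / (2 * P)" "u ^ 3 + u ^ 4 * E0 < 1 / 2" "u ^ 4 * M < 1"
    using m unfolding u_def good_def by auto
  have u_sq: "u\<^sup>2 = S / ((2 * real m + 1) * pi)"
    unfolding u_def using \<open>S > 0\<close> by (intro real_sqrt_pow2) auto
  have "u > 0" unfolding u_def using \<open>S > 0\<close> by (auto intro!: divide_pos_pos mult_pos_pos add_nonneg_pos)
  define \<theta> where "\<theta> t = \<tau> t / u\<^sup>2" for t
  have \<theta>_der: "(\<theta> has_real_derivative 2 / (u * B t)\<^sup>2) (at t)" for t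
    unfolding \<theta>_def using DERIV_cdivide[OF \<tau>[of t], of "u\<^sup>2"] by (simp add: power_mult_distrib mult.commute)
  have cis_per: "cis (\<theta> (t + P)) = - cis (\<theta> t)" for t
  proof -
    have "S / u\<^sup>2 = (2 * real m + 1) * pi" unfolding u_sq using \<open>S > 0\<close> by (simp add: field_simps)
    then have "\<theta> (t + P) = \<theta> t + pi + 2 * pi * real m"
      by (simp add: \<theta>_def \<tau>_per add_divide_distrib) (simp add: algebra_simps)
    then have "cis (\<theta> (t + P)) = cis (\<theta> t) * cis pi * cis (2 * pi * real m)"
      by (simp only: cis_mult)
    moreover have "cis (2 * pi * real m) = 1"
      by (rule cis_multiple_2pi) simp
    ultimately show ?thesis by simp
  qed
  have u3: "u ^ 3 > 0" "u ^ 4 > 0" using \<open>u > 0\<close> by simp_all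
  have uB: "u * B t > 0" for t using \<open>u > 0\<close> B(2) by simp
  define l where "l = 1 / u ^ 4"
  have \<theta>_smooth: "smooth_on UNIV \<theta>"
    by (rule smooth_on_real_derivativeI[where f' = "\<lambda>t. 2 / (u * B t)\<^sup>2"])
      (use \<theta>_der uB in \<open>auto simp: has_real_derivative_iff_has_vector_derivative
        intro!: smooth_on_divide smooth_on_const smooth_on_power smooth_on_mult B zero_less_power simp del: power_mult_distrib\<close>)
  \<comment> \<open>\<open>u B = (l w)\<^sup>-\<^sup>1\<^sup>/\<^sup>4\<close> is the WKB amplitude and \<open>1 + y\<close> the ratio of \<open>\<alpha>\<close> to it.  The shift by
    \<open>u\<^sup>4 e / 4\<close> removes the leading forcing term; without it the Lipschitz constant on the ball where
    the solution lives would not tend to \<open>0\<close> with \<open>u\<close>.\<close>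
  define z y al be g where "z X = cis (\<theta> (snd (fst X))) * snd X"
    and "y X = Im (z X) / 2 - u ^ 4 * e (snd (fst X)) / 4"
    and "al X = u * B (snd (fst X)) * (1 + y X)"
    and "be X = u * B1 (snd (fst X)) * (1 + y X) + Re (z X) / (u * B (snd (fst X)))"
    and "g X = u * B (snd (fst X)) * (reduced_force \<nu> (1 / B (snd (fst X)) ^ 4) (q (snd (fst X))) (fst (fst X)) (al X) (be X)
        - u * B2 (snd (fst X)) * (1 + y X)) + 4 * y X / (u * B (snd (fst X)))\<^sup>2 + u\<^sup>2 * e (snd (fst X)) / (B (snd (fst X)))\<^sup>2"
    for X :: "((real \<times> real) \<times> real) \<times> complex"
  define H where "H X = cis (- \<theta> (snd (fst X))) * (of_real (g X) + \<i> * of_real (u ^ 4 * e1 (snd (fst X)) / 2))" for X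
  define D where "D = {X. 0 < al X \<and> 0 < reduced_R (snd (fst (fst X))) (al X) (be X) \<and> 0 < reduced_Z (snd (fst (fst X))) (al X)}"
  have time: "smooth_on S (\<lambda>X. f (snd (fst X)))" if "smooth_on UNIV f" "open S"
    for f :: "real \<Rightarrow> real" and S :: "(((real \<times> real) \<times> real) \<times> complex) set"
    by (rule smooth_on_compose[OF that(1,2) open_UNIV]) (auto intro!: smooth_on_snd smooth_on_fst smooth_on_ident that)
  have z: "smooth_on S z" if "open S" for S
    unfolding z_def by (intro smooth_on_mult smooth_on_cis time \<theta>_smooth smooth_on_snd smooth_on_ident that)
  have y: "smooth_on S y" if "open S" for S
    unfolding y_def by (intro smooth_on_diff smooth_on_divide smooth_on_Im z smooth_on_mult smooth_on_const time e that) auto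
  have al: "smooth_on S al" if "open S" for S
    unfolding al_def by (intro smooth_on_mult smooth_on_add smooth_on_const time B y that)
  have be: "smooth_on S be" if "open S" for S
    unfolding be_def by (intro smooth_on_mult smooth_on_add smooth_on_const time B B1 y smooth_on_divide smooth_on_Re z uB that)
  have p_smooth: "smooth_on S (\<lambda>X. snd (fst (fst X)))" "smooth_on S (\<lambda>X. fst (fst X))" if "open S"
    for S :: "(((real \<times> real) \<times> real) \<times> complex) set"
    by (intro smooth_on_snd smooth_on_fst smooth_on_ident that)+
  have "open D"
    unfolding D_def
    by (intro open_Collect_conj open_Collect_less continuous_on_const smooth_on_imp_continuous_on
      smooth_on_reduced_R smooth_on_reduced_Z al be p_smooth open_UNIV)
  have H: "smooth_on D H"
    unfolding H_def g_def
    by (intro smooth_on_mult smooth_on_add smooth_on_diff smooth_on_cis smooth_on_minus smooth_on_of_real time \<theta>_smooth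
        smooth_on_const smooth_on_divide smooth_on_power B B1 B2 e e1 q y al be smooth_on_reduced_force p_smooth \<open>open D\<close> uB zero_less_power)
      (auto simp: D_def B(2))
  \<comment> \<open>The state enters these functions through \<open>z\<close> only, where the sign
    change of \<open>cis \<theta>\<close> over a period cancels that of \<open>x\<close>. The sign
    in the antiperiodicity of \<open>H\<close> comes from its outer factor.\<close>
  have shift: "z ((p, t + P), - x) = z ((p, t), x)" "y ((p, t + P), - x) = y ((p, t), x)"
    "al ((p, t + P), - x) = al ((p, t), x)" "be ((p, t + P), - x) = be ((p, t), x)"
    "g ((p, t + P), - x) = g ((p, t), x)" for p t x
  proof -
    show 1: "z ((p, t + P), - x) = z ((p, t), x)" by (simp add: z_def cis_per)
    then show 2: "y ((p, t + P), - x) = y ((p, t), x)" using e_per by (simp add: y_def periodic_def)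
    then show 3: "al ((p, t + P), - x) = al ((p, t), x)" using B(3) by (simp add: al_def periodic_def)
    show 4: "be ((p, t + P), - x) = be ((p, t), x)" using 1 2 B(3) B1_per by (simp add: be_def periodic_def)
    show "g ((p, t + P), - x) = g ((p, t), x)"
      using 1 2 3 4 B(3) B2_per q(2) e_per by (simp add: g_def periodic_def)
  qed
  \<comment> \<open>Bound for \<open>y\<close> on the ball of radius \<open>2 * u ^ 3\<close>: half
    the state, plus a generous bound for the shift.\<close>
  define s where "s = u ^ 3 + u ^ 4 * E0"
  have y_le: "\<bar>y ((p, t), x)\<bar> \<le> s" if "norm x < 2 * u ^ 3" for p t x
  proof -
    have "\<bar>Im (z ((p, t), x))\<bar> \<le> norm x"
      using abs_Im_le_cmod[of "z ((p, t), x)"] by (simp add: z_def norm_mult)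
    moreover have "\<bar>u ^ 4 * e t\<bar> \<le> u ^ 4 * E0"
      using E0(2)[of t] u3 by (simp add: abs_mult mult_left_mono)
    moreover have "y ((p, t), x) = Im (z ((p, t), x)) / 2 - u ^ 4 * e t / 4" by (simp add: y_def)
    moreover have "0 \<le> u ^ 4 * E0" using E0(1) u3 by simp
    ultimately show ?thesis using that unfolding s_def by linarith
  qed
  have s: "s \<le> 1 / 2" using u(3) by (simp add: s_def)
  have base: "(((l, 0), t), x) \<in> D" if "norm x < 2 * u ^ 3" for t x
  proof -
    have "0 < al (((l, 0), t), x)"
    proof -
      have "0 < 1 + y (((l, 0), t), x)" using y_le[OF that, of "(l, 0)" t] s by linarith
      from mult_pos_pos[OF uB[of t] this] show ?thesis by (simp add: al_def)
    qed
    then show ?thesis by (simp add: D_def)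
  qed
  define N where "N c y = inverse (1 + y) ^ 3 - 1 + 3 * y - c * y" for c y :: real
  have g_base: "g (((l, 0), t), x) = N (u ^ 4 * e t) (y (((l, 0), t), x)) / (u * B t)\<^sup>2" if "norm x < 2 * u ^ 3" for t x
  proof -
    have "1 + y (((l, 0), t), x) > 0" using y_le[OF that, of "(l, 0)" t] s by simp
    from reduced_force_normal_form[OF \<open>u > 0\<close> B(2) this e_def] show ?thesis
      by (simp add: g_def al_def l_def N_def)
  qed
  have inv_b: "1 / (u * B t)\<^sup>2 \<le> W / u\<^sup>2" for t
    using W(2)[of t] \<open>u > 0\<close> by (simp add: power_mult_distrib field_simps)
  have e_le: "\<bar>u ^ 4 * e t\<bar> \<le> u ^ 4 * E0" for t
    using E0(2)[of t] u3 by (simp add: abs_mult mult_left_mono)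
  \<comment> \<open>The division by \<open>(u * B)\<^sup>2\<close> costs
    \<open>W / u\<^sup>2\<close>, while the remainder has a Lipschitz constant of order
    \<open>s\<close>, that is \<open>u ^ 3\<close>. The net constant is of order
    \<open>u\<close>.\<close>
  have Lip: "norm (H (((l, 0), t), x1) - H (((l, 0), t), x2)) \<le> norm (x1 - x2) / (2 * P)"
    if x: "norm x1 < 2 * u ^ 3" "norm x2 < 2 * u ^ 3" for t x1 x2
  proof -
    let ?y = "\<lambda>x. y (((l, 0), t), x)"
    have "H (((l, 0), t), x1) - H (((l, 0), t), x2) = cis (- \<theta> t) * of_real (g (((l, 0), t), x1) - g (((l, 0), t), x2))"
      by (simp add: H_def algebra_simps)
    then have "norm (H (((l, 0), t), x1) - H (((l, 0), t), x2)) = \<bar>g (((l, 0), t), x1) - g (((l, 0), t), x2)\<bar>"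
      by (simp add: norm_mult flip: of_real_diff)
    also have "\<dots> = \<bar>N (u ^ 4 * e t) (?y x1) - N (u ^ 4 * e t) (?y x2)\<bar> * (1 / (u * B t)\<^sup>2)"
      by (simp add: g_base x flip: diff_divide_distrib)
    also have "\<dots> \<le> ((90 * s + u ^ 4 * E0) * (norm (x1 - x2) / 2)) * (W / u\<^sup>2)"
    proof (intro mult_mono inv_b)
      have "\<bar>N (u ^ 4 * e t) (?y x1) - N (u ^ 4 * e t) (?y x2)\<bar> \<le> (90 * s + u ^ 4 * E0) * \<bar>?y x1 - ?y x2\<bar>"
        unfolding N_def by (rule inverse_cube_remainder_Lipschitz[OF y_le y_le s e_le]) (use x in auto)
      also have "\<bar>?y x1 - ?y x2\<bar> \<le> norm (x1 - x2) / 2"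
      proof -
        have "?y x1 - ?y x2 = Im (cis (\<theta> t) * (x1 - x2)) / 2" by (simp add: y_def z_def algebra_simps diff_divide_distrib)
        also have "\<bar>\<dots>\<bar> \<le> norm (cis (\<theta> t) * (x1 - x2)) / 2" 
          unfolding abs_divide abs_numeral by (intro divide_right_mono abs_Im_le_cmod) simp
        finally show ?thesis by (simp add: norm_mult)
      qed
      finally show "\<bar>N (u ^ 4 * e t) (?y x1) - N (u ^ 4 * e t) (?y x2)\<bar> \<le> (90 * s + u ^ 4 * E0) * (norm (x1 - x2) / 2)"
        using E0 u3 by (auto simp: s_def mult_left_mono)
    qed (use E0 u3 in \<open>auto simp: s_def\<close>)
    also have "\<dots> = (W * (90 * (u + u * u * E0) + u * u * E0)) / 2 * norm (x1 - x2)"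
      using \<open>u > 0\<close> by (simp add: s_def field_simps power_numeral_reduce)
    also have "\<dots> \<le> (1 / (2 * P)) * norm (x1 - x2)"
    proof (rule mult_right_mono)
      have "0 \<le> W * (90 * (u + u * u * E0) + u * u * E0)" using W(1) E0(1) \<open>u > 0\<close> by simp
      then show "W * (90 * (u + u * u * E0) + u * u * E0) / 2 \<le> 1 / (2 * P)" using u(1) by linarith
    qed simp
    finally show ?thesis by simp
  qed
  \<comment> \<open>At the origin \<open>y\<close> is \<open>- u ^ 4 * e / 4\<close> and
    \<open>N\<close> is quadratically small; 25 is a rounding of \<open>91 / 4\<close>. With the
    drift \<open>u ^ 4 * e1 / 2\<close> the total is of order \<open>u ^ 4\<close>, smaller by a
    factor \<open>u\<close> than the radius \<open>u ^ 3\<close>.\<close>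
  have small: "norm (H (((l, 0), t), 0)) \<le> u ^ 3 / (2 * P)" for t
  proof -
    let ?y = "y (((l, 0), t), 0)" and ?s = "u ^ 4 * E0"
    have y0: "?y = - (u ^ 4 * e t / 4)" by (simp add: y_def z_def)
    have s': "?s \<le> 1 / 2" using s u3(1) unfolding s_def by linarith
    have "\<bar>?y\<bar> \<le> ?s / 4" using e_le[of t] by (simp add: y0)
    then have "\<bar>N (u ^ 4 * e t) ?y - N (u ^ 4 * e t) 0\<bar> \<le> (90 * ?s + ?s) * \<bar>?y - 0\<bar>"
      unfolding N_def by (intro inverse_cube_remainder_Lipschitz s' e_le) (use E0 u3 in auto)
    also have "\<dots> \<le> (90 * ?s + ?s) * (?s / 4)"
      using \<open>\<bar>?y\<bar> \<le> ?s / 4\<close> E0 u3 by (intro mult_left_mono) auto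
    also have "\<dots> \<le> 25 * ?s\<^sup>2"
    proof -
      have "(90 * c + c) * (c / 4) \<le> 25 * c\<^sup>2" for c :: real by (simp add: power2_eq_square)
      then show ?thesis .
    qed
    finally have "\<bar>N (u ^ 4 * e t) ?y\<bar> \<le> 25 * ?s\<^sup>2" by (simp add: N_def)
    then have "\<bar>g (((l, 0), t), 0)\<bar> \<le> 25 * ?s\<^sup>2 * (W / u\<^sup>2)"
      using mult_mono[OF _ inv_b[of t], of "\<bar>N (u ^ 4 * e t) ?y\<bar>" "25 * ?s\<^sup>2"] u3 by (simp add: g_base abs_mult)
    moreover have "\<bar>u ^ 4 * e1 t / 2\<bar> \<le> u ^ 4 * E1"
      using E1(2)[of t] u3 mult_left_mono[of "\<bar>e1 t\<bar>" E1 "u ^ 4"] by (simp add: abs_mult)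
    moreover have "norm (H (((l, 0), t), 0)) \<le> \<bar>g (((l, 0), t), 0)\<bar> + \<bar>u ^ 4 * e1 t / 2\<bar>"
      unfolding H_def by (simp only: norm_mult norm_cis mult_1 fst_conv snd_conv)
        (rule order_trans[OF norm_triangle_ineq], simp only: norm_mult norm_of_real norm_ii mult_1 order_refl)
    ultimately have "norm (H (((l, 0), t), 0)) \<le> 25 * ?s\<^sup>2 * (W / u\<^sup>2) + u ^ 4 * E1" by linarith
    also have "\<dots> = u ^ 3 * (25 * W * E0\<^sup>2 * u ^ 3 + u * E1)"
      using \<open>u > 0\<close> by (simp add: field_simps power_numeral_reduce)
    also have "\<dots> \<le> u ^ 3 * (1 / (2 * P))" using u(2) u3 by (intro mult_left_mono) auto
    finally show ?thesis by simp
  qed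
  obtain \<rho> \<zeta> where \<rho>: "\<rho> > 0" and \<zeta>: "smooth_on (ball (l, 0) \<rho> \<times> UNIV) \<zeta>"
    "\<And>p t. p \<in> ball (l, 0) \<rho> \<Longrightarrow> ((p, t), \<zeta> (p, t)) \<in> D"
    "\<And>p t. p \<in> ball (l, 0) \<rho> \<Longrightarrow> ((\<lambda>t. \<zeta> (p, t)) has_vector_derivative H ((p, t), \<zeta> (p, t))) (at t)"
    "\<And>p t. p \<in> ball (l, 0) \<rho> \<Longrightarrow> \<zeta> (p, t + P) = - \<zeta> (p, t)"
  proof (rule antiperiodic_solution_family[OF P \<open>open D\<close> H, of "u ^ 3" "2 * u ^ 3" "(l, 0)"])
    show "(((p, t + P), - x) \<in> D) = (((p, t), x) \<in> D)" for p t x by (simp add: D_def shift)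
    show "H ((p, t + P), - x) = - H ((p, t), x)" for p t x
    proof -
      have "cis (- \<theta> (t + P)) = - cis (- \<theta> t)"
        using cis_per[of t] by (metis cis_cnj complex_cnj_minus)
      then show ?thesis using e1_per by (simp add: H_def shift periodic_def)
    qed
  qed (use u3 base Lip small in auto)
  define \<alpha> \<beta> where "\<alpha> X = al (X, \<zeta> X)" and "\<beta> X = be (X, \<zeta> X)" for X
  have op: "open (ball (l, 0) \<rho> \<times> (UNIV :: real set))" by (auto intro: open_Times)
  have graph: "smooth_on (ball (l, 0) \<rho> \<times> UNIV) (\<lambda>X. (X, \<zeta> X))"
    by (intro smooth_on_Pair smooth_on_ident \<zeta> op)
  show ?thesis
  proof (rule that[of l \<rho> \<alpha> \<beta>])
    show "l > 0" using u3 by (simp add: l_def)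
    show "q t < l / B t ^ 4" for t
    proof -
      have "u ^ 4 * (q t * B t ^ 4) \<le> u ^ 4 * M" using M(2)[of t] u3 by (intro mult_left_mono) auto
      then have "u ^ 4 * (q t * B t ^ 4) < 1" using u(4) by linarith
      then show ?thesis using u3 B(2)[of t] by (simp add: l_def field_simps)
    qed
    show "smooth_on (ball (l, 0) \<rho> \<times> UNIV) \<alpha>" "smooth_on (ball (l, 0) \<rho> \<times> UNIV) \<beta>"
      unfolding \<alpha>_def \<beta>_def
      by (rule smooth_on_compose[OF al[OF open_UNIV] op open_UNIV graph] smooth_on_compose[OF be[OF open_UNIV] op open_UNIV graph]; simp)+
  next
    fix p :: "real \<times> real" and t assume p: "p \<in> ball (l, 0) \<rho>"
    show "0 < \<alpha> (p, t)" "0 < reduced_R (snd p) (\<alpha> (p, t)) (\<beta> (p, t))" "0 < reduced_Z (snd p) (\<alpha> (p, t))"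
      using \<zeta>(2)[OF p, of t] by (auto simp: D_def \<alpha>_def \<beta>_def)
    show "\<alpha> (p, t + P) = \<alpha> (p, t)" "\<beta> (p, t + P) = \<beta> (p, t)"
      by (simp_all add: \<alpha>_def \<beta>_def \<zeta>(4)[OF p] shift)
    define Z where "Z t = z ((p, t), \<zeta> (p, t))" for t
    define Y where "Y t = y ((p, t), \<zeta> (p, t))" for t
    define G where "G t = g ((p, t), \<zeta> (p, t))" for t
    have bt: "u * B t \<noteq> 0" using uB[of t] by (metis less_irrefl)
    have "(cis \<circ> \<theta> has_vector_derivative (2 / (u * B t)\<^sup>2) *\<^sub>R (\<i> * cis (\<theta> t))) (at t)"
      by (rule vector_diff_chain_at)
        (use \<theta>_der[of t] in \<open>auto simp: has_real_derivative_iff_has_vector_derivative intro: has_vector_derivative_cis\<close>)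
    from has_vector_derivative_mult[OF this \<zeta>(3)[OF p, of t]]
    have "(Z has_vector_derivative cis (\<theta> t) * H ((p, t), \<zeta> (p, t)) + (2 / (u * B t)\<^sup>2) *\<^sub>R (\<i> * cis (\<theta> t)) * \<zeta> (p, t)) (at t)"
      by (simp add: o_def Z_def[abs_def] z_def)
    moreover have "cis (\<theta> t) * H ((p, t), \<zeta> (p, t)) + (2 / (u * B t)\<^sup>2) *\<^sub>R (\<i> * cis (\<theta> t)) * \<zeta> (p, t)
      = Complex (G t - 2 / (u * B t)\<^sup>2 * Im (Z t)) (u ^ 4 * e1 t / 2 + 2 / (u * B t)\<^sup>2 * Re (Z t))"
    proof -
      have c1: "cis (\<theta> t) * H ((p, t), \<zeta> (p, t)) = of_real (G t) + \<i> * of_real (u ^ 4 * e1 t / 2)"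
        by (simp add: H_def G_def cis_mult flip: mult.assoc)
      have c2: "(2 / (u * B t)\<^sup>2) *\<^sub>R (\<i> * cis (\<theta> t)) * \<zeta> (p, t) = of_real (2 / (u * B t)\<^sup>2) * (\<i> * Z t)"
        by (simp add: Z_def z_def scaleR_conv_of_real mult.assoc)
      show ?thesis unfolding c1 c2 by (simp add: complex_eq_iff)
    qed
    ultimately have Z: "(Z has_vector_derivative Complex (G t - 2 / (u * B t)\<^sup>2 * Im (Z t)) (u ^ 4 * e1 t / 2 + 2 / (u * B t)\<^sup>2 * Re (Z t))) (at t)"
      by simp
    have ReZ: "((\<lambda>t. Re (Z t)) has_real_derivative G t - 2 / (u * B t)\<^sup>2 * Im (Z t)) (at t)"
      using bounded_linear.has_vector_derivative[OF bounded_linear_Re Z]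
      by (simp add: has_real_derivative_iff_has_vector_derivative)
    have ImZ: "((\<lambda>t. Im (Z t)) has_real_derivative u ^ 4 * e1 t / 2 + 2 / (u * B t)\<^sup>2 * Re (Z t)) (at t)"
      using bounded_linear.has_vector_derivative[OF bounded_linear_Im Z]
      by (simp add: has_real_derivative_iff_has_vector_derivative)
    have Y_eq: "Y = (\<lambda>t. Im (Z t) / 2 - u ^ 4 * e t / 4)" by (simp add: Y_def y_def Z_def fun_eq_iff)
    \<comment> \<open>The drift in \<open>H\<close> is the one that makes the terms with
      \<open>e1\<close> cancel, leaving \<open>Re z\<close> as \<open>(u * B)\<^sup>2\<close> times
      the derivative of \<open>Y\<close>.\<close>
    have Y: "(Y has_real_derivative Re (Z t) / (u * B t)\<^sup>2) (at t)"
      unfolding Y_eq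
      by (rule DERIV_cong[OF DERIV_diff[OF DERIV_cdivide[OF ImZ] DERIV_cdivide[OF DERIV_cmult[OF e1(2)]]]])
        (simp add: add_divide_distrib)
    have \<alpha>_eq: "\<alpha> (p, t) = u * B t * (1 + Y t)" and \<beta>_eq: "\<beta> (p, t) = u * B1 t * (1 + Y t) + Re (Z t) / (u * B t)" for t
      by (simp_all add: \<alpha>_def \<beta>_def al_def be_def Y_def Z_def)
    show "((\<lambda>t. \<alpha> (p, t)) has_real_derivative \<beta> (p, t)) (at t)"
      unfolding \<alpha>_eq \<beta>_eq
      by (rule Y B1(2) derivative_eq_intros refl)+ (use bt in \<open>simp add: power2_eq_square\<close>)
    define F where "F = reduced_force \<nu> (1 / B t ^ 4) (q t) p (\<alpha> (p, t)) (\<beta> (p, t))"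
    have "G t = u * B t * (F - u * B2 t * (1 + Y t)) + 4 * Y t / (u * B t)\<^sup>2 + u\<^sup>2 * e t / (B t)\<^sup>2"
      by (simp add: G_def g_def F_def \<alpha>_def \<beta>_def Y_def)
    moreover have "4 * Y t / (u * B t)\<^sup>2 = 2 / (u * B t)\<^sup>2 * Im (Z t) - u\<^sup>2 * e t / (B t)\<^sup>2"
      using bt by (simp add: Y_eq field_simps power_numeral_reduce)
    \<comment> \<open>The two terms added in \<open>g\<close> amount to the rotation term
      \<open>2 / (u * B)\<^sup>2 * Im z\<close>, so the original second-order equation
      reappears.\<close>
    ultimately have G: "G t - 2 / (u * B t)\<^sup>2 * Im (Z t) = u * B t * (F - u * B2 t * (1 + Y t))" by simp
    have "((\<lambda>t. u * B1 t * (1 + Y t) + Re (Z t) / (u * B t)) has_real_derivative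
        u * B2 t * (1 + Y t) + u * B1 t * (Re (Z t) / (u * B t)\<^sup>2)
        + ((u * B t * (F - u * B2 t * (1 + Y t))) * (u * B t) - Re (Z t) * (u * B1 t)) / ((u * B t) * (u * B t))) (at t)"
      by (rule Y B2(2) B1(2) ReZ[unfolded G] derivative_eq_intros refl bt)+ (simp add: algebra_simps)
    moreover have "u * B2 t * (1 + Y t) + u * B1 t * (Re (Z t) / (u * B t)\<^sup>2)
        + ((u * B t * (F - u * B2 t * (1 + Y t))) * (u * B t) - Re (Z t) * (u * B1 t)) / ((u * B t) * (u * B t)) = F"
    proof -
      have "x + w * (v / b\<^sup>2) + ((b * (F - x)) * b - v * w) / (b * b) = F" if "b \<noteq> 0" for x w v b :: real
        using that by (simp add: field_simps power2_eq_square)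
      from this[OF bt, of "u * B2 t * (1 + Y t)" "u * B1 t" "Re (Z t)"] show ?thesis .
    qed
    ultimately have "((\<lambda>t. \<beta> (p, t)) has_real_derivative F) (at t)" by (simp add: \<beta>_eq)
    then show "((\<lambda>t. \<beta> (p, t)) has_real_derivative
        reduced_force \<nu> (1 / B t ^ 4) (q t) p (\<alpha> (p, t)) (\<beta> (p, t))) (at t)"
      unfolding F_def .
  qed (use \<rho> in auto)
qed

section \<open>Derivatives of the phase increments\<close>

lemma has_derivative_directional:
  fixes f :: "'a::real_normed_vector \<Rightarrow> real"
  assumes "(f has_derivative D) (at x)"
  shows "((\<lambda>h. f (x + h *\<^sub>R v)) has_real_derivative D v) (at 0)"
proof -
  have "((\<lambda>h. x + h *\<^sub>R v) has_derivative (\<lambda>h. h *\<^sub>R v)) (at 0)"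
    by (auto intro!: derivative_eq_intros)
  moreover have "(f has_derivative D) (at (x + 0 *\<^sub>R v))" using assms by simp
  ultimately have "((\<lambda>h. f (x + h *\<^sub>R v)) has_derivative (\<lambda>h. D (h *\<^sub>R v))) (at 0)"
    using diff_chain_at by (fastforce simp: o_def)
  moreover have "(\<lambda>h. D (h *\<^sub>R v)) = (*) (D v)"
    using linear_scale[OF has_derivative_linear[OF assms]] by (auto simp: mult.commute)
  ultimately show ?thesis by (simp add: has_field_derivative_def)
qed

lemma integral_pos_continuous:
  fixes f :: "real \<Rightarrow> real"
  assumes "a < b" "continuous_on {a..b} f" "\<And>t. 0 < f t"
  shows "0 < integral {a..b} f"
proof -
  obtain t0 where t0: "\<And>t. t \<in> {a..b} \<Longrightarrow> f t0 \<le> f t"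
    using continuous_attains_inf[OF compact_Icc _ assms(2)] \<open>a < b\<close>
    by (metis atLeastatMost_empty_iff less_imp_le not_le)
  have "0 < (b - a) * f t0" using assms by simp
  also have "\<dots> = integral {a..b} (\<lambda>_. f t0)" using \<open>a < b\<close> by simp
  also have "\<dots> \<le> integral {a..b} f"
    by (rule integral_le) (use t0 assms integrable_continuous_real in auto)
  finally show ?thesis .
qed

section \<open>The periodic family and its phase increments\<close>

locale reduced_family =
  fixes P l \<rho> \<nu> :: real and w q :: "real \<Rightarrow> real" and \<alpha> \<beta> :: "(real \<times> real) \<times> real \<Rightarrow> real"
  assumes P: "0 < P" and \<rho>: "0 < \<rho>"
    and w: "smooth_on UNIV w" "\<And>t. 0 < w t" and q: "smooth_on UNIV q" and q_less: "\<And>t. q t < l * w t"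
    and \<alpha>: "smooth_on (ball (l, 0) \<rho> \<times> UNIV) \<alpha>" and \<beta>: "smooth_on (ball (l, 0) \<rho> \<times> UNIV) \<beta>"
    and \<alpha>_pos: "\<And>p t. p \<in> ball (l, 0) \<rho> \<Longrightarrow> 0 < \<alpha> (p, t)"
    and R_pos: "\<And>p t. p \<in> ball (l, 0) \<rho> \<Longrightarrow> 0 < reduced_R (snd p) (\<alpha> (p, t)) (\<beta> (p, t))"
    and Z_pos: "\<And>p t. p \<in> ball (l, 0) \<rho> \<Longrightarrow> 0 < reduced_Z (snd p) (\<alpha> (p, t))"
    and \<alpha>_der: "\<And>p t. p \<in> ball (l, 0) \<rho> \<Longrightarrow> ((\<lambda>t. \<alpha> (p, t)) has_real_derivative \<beta> (p, t)) (at t)"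
    and \<beta>_der: "\<And>p t. p \<in> ball (l, 0) \<rho> \<Longrightarrow> ((\<lambda>t. \<beta> (p, t)) has_real_derivative
        reduced_force \<nu> (w t) (q t) p (\<alpha> (p, t)) (\<beta> (p, t))) (at t)"
    and \<alpha>_per: "\<And>p t. p \<in> ball (l, 0) \<rho> \<Longrightarrow> \<alpha> (p, t + P) = \<alpha> (p, t)"
    and \<beta>_per: "\<And>p t. p \<in> ball (l, 0) \<rho> \<Longrightarrow> \<beta> (p, t + P) = \<beta> (p, t)"
begin

abbreviation U :: "(real \<times> real) set" where
  "U \<equiv> ball (l, 0) \<rho>"

text \<open>The first phase velocity in rescaled variables. It makes sense for \<eta> of either sign
  and so can be differentiated at \<eta> = 0.\<close>

definition phase_rate1 :: "(real \<times> real) \<times> real \<Rightarrow> real" where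
  "phase_rate1 X = sqrt (reduced_R (snd (fst X)) (\<alpha> X) (\<beta> X) / reduced_Z (snd (fst X)) (\<alpha> X))"

text \<open>Comes from \<open>s2' = c * (a / b)\<^sup>2 * s1'\<close>: the factor
  \<open>\<delta>\<^sup>2\<close> of \<open>a\<^sup>2\<close> absorbs the singular
  \<open>c\<close>.\<close>

definition phase_rate2 :: "(real \<times> real) \<times> real \<Rightarrow> real" where
  "phase_rate2 X = (\<alpha> X)\<^sup>2 * phase_rate1 X / (1 - snd (fst X) * (\<alpha> X)\<^sup>2)"

definition phase1 :: "real \<times> real \<Rightarrow> real" where
  "phase1 p = integral {0..P} (\<lambda>t. phase_rate1 (p, t))"

definition phase2 :: "real \<times> real \<Rightarrow> real" where
  "phase2 p = integral {0..P} (\<lambda>t. phase_rate2 (p, t))"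

lemma open_domain: "open (U \<times> (UNIV :: real set))"
  by (auto intro: open_Times)

lemma base_in_domain: "(l, 0) \<in> U"
  using \<rho> by simp

text \<open>This is \<open>b\<^sup>2\<close> in rescaled form. For \<eta> \<ge> 0 it exceeds or
  equals the positive \<open>R\<close>; for \<eta> < 0 the subtracted term is not positive.\<close>

lemma cos_denominator_pos:
  assumes "p \<in> U"
  shows "0 < 1 - snd p * (\<alpha> (p, t))\<^sup>2"
proof (cases "snd p \<ge> 0")
  case True
  then have "0 \<le> snd p * (\<beta> (p, t))\<^sup>2" by simp
  with R_pos[OF assms, of t] show ?thesis by (simp add: reduced_R_def algebra_simps)
next
  case False
  then have "snd p * (\<alpha> (p, t))\<^sup>2 \<le> 0" by (simp add: mult_nonpos_nonneg)
  then show ?thesis by linarith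
qed

lemma domain_pos:
  assumes "X \<in> U \<times> UNIV"
  shows "0 < \<alpha> X" "0 < reduced_R (snd (fst X)) (\<alpha> X) (\<beta> X)" "0 < reduced_Z (snd (fst X)) (\<alpha> X)"
    "0 < 1 - snd (fst X) * (\<alpha> X)\<^sup>2"
  using assms \<alpha>_pos[of "fst X" "snd X"] R_pos[of "fst X" "snd X"] Z_pos[of "fst X" "snd X"]
    cos_denominator_pos[of "fst X" "snd X"] by (auto simp del: mem_ball)

lemma smooth_on_parameter:
  "smooth_on (U \<times> (UNIV :: real set)) (\<lambda>X. snd (fst X))"
  "smooth_on (U \<times> (UNIV :: real set)) (\<lambda>X. fst (fst X))"
  by (intro smooth_on_snd smooth_on_fst smooth_on_ident open_domain)+

lemma smooth_on_phase_rate1: "smooth_on (U \<times> UNIV) phase_rate1"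
  unfolding phase_rate1_def
  by (intro smooth_on_sqrt smooth_on_divide smooth_on_reduced_R smooth_on_reduced_Z \<alpha> \<beta> smooth_on_parameter open_domain)
    (simp_all only: domain_pos divide_pos_pos)

lemma smooth_on_phase_rate2: "smooth_on (U \<times> UNIV) phase_rate2"
  unfolding phase_rate2_def
  by (intro smooth_on_divide smooth_on_mult smooth_on_diff smooth_on_const smooth_on_power \<alpha> smooth_on_phase_rate1
      smooth_on_parameter open_domain)
    (simp_all only: domain_pos)

lemma smooth_on_phase1: "smooth_on (U) phase1"
  unfolding phase1_def by (rule smooth_on_parametric_integral[OF open_ball smooth_on_phase_rate1])

lemma smooth_on_phase2: "smooth_on (U) phase2"
  unfolding phase2_def by (rule smooth_on_parametric_integral[OF open_ball smooth_on_phase_rate2])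

lemma phase_rate_0:
  assumes "(\<mu>, 0) \<in> U"
  shows "phase_rate1 ((\<mu>, 0), t) = inverse ((\<alpha> ((\<mu>, 0), t))\<^sup>2)" "phase_rate2 ((\<mu>, 0), t) = 1"
proof -
  have "\<alpha> ((\<mu>, 0), t) ^ 4 = ((\<alpha> ((\<mu>, 0), t))\<^sup>2)\<^sup>2" by simp
  then have "sqrt (\<alpha> ((\<mu>, 0), t) ^ 4) = (\<alpha> ((\<mu>, 0), t))\<^sup>2" by (metis real_sqrt_unique zero_le_power2)
  then show 1: "phase_rate1 ((\<mu>, 0), t) = inverse ((\<alpha> ((\<mu>, 0), t))\<^sup>2)"
    by (simp add: phase_rate1_def real_sqrt_divide inverse_eq_divide)
  show "phase_rate2 ((\<mu>, 0), t) = 1"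
    using \<alpha>_pos[OF assms, of t] by (simp add: phase_rate2_def 1)
qed

lemma domain_near:
  obtains d where "d > 0" "\<And>h v. \<bar>h\<bar> < d \<Longrightarrow> norm v \<le> 1 \<Longrightarrow> (l, 0) + h *\<^sub>R v \<in> U"
proof (rule that[OF \<rho>])
  fix h :: real and v :: "real \<times> real" assume "\<bar>h\<bar> < \<rho>" "norm v \<le> 1"
  then have "norm (h *\<^sub>R v) < \<rho>" using mult_left_mono[of "norm v" 1 "\<bar>h\<bar>"] by simp
  then show "(l, 0) + h *\<^sub>R v \<in> U" by (simp add: dist_norm)
qed

lemma phase_derivative:
  "(phase1 has_derivative (\<lambda>v. integral {0..P} (\<lambda>t. frechet_derivative phase_rate1 (at ((l, 0), t)) (v, 0)))) (at (l, 0))"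
  "(phase2 has_derivative (\<lambda>v. integral {0..P} (\<lambda>t. frechet_derivative phase_rate2 (at ((l, 0), t)) (v, 0)))) (at (l, 0))"
  unfolding phase1_def[abs_def] phase2_def[abs_def]
  using smooth_on_phase_rate1 smooth_on_phase_rate2 unfolding smooth_on_def
  by (blast intro: has_derivative_parametric_integral[OF _ open_ball base_in_domain])+

lemma directional_derivative:
  fixes f :: "(real \<times> real) \<times> real \<Rightarrow> real"
  assumes "smooth_on (U \<times> UNIV) f"
  shows "((\<lambda>h. f ((l, 0) + h *\<^sub>R v, t)) has_real_derivative frechet_derivative f (at ((l, 0), t)) (v, 0)) (at 0)"
proof -
  have "(f has_derivative frechet_derivative f (at ((l, 0), t))) (at ((l, 0), t))"
    by (rule smooth_on_has_derivative[OF assms open_domain]) (use \<rho> in simp)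
  from has_derivative_directional[OF this, of "(v, 0)"] show ?thesis by simp
qed

lemma phase2_derivative_mu: "frechet_derivative phase2 (at (l, 0)) (1, 0) = 0"
proof -
  have "frechet_derivative phase_rate2 (at ((l, 0), t)) ((1, 0), 0) = 0" for t
  proof -
    obtain d where d: "d > 0" "\<And>h v. \<bar>h\<bar> < d \<Longrightarrow> norm v \<le> 1 \<Longrightarrow> (l, 0) + h *\<^sub>R v \<in> U"
      using domain_near by blast
    have "((\<lambda>h::real. 1) has_real_derivative frechet_derivative phase_rate2 (at ((l, 0), t)) ((1, 0), 0)) (at 0)"
    proof (rule has_field_derivative_transform_within[OF _ d(1)])
      show "((\<lambda>h. phase_rate2 ((l, 0) + h *\<^sub>R (1, 0), t)) has_real_derivative
          frechet_derivative phase_rate2 (at ((l, 0), t)) ((1, 0), 0)) (at 0)"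
        by (rule directional_derivative[OF smooth_on_phase_rate2])
      show "phase_rate2 ((l, 0) + h *\<^sub>R (1, 0), t) = 1" if "dist h 0 < d" for h
        using d(2)[of h "(1, 0)"] that by (simp add: phase_rate_0 norm_Pair)
    qed auto
    then show ?thesis using DERIV_const DERIV_unique by blast
  qed
  then show ?thesis using frechet_derivative_at[OF phase_derivative(2)] by (metis (mono_tags, lifting) integral_0 integral_cong)
qed

lemma base_force:
  assumes "(\<mu>, 0) \<in> U"
  shows "((\<lambda>t. \<beta> ((\<mu>, 0), t)) has_real_derivative
    inverse (\<alpha> ((\<mu>, 0), t)) ^ 3 - \<alpha> ((\<mu>, 0), t) + (q t - \<mu> * w t) * \<alpha> ((\<mu>, 0), t)) (at t)"
proof -
  have "reduced_force \<nu> (w t) (q t) (\<mu>, 0) (\<alpha> ((\<mu>, 0), t)) (\<beta> ((\<mu>, 0), t))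
     = inverse (\<alpha> ((\<mu>, 0), t)) ^ 3 - \<alpha> ((\<mu>, 0), t) + (q t - \<mu> * w t) * \<alpha> ((\<mu>, 0), t)"
    using \<alpha>_pos[OF assms, of t] by (subst reduced_force_base) (auto simp: field_simps power_numeral_reduce)
  then show ?thesis using \<beta>_der[OF assms, of t] by simp
qed

lemma continuous_on_slice:
  assumes "smooth_on (U \<times> UNIV) f" "p \<in> U"
  shows "continuous_on S (\<lambda>t. f (p, t))"
  by (rule continuous_on_compose2[OF smooth_on_imp_continuous_on[OF assms(1)]])
    (use assms(2) in \<open>auto intro!: continuous_intros\<close>)

lemma phase2_derivative_eta: "frechet_derivative phase2 (at (l, 0)) (0, 1) < 0"
proof -
  let ?a = "\<lambda>t. \<alpha> ((l, 0), t)" and ?b = "\<lambda>t. \<beta> ((l, 0), t)"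
  have a: "?a t > 0" for t using \<alpha>_pos base_in_domain by blast
  define k where "k t = ((?a t)\<^sup>2 - (?b t)\<^sup>2 - inverse (?a t) ^ 2) / 2" for t
  \<comment> \<open>The unknown derivatives \<open>x'\<close> and \<open>y'\<close> drop out:
    \<open>y\<close> occurs only with the factor \<eta>, and the contribution of \<open>x'\<close>
    through \<open>Z\<close> cancels the one through \<open>(x h)\<^sup>2\<close>.\<close>
  have k: "frechet_derivative phase_rate2 (at ((l, 0), t)) ((0, 1), 0) = k t" for t
  proof -
    define x y where "x h = \<alpha> ((l, 0) + h *\<^sub>R (0, 1), t)" and "y h = \<beta> ((l, 0) + h *\<^sub>R (0, 1), t)" for h
    obtain x' y' where x': "(x has_real_derivative x') (at 0)" and y': "(y has_real_derivative y') (at 0)"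
      unfolding x_def[abs_def] y_def[abs_def] using directional_derivative[OF \<alpha>] directional_derivative[OF \<beta>] by metis
    have x0: "x 0 = ?a t" "y 0 = ?b t" by (simp_all add: x_def y_def)
    have xp: "x 0 > 0" using a x0 by simp
    have s: "sqrt (1 / x 0 ^ 4) = 1 / (x 0)\<^sup>2"
      using xp by (intro real_sqrt_unique) (auto simp: power_divide simp flip: power_mult)
    have dR: "((\<lambda>h. reduced_R h (x h) (y h)) has_real_derivative - ((x 0)\<^sup>2 + (y 0)\<^sup>2)) (at 0)"
      unfolding reduced_R_def by (rule derivative_eq_intros x' y' refl)+ simp
    have dZ: "((\<lambda>h. reduced_Z h (x h)) has_real_derivative 4 * x 0 ^ 3 * x' + (x 0)\<^sup>2) (at 0)"
      unfolding reduced_Z_def by (rule derivative_eq_intros x' y' refl)+ (simp add: mult_ac)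
    have dQ: "((\<lambda>h. reduced_R h (x h) (y h) / reduced_Z h (x h)) has_real_derivative
        (- ((x 0)\<^sup>2 + (y 0)\<^sup>2) * x 0 ^ 4 - (4 * x 0 ^ 3 * x' + (x 0)\<^sup>2)) / (x 0 ^ 4 * x 0 ^ 4)) (at 0)"
      using DERIV_divide[OF dR dZ] xp by simp
    have dS: "((\<lambda>h. sqrt (reduced_R h (x h) (y h) / reduced_Z h (x h))) has_real_derivative
        (x 0)\<^sup>2 / 2 * ((- ((x 0)\<^sup>2 + (y 0)\<^sup>2) * x 0 ^ 4 - (4 * x 0 ^ 3 * x' + (x 0)\<^sup>2)) / (x 0 ^ 4 * x 0 ^ 4))) (at 0)"
      using DERIV_chain2[OF DERIV_real_sqrt dQ] xp by (simp add: s)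
    have "((\<lambda>h. (x h)\<^sup>2 * sqrt (reduced_R h (x h) (y h) / reduced_Z h (x h)) / (1 - h * (x h)\<^sup>2)) has_real_derivative k t) (at 0)"
    proof (rule DERIV_cong)
      show "((\<lambda>h. (x h)\<^sup>2 * sqrt (reduced_R h (x h) (y h) / reduced_Z h (x h)) / (1 - h * (x h)\<^sup>2)) has_real_derivative
          2 * x 0 * x' * (1 / (x 0)\<^sup>2) + (x 0)\<^sup>2 * ((x 0)\<^sup>2 / 2 * ((- ((x 0)\<^sup>2 + (y 0)\<^sup>2) * x 0 ^ 4
            - (4 * x 0 ^ 3 * x' + (x 0)\<^sup>2)) / (x 0 ^ 4 * x 0 ^ 4))) + (x 0)\<^sup>2) (at 0)"
        by (rule dS x' derivative_eq_intros refl)+ (simp_all add: s, use xp in \<open>simp add: field_simps power_numeral_reduce\<close>)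
    qed (use xp in \<open>simp add: k_def field_simps power_numeral_reduce flip: x0\<close>)
    then have "((\<lambda>h. phase_rate2 ((l, 0) + h *\<^sub>R (0, 1), t)) has_real_derivative k t) (at 0)"
      by (simp add: phase_rate2_def phase_rate1_def x_def y_def)
    then show ?thesis using directional_derivative[OF smooth_on_phase_rate2, of "(0, 1)" t] DERIV_unique by blast
  qed
  have cont: "continuous_on S ?a" "continuous_on S ?b" for S
    using continuous_on_slice[OF _ base_in_domain] \<alpha> \<beta> by auto
  have cq: "continuous_on S q" "continuous_on S w" for S
    using smooth_on_imp_continuous_on[OF q] smooth_on_imp_continuous_on[OF w(1)] continuous_on_subset by blast+
  \<comment> \<open>virial identity: the integrand is the derivative of \<open>- \<alpha> \<alpha>'\<close>\<close>
  have "((\<lambda>t. 2 * k t - (q t - l * w t) * (?a t)\<^sup>2) has_integral (- (?a P * ?b P) - - (?a 0 * ?b 0))) {0..P}"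
  proof (rule fundamental_theorem_of_calculus)
    fix t
    have "((\<lambda>t. - (?a t * ?b t)) has_real_derivative 2 * k t - (q t - l * w t) * (?a t)\<^sup>2) (at t)"
      by (rule derivative_eq_intros \<alpha>_der[OF base_in_domain] base_force[OF base_in_domain] refl)+
        (use a[of t] in \<open>simp add: k_def field_simps power_numeral_reduce\<close>)
    then show "((\<lambda>t. - (?a t * ?b t)) has_vector_derivative 2 * k t - (q t - l * w t) * (?a t)\<^sup>2) (at t within {0..P})"
      by (simp add: has_real_derivative_iff_has_vector_derivative has_vector_derivative_at_within)
  qed (use P in simp)
  moreover have "?a P = ?a 0" "?b P = ?b 0"
    using \<alpha>_per[OF base_in_domain, of 0] \<beta>_per[OF base_in_domain, of 0] by auto
  ultimately have z: "integral {0..P} (\<lambda>t. 2 * k t - (q t - l * w t) * (?a t)\<^sup>2) = 0"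
    by (simp add: integral_unique)
  have "continuous_on {0..P} k"
    unfolding k_def using a by (intro continuous_intros cont) (auto simp: less_imp_neq[symmetric])
  then have ki: "(\<lambda>t. 2 * k t) integrable_on {0..P}" by (intro integrable_continuous_real continuous_intros)
  have c: "continuous_on {0..P} (\<lambda>t. (l * w t - q t) * (?a t)\<^sup>2)" by (intro continuous_intros cont cq)
  have "0 < integral {0..P} (\<lambda>t. (l * w t - q t) * (?a t)\<^sup>2)"
    by (rule integral_pos_continuous[OF P c]) (use q_less a in \<open>simp add: less_imp_neq[symmetric]\<close>)
  moreover have "integral {0..P} (\<lambda>t. 2 * k t + (l * w t - q t) * (?a t)\<^sup>2)
      = 2 * integral {0..P} k + integral {0..P} (\<lambda>t. (l * w t - q t) * (?a t)\<^sup>2)"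
    by (subst integral_add[OF ki integrable_continuous_real[OF c]]) simp
  moreover have "(\<lambda>t. 2 * k t - (q t - l * w t) * (?a t)\<^sup>2) = (\<lambda>t. 2 * k t + (l * w t - q t) * (?a t)\<^sup>2)"
    by (simp add: algebra_simps)
  ultimately have "integral {0..P} k < 0" using z by simp
  moreover have "frechet_derivative phase2 (at (l, 0)) (0, 1) = integral {0..P} k"
    using fun_cong[OF frechet_derivative_at[OF phase_derivative(2)], of "(0, 1)"] by (simp add: k)
  ultimately show ?thesis by simp
qed

lemma phase1_derivative_mu: "0 < frechet_derivative phase1 (at (l, 0)) (1, 0)"
proof -
  let ?a = "\<lambda>t. \<alpha> ((l, 0), t)" and ?b = "\<lambda>t. \<beta> ((l, 0), t)"
  have a: "?a t > 0" for t using \<alpha>_pos base_in_domain by blast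
  define y where "y t = frechet_derivative \<alpha> (at ((l, 0), t)) ((1, 0), 0)" for t
  define x where "x t h = \<alpha> ((l, 0) + h *\<^sub>R (1, 0), t)" for t h
  have x: "(x t has_real_derivative y t) (at 0)" "x t 0 = ?a t" for t
    using directional_derivative[OF \<alpha>, of "(1, 0)" t] by (simp_all add: x_def[abs_def] y_def)
  obtain d where d: "d > 0" "\<And>h v. \<bar>h\<bar> < d \<Longrightarrow> norm v \<le> 1 \<Longrightarrow> (l, 0) + h *\<^sub>R v \<in> U"
    using domain_near by blast
  have dom: "(l + h, 0) \<in> U" if "\<bar>h\<bar> < d" for h
    using d(2)[OF that, of "(1, 0)"] by (simp add: norm_Pair)
  have rate: "frechet_derivative phase_rate1 (at ((l, 0), t)) ((1, 0), 0) = - 2 * y t * inverse (?a t) ^ 3" for t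
  proof -
    have "((\<lambda>h. inverse ((x t h)\<^sup>2)) has_real_derivative - 2 * y t * inverse (?a t) ^ 3) (at 0)"
      by (rule derivative_eq_intros x(1) refl)+ (use x(2)[of t] a[of t] in \<open>auto simp: field_simps power_numeral_reduce\<close>)
    then have "((\<lambda>h. phase_rate1 ((l, 0) + h *\<^sub>R (1, 0), t)) has_real_derivative - 2 * y t * inverse (?a t) ^ 3) (at 0)"
    proof (rule has_field_derivative_transform_within[OF _ d(1)])
      show "inverse ((x t h)\<^sup>2) = phase_rate1 ((l, 0) + h *\<^sub>R (1, 0), t)" if "dist h 0 < d" for h
        using dom[of h] that by (simp add: phase_rate_0 x_def)
    qed auto
    then show ?thesis using directional_derivative[OF smooth_on_phase_rate1, of "(1, 0)" t] DERIV_unique by blast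
  qed
  \<comment> \<open>the derivative of the Wronskian of the solutions for the parameters \<open>fst (fst X)\<close> and \<open>l\<close>\<close>
  define f where "f X = ?a (snd X) * inverse (\<alpha> X) ^ 3 - \<alpha> X * inverse (?a (snd X)) ^ 3
      - (fst (fst X) - l) * w (snd X) * \<alpha> X * ?a (snd X)" for X
  have time: "smooth_on (U \<times> UNIV) (\<lambda>X. g (snd X))" if "smooth_on UNIV g" for g :: "real \<Rightarrow> real"
    by (rule smooth_on_compose[OF that open_domain open_UNIV]) (auto intro!: smooth_on_snd smooth_on_ident open_domain)
  have a_smooth: "smooth_on UNIV ?a"
    by (rule smooth_on_compose[OF \<alpha> open_UNIV open_domain])
      (use base_in_domain in \<open>auto intro!: smooth_on_Pair smooth_on_const smooth_on_ident\<close>)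
  have inv: "smooth_on S (\<lambda>X. inverse (g X))" if "open S" "smooth_on S g" "\<And>X. X \<in> S \<Longrightarrow> 0 < g X"
    for S :: "((real \<times> real) \<times> real) set" and g :: "(real \<times> real) \<times> real \<Rightarrow> real"
    using smooth_on_divide[OF that(1) smooth_on_const[OF that(1), of 1] that(2,3)] by (simp add: inverse_eq_divide)
  have f_smooth: "smooth_on (U \<times> UNIV) f"
    unfolding f_def
    by (intro smooth_on_diff smooth_on_mult smooth_on_power inv time a_smooth w(1) \<alpha> smooth_on_parameter smooth_on_const open_domain)
      (simp_all only: domain_pos a)
  \<comment> \<open>The Wronskian is periodic, so the integral of its derivative vanishes for every
    nearby parameter. Differentiating this identity in the parameter replaces the linearized
    equation for \<open>y\<close> and avoids interchanging time and parameter derivatives.\<close>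
  have f_int: "integral {0..P} (\<lambda>t. f ((l + h, 0), t)) = 0" if "\<bar>h\<bar> < d" for h
  proof -
    let ?a1 = "\<lambda>t. \<alpha> ((l + h, 0), t)" and ?b1 = "\<lambda>t. \<beta> ((l + h, 0), t)"
    note dom = dom[OF that]
    have "((\<lambda>t. f ((l + h, 0), t)) has_integral
        (?b1 P * ?a P - ?b P * ?a1 P - (?b1 0 * ?a 0 - ?b 0 * ?a1 0))) {0..P}"
    proof (rule fundamental_theorem_of_calculus)
      fix t
      have "((\<lambda>t. ?b1 t * ?a t - ?b t * ?a1 t) has_real_derivative f ((l + h, 0), t)) (at t)"
        by (rule derivative_eq_intros \<alpha>_der[OF base_in_domain] base_force[OF base_in_domain]
            \<alpha>_der[OF dom] base_force[OF dom] refl)+ (simp add: f_def algebra_simps)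
      then show "((\<lambda>t. ?b1 t * ?a t - ?b t * ?a1 t) has_vector_derivative f ((l + h, 0), t)) (at t within {0..P})"
        by (simp add: has_real_derivative_iff_has_vector_derivative has_vector_derivative_at_within)
    qed (use P in simp)
    moreover have "?a P = ?a 0" "?b P = ?b 0" "?a1 P = ?a1 0" "?b1 P = ?b1 0"
      using \<alpha>_per[OF base_in_domain, of 0] \<beta>_per[OF base_in_domain, of 0] \<alpha>_per[OF dom, of 0] \<beta>_per[OF dom, of 0] by auto
    ultimately show ?thesis by (simp add: integral_unique)
  qed
  have f_der: "frechet_derivative f (at ((l, 0), t)) ((1, 0), 0) = - 4 * y t * inverse (?a t) ^ 3 - w t * (?a t)\<^sup>2" for t
  proof -
    have xn: "x t 0 \<noteq> 0" using x(2)[of t] a[of t] by simp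
    have "((\<lambda>h. ?a t * inverse (x t h) ^ 3 - x t h * inverse (?a t) ^ 3 - h * w t * x t h * ?a t)
       has_real_derivative - 4 * y t * inverse (?a t) ^ 3 - w t * (?a t)\<^sup>2) (at 0)"
      by (rule x(1) xn derivative_eq_intros refl)+ (use x(2)[of t] a[of t] in \<open>auto simp: field_simps power_numeral_reduce\<close>)
    then have "((\<lambda>h. f ((l, 0) + h *\<^sub>R (1, 0), t)) has_real_derivative - 4 * y t * inverse (?a t) ^ 3 - w t * (?a t)\<^sup>2) (at 0)"
      by (simp add: f_def x_def)
    then show ?thesis using directional_derivative[OF f_smooth, of "(1, 0)" t] DERIV_unique by blast
  qed
  let ?F = "\<lambda>p. integral {0..P} (\<lambda>t. f (p, t))"
  have F: "(?F has_derivative (\<lambda>v. integral {0..P} (\<lambda>t. frechet_derivative f (at ((l, 0), t)) (v, 0)))) (at (l, 0))"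
    using f_smooth unfolding smooth_on_def by (blast intro: has_derivative_parametric_integral[OF _ open_ball base_in_domain])
  have "((\<lambda>h. ?F ((l, 0) + h *\<^sub>R (1, 0))) has_real_derivative
      integral {0..P} (\<lambda>t. - 4 * y t * inverse (?a t) ^ 3 - w t * (?a t)\<^sup>2)) (at 0)"
    using has_derivative_directional[OF F, of "(1, 0)"] by (simp add: f_der)
  then have "((\<lambda>h. 0) has_real_derivative integral {0..P} (\<lambda>t. - 4 * y t * inverse (?a t) ^ 3 - w t * (?a t)\<^sup>2)) (at 0)"
    by (rule has_field_derivative_transform_within[OF _ d(1)]) (use f_int in auto)
  then have z: "integral {0..P} (\<lambda>t. - 4 * y t * inverse (?a t) ^ 3 - w t * (?a t)\<^sup>2) = 0"
    using DERIV_const DERIV_unique by blast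
  have ca: "continuous_on S ?a" for S using continuous_on_slice[OF \<alpha> base_in_domain] .
  have cw: "continuous_on S w" for S
    using smooth_on_imp_continuous_on[OF w(1)] continuous_on_subset by blast
  have cy: "continuous_on S y" for S
    unfolding y_def by (rule continuous_on_slice[OF smooth_on_frechet_derivative[OF \<alpha>] base_in_domain])
  have c1: "continuous_on {0..P} (\<lambda>t. - 2 * y t * inverse (?a t) ^ 3)"
    using a by (intro continuous_intros ca cy) (auto simp: less_imp_neq[symmetric])
  have c2: "continuous_on {0..P} (\<lambda>t. w t * (?a t)\<^sup>2)" by (intro continuous_intros ca cw)
  have "0 < integral {0..P} (\<lambda>t. w t * (?a t)\<^sup>2)"
    by (rule integral_pos_continuous[OF P c2]) (use w(2) a in \<open>simp add: less_imp_neq[symmetric]\<close>)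
  moreover have "integral {0..P} (\<lambda>t. 2 * (- 2 * y t * inverse (?a t) ^ 3) - w t * (?a t)\<^sup>2)
      = 2 * integral {0..P} (\<lambda>t. - 2 * y t * inverse (?a t) ^ 3) - integral {0..P} (\<lambda>t. w t * (?a t)\<^sup>2)"
    by (subst integral_diff[OF integrable_continuous_real[OF continuous_on_mult[OF continuous_on_const c1]]
          integrable_continuous_real[OF c2]]) (simp only: integral_mult_right)
  moreover have "(\<lambda>t. - 4 * y t * inverse (?a t) ^ 3 - w t * (?a t)\<^sup>2)
     = (\<lambda>t. 2 * (- 2 * y t * inverse (?a t) ^ 3) - w t * (?a t)\<^sup>2)" by (simp add: algebra_simps)
  ultimately have "0 < integral {0..P} (\<lambda>t. - 2 * y t * inverse (?a t) ^ 3)" using z by simp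
  moreover have "frechet_derivative phase1 (at (l, 0)) (1, 0) = integral {0..P} (\<lambda>t. - 2 * y t * inverse (?a t) ^ 3)"
    using fun_cong[OF frechet_derivative_at[OF phase_derivative(1)], of "(1, 0)"] by (simp add: rate)
  ultimately show ?thesis by simp
qed

text \<open>The Jacobian matrix is triangular at \<open>(l, 0)\<close> with diagonal entries of
  opposite sign; its determinant stays nonzero nearby by continuity.\<close>

lemma phases_immersion:
  obtains r where "0 < r" "r \<le> \<rho>" "\<And>p :: real \<times> real. p \<in> ball (l, 0) r \<Longrightarrow>
    \<exists>D. ((\<lambda>p. (phase1 p, phase2 p)) has_derivative D) (at p) \<and> inj D"
proof -
  define D1 D2 where "D1 p = frechet_derivative phase1 (at p)" and "D2 p = frechet_derivative phase2 (at p)" for p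
  define J where "J p = D1 p (1, 0) * D2 p (0, 1) - D1 p (0, 1) * D2 p (1, 0)" for p
  have "continuous_on (U) J"
    unfolding J_def D1_def D2_def
    by (intro continuous_intros smooth_on_imp_continuous_on smooth_on_frechet_derivative smooth_on_phase1 smooth_on_phase2)
  then have "isCont J (l, 0)" using base_in_domain by (simp add: continuous_on_eq_continuous_at)
  moreover have "J (l, 0) \<noteq> 0"
    using phase1_derivative_mu phase2_derivative_mu phase2_derivative_eta by (simp add: J_def D1_def D2_def)
  ultimately obtain e where e: "e > 0" "\<And>p. dist (l, 0) p < e \<Longrightarrow> J p \<noteq> 0"
    using continuous_at_avoid[of "(l, 0)" J 0] by metis
  show ?thesis
  proof (rule that[of "min e \<rho>"])
    fix p :: "real \<times> real" assume p: "p \<in> ball (l, 0) (min e \<rho>)"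
    have D: "(phase1 has_derivative D1 p) (at p)" "(phase2 has_derivative D2 p) (at p)"
      unfolding D1_def D2_def
      using smooth_on_has_derivative[OF smooth_on_phase1 open_ball] smooth_on_has_derivative[OF smooth_on_phase2 open_ball] p
      by auto
    have lin: "linear (D1 p)" "linear (D2 p)" using D has_derivative_linear by blast+
    have expand: "F v = fst v * F (1, 0) + snd v * F (0, 1)" if "linear F" for F :: "real \<times> real \<Rightarrow> real" and v
    proof -
      have "v = fst v *\<^sub>R (1, 0) + snd v *\<^sub>R (0, 1)" by (simp add: prod_eq_iff)
      then have "F v = F (fst v *\<^sub>R (1, 0) + snd v *\<^sub>R (0, 1))" by simp
      then show ?thesis by (simp only: linear_add[OF that] linear_scale[OF that] real_scaleR_def)
    qed
    have "v = 0" if "D1 p v = 0" "D2 p v = 0" for v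
    proof -
      have 1: "fst v * D1 p (1, 0) + snd v * D1 p (0, 1) = 0" "fst v * D2 p (1, 0) + snd v * D2 p (0, 1) = 0"
        using that expand[OF lin(1), of v] expand[OF lin(2), of v] by simp_all
      \<comment> \<open>Cramer's rule: each component of \<open>v\<close> times the determinant is a
        combination of the two vanishing expressions.\<close>
      have "fst v * J p = (fst v * D1 p (1, 0) + snd v * D1 p (0, 1)) * D2 p (0, 1)
          - (fst v * D2 p (1, 0) + snd v * D2 p (0, 1)) * D1 p (0, 1)"
        "snd v * J p = (fst v * D2 p (1, 0) + snd v * D2 p (0, 1)) * D1 p (1, 0)
          - (fst v * D1 p (1, 0) + snd v * D1 p (0, 1)) * D2 p (1, 0)"
        by (simp_all add: J_def algebra_simps)
      then have "fst v * J p = 0" "snd v * J p = 0" by (simp_all only: 1 mult_zero_left diff_zero)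
      moreover have "J p \<noteq> 0" using e(2) p by simp
      ultimately show ?thesis by (simp add: prod_eq_iff)
    qed
    moreover have "((\<lambda>p. (phase1 p, phase2 p)) has_derivative (\<lambda>v. (D1 p v, D2 p v))) (at p)"
      by (intro has_derivative_Pair D)
    moreover from this have "linear (\<lambda>v. (D1 p v, D2 p v))" by (rule has_derivative_linear)
    ultimately show "\<exists>D. ((\<lambda>p. (phase1 p, phase2 p)) has_derivative D) (at p) \<and> inj D"
      by (intro exI[of _ "\<lambda>v. (D1 p v, D2 p v)"]) (auto simp: linear_injective_0 zero_prod_def)
  qed (use e \<rho> in auto)
qed

end

section \<open>From the reduced equation to reconstructions\<close>

text \<open>Substituting \<open>t * s\<close> moves the end point \<open>t\<close> into the
  integrand. The primitive becomes an integral over the fixed interval \<open>{0..1}\<close>, hence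
  smooth jointly in parameter and time, with the right sign for negative \<open>t\<close>.\<close>

lemma smooth_on_primitive:
  fixes f :: "'a::euclidean_space \<times> real \<Rightarrow> real"
  assumes "open S" "smooth_on (S \<times> UNIV) f"
  obtains F where "smooth_on (S \<times> UNIV) F" "\<And>p t. p \<in> S \<Longrightarrow> ((\<lambda>t. F (p, t)) has_real_derivative f (p, t)) (at t)"
proof (rule that)
  let ?F = "\<lambda>x. integral {0..1} (\<lambda>s. snd x * f (fst x, snd x * s))"
  have op: "open (S \<times> (UNIV :: real set))" "open ((S \<times> (UNIV :: real set)) \<times> (UNIV :: real set))"
    using assms(1) by (auto intro!: open_Times)
  have "smooth_on ((S \<times> UNIV) \<times> UNIV) (\<lambda>y. snd (fst y) * f (fst (fst y), snd (fst y) * snd y))"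
    by (intro smooth_on_mult smooth_on_compose[OF assms(2) op(2) op(1)] smooth_on_Pair smooth_on_fst smooth_on_snd smooth_on_ident op) auto
  from smooth_on_parametric_integral[OF op(1) this, of 0 1] show "smooth_on (S \<times> UNIV) ?F" by simp
  fix p t assume p: "p \<in> S"
  have "continuous_on UNIV (\<lambda>t. f (p, t))"
    by (rule continuous_on_compose2[OF smooth_on_imp_continuous_on[OF assms(2)]]) (use p in \<open>auto intro!: continuous_intros\<close>)
  from continuous_has_antiderivative[OF this] obtain G where G: "\<And>t. (G has_real_derivative f (p, t)) (at t)"
    unfolding has_real_derivative_iff_has_vector_derivative by blast
  have "?F (p, t) = G t - G 0" for t
  proof -
    have "((\<lambda>s. t * f (p, t * s)) has_integral (G (t * 1) - G (t * 0))) {0..1}"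
    proof (rule fundamental_theorem_of_calculus)
      fix s
      have "((\<lambda>s. G (t * s)) has_real_derivative f (p, t * s) * t) (at s)"
        by (rule DERIV_chain2[OF G]) (auto intro!: derivative_eq_intros)
      then show "((\<lambda>s. G (t * s)) has_vector_derivative t * f (p, t * s)) (at s within {0..1})"
        by (simp add: has_real_derivative_iff_has_vector_derivative has_vector_derivative_at_within mult.commute)
    qed simp
    from integral_unique[OF this] show ?thesis
      by (simp only: fst_conv snd_conv mult_1_right mult_zero_right)
  qed
  then have "(\<lambda>t. ?F (p, t)) = (\<lambda>t. G t - G 0)" by blast
  then show "((\<lambda>t. ?F (p, t)) has_real_derivative f (p, t)) (at t)"
    using G[of t] by (auto intro!: derivative_eq_intros)
qed

lemma periodic_family_bounded:
  fixes f :: "'a::euclidean_space \<times> real \<Rightarrow> real"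
  assumes "P > 0" "compact C" "continuous_on (C \<times> UNIV) f" "\<And>p t. p \<in> C \<Longrightarrow> f (p, t + P) = f (p, t)"
  obtains M where "M > 0" "\<And>p t. p \<in> C \<Longrightarrow> \<bar>f (p, t)\<bar> \<le> M"
proof -
  have "compact (f ` (C \<times> {0..P}))"
    by (intro compact_continuous_image compact_Times compact_Icc assms(2) continuous_on_subset[OF assms(3)]) auto
  then obtain M where M: "M > 0" "\<And>x. x \<in> f ` (C \<times> {0..P}) \<Longrightarrow> norm x \<le> M"
    using compact_imp_bounded bounded_pos by metis
  have "\<bar>f (p, t)\<bar> \<le> M" if p: "p \<in> C" for p t
    by (rule periodic_predicate[OF assms(1)]) (use assms(4)[OF p] M(2) p in auto)
  with M(1) show ?thesis using that by blast
qed

section \<open>The profile quantities in rescaled variables\<close>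

context
  fixes \<delta> x y :: real and a :: "real \<Rightarrow> real" and t :: real
  assumes \<delta>: "0 < \<delta>" and a: "a t = \<delta> * x" "deriv a t = \<delta> * y" and x: "0 < x"
    and R: "0 < reduced_R (\<delta>\<^sup>2) x y" and Z: "0 < reduced_Z (\<delta>\<^sup>2) x"
begin

lemma profile_R_reduced: "profile_R a t = reduced_R (\<delta>\<^sup>2) x y"
  by (simp add: profile_R_def reduced_R_def a power_mult_distrib algebra_simps)

lemma profile_Q_reduced: "(a t)\<^sup>2 * profile_Q (1 / \<delta>\<^sup>2) a t = reduced_Z (\<delta>\<^sup>2) x"
  using \<delta> by (simp add: profile_Q_def reduced_Z_def a field_simps power_numeral_reduce)

text \<open>Here \<open>m\<close> stands for \<mu> to the power \<open>k2\<close>. Extending the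
  fraction by \<open>a\<^sup>2\<close> produces \<open>a ^ 4\<close> in the denominator, whose
  \<open>\<delta> ^ 4\<close> cancels the one in \<epsilon>.\<close>

lemma profile_F_reduced:
  assumes "0 < m"
  shows "profile_F (1 / \<delta>\<^sup>2) (\<delta> ^ 4 / m) a t = sqrt (reduced_Z (\<delta>\<^sup>2) x / (m * x ^ 4 * reduced_R (\<delta>\<^sup>2) x y))"
proof -
  have "\<delta> ^ 4 / m * profile_Q (1 / \<delta>\<^sup>2) a t / ((a t)\<^sup>2 * profile_R a t)
      = \<delta> ^ 4 / m * ((a t)\<^sup>2 * profile_Q (1 / \<delta>\<^sup>2) a t) / ((a t) ^ 4 * profile_R a t)"
    using \<delta> x by (simp add: a field_simps power_numeral_reduce)
  also have "\<dots> = reduced_Z (\<delta>\<^sup>2) x / (m * x ^ 4 * reduced_R (\<delta>\<^sup>2) x y)"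
    unfolding profile_Q_reduced profile_R_reduced using \<delta> by (simp add: a power_mult_distrib)
  finally show ?thesis by (simp add: profile_F_def)
qed

lemma phase_velocity_reduced:
  assumes "0 < m"
  shows "sqrt (\<delta> ^ 4 / m) / (profile_F (1 / \<delta>\<^sup>2) (\<delta> ^ 4 / m) a t * (a t)\<^sup>2)
    = sqrt (reduced_R (\<delta>\<^sup>2) x y / reduced_Z (\<delta>\<^sup>2) x)"
proof -
  have "sqrt (\<delta> ^ 4) = \<delta>\<^sup>2" "sqrt (x ^ 4) = x\<^sup>2"
    by (intro real_sqrt_unique; simp flip: power_mult)+
  then show ?thesis
    unfolding profile_F_reduced[OF assms] using \<delta> x R Z assms
    by (simp add: a real_sqrt_divide real_sqrt_mult field_simps)
qed

end

text \<open>Taking the power \<open>\<mu> ^ k2\<close> on the right-hand side is what lets \<mu>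
  enter \<open>d2 / l2\<^sup>2\<close> linearly, and with it the reduced equation. \<open>X\<close>
  will be \<open>R * x ^ 4 / Z\<close>.\<close>

lemma warp_equations:
  fixes \<mu> L d2 X :: real and k1 k2 :: nat
  assumes "0 < \<mu>" "0 < L" "0 < X" "0 < k2"
  defines "l2 \<equiv> (\<mu> * (L ^ (2 * k1) * X) powr (1 / k2)) powr (- 1 / 2)"
  shows "0 < l2" "L ^ k1 * l2 ^ k2 = sqrt (1 / (\<mu> ^ k2 * X))"
    "d2 / l2\<^sup>2 = \<mu> * (d2 * (L ^ (2 * k1)) powr (1 / k2)) * X powr (1 / k2)"
proof -
  define Y where "Y = L ^ (2 * k1) * X"
  have Y: "0 < Y" using assms by (simp add: Y_def)
  define V where "V = \<mu> * Y powr (1 / k2)"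
  have V: "0 < V" using Y assms(1) by (simp add: V_def)
  have l2: "l2 = V powr (- 1 / 2)" by (simp add: l2_def V_def Y_def)
  show pos: "0 < l2" using V by (simp add: l2)
  have "l2\<^sup>2 = V powr (- 1)" unfolding l2 using V by (subst powr_power) auto
  then have sq: "l2\<^sup>2 = inverse V" using V by (simp add: powr_minus)
  have "(Y powr (1 / k2)) ^ k2 = Y" using Y \<open>0 < k2\<close> by (simp add: powr_power)
  then have Vk: "V ^ k2 = \<mu> ^ k2 * Y" by (simp add: V_def power_mult_distrib)
  have "(L ^ k1 * l2 ^ k2)\<^sup>2 = L ^ (2 * k1) * (l2\<^sup>2) ^ k2"
    by (simp add: power_mult_distrib mult.commute flip: power_mult)
  also have "\<dots> = 1 / (\<mu> ^ k2 * X)"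
    unfolding sq power_inverse Vk using assms by (simp add: Y_def field_simps)
  finally show "L ^ k1 * l2 ^ k2 = sqrt (1 / (\<mu> ^ k2 * X))"
    using pos assms(2) by (intro real_sqrt_unique[symmetric]) auto
  show "d2 / l2\<^sup>2 = \<mu> * (d2 * (L ^ (2 * k1)) powr (1 / k2)) * X powr (1 / k2)"
    unfolding sq using assms by (simp add: V_def Y_def powr_mult field_simps)
qed

text \<open>The reduced force solves the definition of \<open>T\<close> for the second derivative;
  here that step is reversed.\<close>

lemma profile_T_reduced:
  assumes "0 < \<delta>" "a t = \<delta> * x" "deriv a t = \<delta> * y" "0 < x" "0 < reduced_R (\<delta>\<^sup>2) x y" "0 < reduced_Z (\<delta>\<^sup>2) x"
    and "deriv (deriv a) t = \<delta> * reduced_force \<nu> w q (\<mu>, \<delta>\<^sup>2) x y"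
  shows "profile_T (1 / \<delta>\<^sup>2) a t = \<mu> * w * (reduced_R (\<delta>\<^sup>2) x y * x ^ 4 / reduced_Z (\<delta>\<^sup>2) x) powr \<nu> - q"
proof -
  define s where "s = 1 / reduced_Z (\<delta>\<^sup>2) x + q - \<mu> * w * (reduced_R (\<delta>\<^sup>2) x y * x ^ 4 / reduced_Z (\<delta>\<^sup>2) x) powr \<nu>"
  have "a t + deriv (deriv a) t = (a t * profile_R a t) * s"
    unfolding profile_R_reduced[OF assms(1-6)] assms(2,7) by (simp add: reduced_force_def s_def algebra_simps)
  moreover have "a t * profile_R a t \<noteq> 0"
    unfolding profile_R_reduced[OF assms(1-6)] using assms by simp
  ultimately have "(a t + deriv (deriv a) t) / (a t * profile_R a t) = s" by simp
  then show ?thesis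
    unfolding profile_T_def profile_Q_reduced[OF assms(1-6)] by (simp add: s_def)
qed

context reduced_family
begin

text \<open>Time derivatives of \<alpha> of all orders, kept as functions on the joint domain so
  that each is bounded over a compact parameter set uniformly in time.\<close>

primrec iterated_rate :: "nat \<Rightarrow> (real \<times> real) \<times> real \<Rightarrow> real" where
  "iterated_rate 0 = \<alpha>"
| "iterated_rate (Suc j) = (\<lambda>X. frechet_derivative (iterated_rate j) (at X) (0, 1))"

lemma smooth_on_iterated_rate: "smooth_on (U \<times> UNIV) (iterated_rate j)"
  by (induction j) (auto intro: \<alpha> smooth_on_frechet_derivative)

lemma iterated_rate_derivative:
  assumes "p \<in> U"
  shows "((\<lambda>t. iterated_rate j (p, t)) has_real_derivative iterated_rate (Suc j) (p, t)) (at t)"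
  using smooth_on_vector_derivative_snd[OF open_ball smooth_on_iterated_rate assms]
  by (simp add: has_real_derivative_iff_has_vector_derivative)

lemma iterated_rate_periodic:
  assumes "p \<in> U"
  shows "iterated_rate j (p, t + P) = iterated_rate j (p, t)"
proof -
  have "periodic P (\<lambda>t. iterated_rate j (p, t))"
  proof (induction j)
    case 0
    then show ?case using \<alpha>_per[OF assms] by (simp add: periodic_def)
  next
    case (Suc j)
    show ?case by (rule periodic_real_derivative[OF Suc iterated_rate_derivative[OF assms]])
  qed
  then show ?thesis by (simp add: periodic_def)
qed

lemma deriv_funpow_scaled:
  assumes "p \<in> U"
  shows "(deriv ^^ j) (\<lambda>t. c * \<alpha> (p, t)) = (\<lambda>t. c * iterated_rate j (p, t))"
proof (induction j)
  case (Suc j)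
  have "deriv (\<lambda>t. c * iterated_rate j (p, t)) t = c * iterated_rate (Suc j) (p, t)" for t
    by (intro DERIV_imp_deriv DERIV_cmult iterated_rate_derivative assms)
  then show ?case by (simp only: funpow.simps o_def Suc)
qed simp

end

section \<open>Assembly of the reconstructions from the periodic family\<close>

theorem theorem5p3:
  fixes A1 :: "('m1::{t2_space, second_countable_topology}, 'k1::finite) chart set"
    and A2 :: "('m2::{t2_space, second_countable_topology}, 'k2::finite) chart set"
    and g1 :: "('m1, 'k1) metric_components"
    and g2 :: "('m2, 'k2) metric_components"
    and f1 :: "'m1 \<Rightarrow> complex ^ 'n1::finite"
    and f2 :: "'m2 \<Rightarrow> complex ^ 'n2::finite"
    and d1 d2 P :: real
    and L :: "real \<Rightarrow> real"
  assumes "riemannian_manifold A1 g1" and "riemannian_manifold A2 g2"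
    and "eigenmap A1 g1 d1 f1" and "eigenmap A2 g2 d2 f2"
    and "P > 0" and "smooth_on UNIV L" and "\<forall>t. L t > 0" and "periodic P L"
  shows "\<exists>\<mu>s>0. \<exists>\<delta>0>0. \<exists>\<rho>>0.
    \<exists>(c :: real \<times> real \<Rightarrow> real) (\<epsilon> :: real \<times> real \<Rightarrow> real)
      (a :: real \<times> real \<Rightarrow> real \<Rightarrow> real)
      (l1 :: real \<times> real \<Rightarrow> real \<Rightarrow> real) (l2 :: real \<times> real \<Rightarrow> real \<Rightarrow> real)
      (s1 :: real \<times> real \<Rightarrow> real \<Rightarrow> real) (s2 :: real \<times> real \<Rightarrow> real \<Rightarrow> real)
      (G :: real \<times> real \<Rightarrow> real \<times> 'm1 \<times> 'm2 \<Rightarrow> (complex ^ 'n1) \<times> (complex ^ 'n2)).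
    let \<Omega> = {\<mu>s - \<rho> <..< \<mu>s + \<rho>} \<times> {0 <..< \<delta>0} in
      smooth_on \<Omega> c \<and> smooth_on \<Omega> \<epsilon> \<and>
      (\<forall>u\<in>{a, l1, l2, s1, s2}. smooth_on (\<Omega> \<times> UNIV) (\<lambda>(p, t). u p t)) \<and>
      (\<forall>p\<in>\<Omega>.
         reconstruction CARD('k1) d1 f1 CARD('k2) d2 f2
           (c p) (\<epsilon> p) 1 (a p) (l1 p) (l2 p) (s1 p) (s2 p) (G p) \<and>
         doubly_spiral (c p) \<and>
         l1 p = L \<and>
         periodic P (a p) \<and> periodic P (profile_b (a p)) \<and>
         periodic P (l1 p) \<and> periodic P (l2 p)) \<and>
      (\<forall>j. uniform_limit ({\<mu>s - \<rho> <..< \<mu>s + \<rho>} \<times> UNIV)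
              (\<lambda>\<delta> (\<mu>, t). (deriv ^^ j) (a (\<mu>, \<delta>)) t) (\<lambda>_. 0) (at_right 0)) \<and>
      (\<exists>m>0. \<exists>M. \<forall>p\<in>\<Omega>. \<forall>t. l1 p t \<in> {m..M} \<and> l2 p t \<in> {m..M}) \<and>
      (\<forall>p\<in>\<Omega>. \<exists>D'.
         ((\<lambda>q. (phase_increment P (s1 q), phase_increment P (s2 q))) has_derivative D') (at p) \<and>
         dim (range D') = 2)"
proof -
  note P = \<open>P > 0\<close> and L = \<open>smooth_on UNIV L\<close>
  have d: "d1 > 0" "d2 > 0" using assms(3,4) by (auto simp: eigenmap_def)
  have L_pos: "0 < L t" for t using assms(7) by blast
  have L_nz: "L t \<noteq> 0" for t using L_pos[of t] by simp
  have L_per: "L (t + P) = L t" for t using assms(8) by (simp add: periodic_def)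
  define k1 where "k1 = CARD('k1)"
  define k2 where "k2 = CARD('k2)"
  have k2: "0 < k2" by (simp add: k2_def)
  define w where "w t = d2 * (L t ^ (2 * k1)) powr (1 / k2)" for t
  define q where "q t = d1 / (L t)\<^sup>2" for t
  have w_pos: "0 < w t" for t using d L_pos[of t] by (simp add: w_def)
  have w: "smooth_on UNIV w"
    unfolding w_def by (intro smooth_on_mult smooth_on_const smooth_on_powr smooth_on_power L open_UNIV) (use L_pos in auto)
  have q: "smooth_on UNIV q"
    unfolding q_def by (intro smooth_on_divide smooth_on_const smooth_on_power L open_UNIV) (use L_nz in auto)
  define B where "B t = w t powr (- 1 / 4)" for t
  have B: "smooth_on UNIV B" unfolding B_def by (intro smooth_on_powr w open_UNIV w_pos)
  have B_pos: "0 < B t" for t using w_pos[of t] by (simp add: B_def)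
  have wB: "w = (\<lambda>t. 1 / B t ^ 4)"
  proof
    fix t
    have "B t ^ 4 = w t powr (- 1)" unfolding B_def using w_pos[of t] by (subst powr_power) auto
    then show "w t = 1 / B t ^ 4" using w_pos[of t] by (simp add: powr_minus inverse_eq_divide)
  qed
  have B_per: "periodic P B" and q_per: "periodic P q" by (simp_all add: periodic_def B_def w_def q_def L_per)
  obtain l \<rho> \<alpha> \<beta> where l: "l > 0" and \<rho>: "\<rho> > 0" and q_less: "\<And>t. q t < l / B t ^ 4"
    and family: "smooth_on (ball (l, 0) \<rho> \<times> UNIV) \<alpha>" "smooth_on (ball (l, 0) \<rho> \<times> UNIV) \<beta>"
    "\<And>p t. p \<in> ball (l, 0) \<rho> \<Longrightarrow> 0 < \<alpha> (p, t)"
    "\<And>p t. p \<in> ball (l, 0) \<rho> \<Longrightarrow> 0 < reduced_R (snd p) (\<alpha> (p, t)) (\<beta> (p, t))"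
    "\<And>p t. p \<in> ball (l, 0) \<rho> \<Longrightarrow> 0 < reduced_Z (snd p) (\<alpha> (p, t))"
    "\<And>p t. p \<in> ball (l, 0) \<rho> \<Longrightarrow> ((\<lambda>t. \<alpha> (p, t)) has_real_derivative \<beta> (p, t)) (at t)"
    "\<And>p t. p \<in> ball (l, 0) \<rho> \<Longrightarrow> ((\<lambda>t. \<beta> (p, t)) has_real_derivative
        reduced_force (1 / k2) (1 / B t ^ 4) (q t) p (\<alpha> (p, t)) (\<beta> (p, t))) (at t)"
    "\<And>p t. p \<in> ball (l, 0) \<rho> \<Longrightarrow> \<alpha> (p, t + P) = \<alpha> (p, t)"
    "\<And>p t. p \<in> ball (l, 0) \<rho> \<Longrightarrow> \<beta> (p, t + P) = \<beta> (p, t)"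
    using reduced_periodic_family[OF P B B_pos B_per q q_per, of "1 / k2" thesis] by blast
  interpret reduced_family P l \<rho> "1 / k2" w q \<alpha> \<beta>
  proof (rule reduced_family.intro[OF P \<rho> w w_pos q _ family(1-6) _ family(8,9)])
    show "q t < l * w t" for t using q_less[of t] by (simp add: wB)
    show "((\<lambda>t. \<beta> (p, t)) has_real_derivative
        reduced_force (1 / k2) (w t) (q t) p (\<alpha> (p, t)) (\<beta> (p, t))) (at t)" if "p \<in> ball (l, 0) \<rho>" for p t
      using family(7)[OF that, of t] by (simp add: wB)
  qed
  obtain r where r: "0 < r" "r \<le> \<rho>" and immersion: "\<And>p :: real \<times> real. p \<in> ball (l, 0) r \<Longrightarrow>
    \<exists>D. ((\<lambda>p. (phase1 p, phase2 p)) has_derivative D) (at p) \<and> inj D"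
    using phases_immersion by blast
  \<comment> \<open>With \<open>r / 3\<close> the two coordinates of a point of \<open>C\<close>
    deviate from \<open>(l, 0)\<close> by less than \<open>r\<close> in total; \<open>l / 2\<close>
    keeps \<mu> positive.\<close>
  define r0 where "r0 = min (r / 3) (l / 2)"
  have r0: "0 < r0" "r0 \<le> r / 3" "r0 \<le> l / 2" using r l by (auto simp: r0_def)
  \<comment> \<open>The closed box contains \<eta> = 0, so maxima over \<open>C\<close> give bounds
    that persist as \<delta> tends to 0.\<close>
  define C where "C = {l - r0..l + r0} \<times> {- r0..r0}"
  have C: "compact C" unfolding C_def by (intro compact_Times compact_Icc)
  have C_ball: "p \<in> ball (l, 0) r" if "p \<in> C" for p
  proof -
    have "dist (l, 0) p \<le> \<bar>fst p - l\<bar> + \<bar>snd p\<bar>"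
      using norm_Pair_le[of "l - fst p" "- snd p"] by (cases p) (simp add: dist_norm abs_minus_commute)
    also have "\<dots> < r" using that r0 r by (auto simp: C_def abs_le_iff)
    finally show ?thesis by simp
  qed
  then have CU: "p \<in> U" if "p \<in> C" for p using r(2) that by fastforce
  have C_pos: "0 < fst p" if "p \<in> C" for p using that r0 l by (auto simp: C_def)
  have restrict: "continuous_on (C \<times> UNIV) f" if "smooth_on (U \<times> UNIV) f" for f :: "(real \<times> real) \<times> real \<Rightarrow> real"
    using smooth_on_imp_continuous_on[OF that] by (rule continuous_on_subset) (use CU in auto)
  obtain K where K: "K > 0" "\<And>p t. p \<in> C \<Longrightarrow> \<bar>\<alpha> (p, t)\<bar> \<le> K"
    using periodic_family_bounded[OF P C restrict[OF \<alpha>] \<alpha>_per[OF CU]] by blast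
  \<comment> \<open>The first bound keeps \<open>\<delta>\<^sup>2\<close> inside the box, the second
    gives \<open>a = \<delta> * \<alpha> < 1\<close>.\<close>
  define \<delta>0 where "\<delta>0 = min (sqrt r0) (1 / K)"
  have \<delta>0: "0 < \<delta>0" using r0 K by (simp add: \<delta>0_def)
  define \<Omega> where "\<Omega> = {l - r0<..<l + r0} \<times> {0<..<\<delta>0}"
  have \<Omega>: "open \<Omega>" "open (\<Omega> \<times> (UNIV :: real set))"
    unfolding \<Omega>_def by (intro open_Times open_greaterThanLessThan open_UNIV)+
  define e2 where "e2 p = (fst p, (snd p)\<^sup>2)" for p :: "real \<times> real"
  have \<Omega>_delta: "0 < snd p" "snd p * K < 1" if "p \<in> \<Omega>" for p
  proof -
    show "0 < snd p" using that by (auto simp: \<Omega>_def)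
    have "snd p < 1 / K" using that by (auto simp: \<Omega>_def \<delta>0_def)
    then show "snd p * K < 1" using K(1) by (simp add: field_simps)
  qed
  have sq_lt: "\<delta>\<^sup>2 < r0" if "0 < \<delta>" "\<delta> < \<delta>0" for \<delta>
  proof -
    have "\<delta> < sqrt r0" using that by (simp add: \<delta>0_def)
    then have "\<delta>\<^sup>2 < (sqrt r0)\<^sup>2" using that by (intro power_strict_mono) auto
    then show ?thesis using r0 by simp
  qed
  have e2C: "e2 p \<in> C" if "p \<in> \<Omega>" for p
    using that sq_lt[of "snd p"] r0 by (auto simp: \<Omega>_def C_def e2_def less_imp_le intro: order_trans[of _ 0])
  have e2U: "e2 p \<in> U" if "p \<in> \<Omega>" for p using CU e2C that by blast
  have e2_smooth: "smooth_on S e2" if "open S" for S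
    unfolding e2_def by (intro smooth_on_Pair smooth_on_power smooth_on_fst smooth_on_snd smooth_on_ident that)
  have lift: "smooth_on (\<Omega> \<times> UNIV) (\<lambda>x. f (e2 (fst x), snd x))"
    if "open V" "smooth_on (V \<times> UNIV) f" "e2 ` \<Omega> \<subseteq> V" for V and f :: "(real \<times> real) \<times> real \<Rightarrow> real"
  proof (rule smooth_on_compose[OF that(2) \<Omega>(2)])
    show "open (V \<times> (UNIV :: real set))" using that(1) by (auto intro: open_Times)
    show "smooth_on (\<Omega> \<times> UNIV) (\<lambda>x. (e2 (fst x), snd x :: real))"
      by (intro smooth_on_Pair smooth_on_compose[OF e2_smooth[OF open_UNIV]] smooth_on_fst smooth_on_snd smooth_on_ident \<Omega> open_UNIV) auto
  qed (use that(3) in auto)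
  obtain F1 where F1: "smooth_on (U \<times> UNIV) F1"
      "\<And>p t. p \<in> U \<Longrightarrow> ((\<lambda>t. F1 (p, t)) has_real_derivative phase_rate1 (p, t)) (at t)"
    using smooth_on_primitive[OF open_ball smooth_on_phase_rate1] by blast
  obtain F2 where F2: "smooth_on (U \<times> UNIV) F2"
      "\<And>p t. p \<in> U \<Longrightarrow> ((\<lambda>t. F2 (p, t)) has_real_derivative phase_rate2 (p, t)) (at t)"
    using smooth_on_primitive[OF open_ball smooth_on_phase_rate2] by blast
  define X where "X Y = reduced_R (snd (fst Y)) (\<alpha> Y) (\<beta> Y) * \<alpha> Y ^ 4 / reduced_Z (snd (fst Y)) (\<alpha> Y)" for Y
  define W where "W Y = (fst (fst Y) * (L (snd Y) ^ (2 * k1) * X Y) powr (1 / k2)) powr (- 1 / 2)" for Y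
  \<comment> \<open>The second warp contains a real power of \<mu>, so its smoothness is established
    where \<mu> is positive; \<open>C\<close> lies in this set.\<close>
  define V where "V = U \<inter> {p. 0 < fst p}"
  have V: "open V" "open (V \<times> (UNIV :: real set))" "e2 ` \<Omega> \<subseteq> V" "C \<subseteq> V"
  proof -
    show "open V" unfolding V_def by (intro open_Int open_ball open_Collect_less continuous_intros)
    then show "open (V \<times> (UNIV :: real set))" by (auto intro: open_Times)
    show "C \<subseteq> V" using CU C_pos by (auto simp: V_def)
    then show "e2 ` \<Omega> \<subseteq> V" using e2C by blast
  qed
  have X_pos: "0 < X Y" if "Y \<in> V \<times> UNIV" for Y
    using that domain_pos[of Y] unfolding X_def by (auto simp: V_def simp del: mem_ball intro!: divide_pos_pos mult_pos_pos)
  have W_arg_pos: "0 < L (snd Y) ^ (2 * k1) * X Y"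
    "0 < fst (fst Y) * (L (snd Y) ^ (2 * k1) * X Y) powr (1 / k2)" if "Y \<in> V \<times> UNIV" for Y
  proof -
    show pos: "0 < L (snd Y) ^ (2 * k1) * X Y" by (intro mult_pos_pos zero_less_power L_pos X_pos that)
    have "0 < fst (fst Y)" using that by (auto simp: V_def simp del: mem_ball)
    moreover have "0 < (L (snd Y) ^ (2 * k1) * X Y) powr (1 / k2)" using pos by (metis powr_gt_zero less_irrefl)
    ultimately show "0 < fst (fst Y) * (L (snd Y) ^ (2 * k1) * X Y) powr (1 / k2)" by (rule mult_pos_pos)
  qed
  have W: "smooth_on (V \<times> UNIV) W"
  proof -
    have sub: "V \<times> UNIV \<subseteq> U \<times> (UNIV :: real set)" by (auto simp: V_def)
    have "smooth_on (V \<times> UNIV) X"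
      unfolding X_def
      by (intro smooth_on_divide smooth_on_mult smooth_on_power smooth_on_reduced_R smooth_on_reduced_Z V(2)
          smooth_on_subset[OF \<alpha> sub] smooth_on_subset[OF \<beta> sub] smooth_on_subset[OF smooth_on_parameter(1) sub])
        (use domain_pos sub in blast)
    moreover have "smooth_on (V \<times> UNIV) (\<lambda>Y. L (snd Y))"
      by (rule smooth_on_compose[OF L V(2) open_UNIV]) (auto intro!: smooth_on_snd smooth_on_ident V)
    ultimately show ?thesis
      unfolding W_def
      by (intro smooth_on_powr smooth_on_mult smooth_on_power smooth_on_fst smooth_on_ident V(2))
        (simp_all only: W_arg_pos)
  qed
  define c where "c p = 1 / (snd p)\<^sup>2" for p :: "real \<times> real"
  define \<epsilon> where "\<epsilon> p = snd p ^ 4 / fst p ^ k2" for p :: "real \<times> real"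
  define a where "a p t = snd p * \<alpha> (e2 p, t)" for p t
  define l1 where "l1 p = L" for p :: "real \<times> real"
  define l2 where "l2 p t = W (e2 p, t)" for p t
  define s1 where "s1 p t = F1 (e2 p, t)" for p t
  define s2 where "s2 p t = F2 (e2 p, t)" for p t
  define G where "G p = reconstructed_map (a p) (s1 p) (s2 p) f1 f2" for p
  have \<Omega>_mu: "0 < fst p" if "p \<in> \<Omega>" for p using C_pos[OF e2C[OF that]] by (simp add: e2_def)
  have W_eq: "0 < W (p, t)" "L t ^ k1 * W (p, t) ^ k2 = sqrt (1 / (fst p ^ k2 * X (p, t)))"
    "d2 / (W (p, t))\<^sup>2 = fst p * w t * X (p, t) powr (1 / k2)" if "p \<in> V" for p t
  proof -
    have "0 < fst p" "(p, t) \<in> V \<times> UNIV" using that by (auto simp: V_def)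
    note prem = this(1) L_pos[of t] X_pos[OF this(2)] k2
    show "0 < W (p, t)" "L t ^ k1 * W (p, t) ^ k2 = sqrt (1 / (fst p ^ k2 * X (p, t)))"
      "d2 / (W (p, t))\<^sup>2 = fst p * w t * X (p, t) powr (1 / k2)"
      using warp_equations(1,2)[OF prem, where ?k1.0 = k1] warp_equations(3)[OF prem, where ?k1.0 = k1 and ?d2.0 = d2]
      by (simp_all add: W_def w_def)
  qed
  have W_per: "W (p, t + P) = W (p, t)" if "p \<in> V" for p t
    using that \<alpha>_per[of p t] \<beta>_per[of p t] by (simp add: W_def X_def V_def L_per del: mem_ball)
  have a_der: "deriv (a p) = (\<lambda>t. snd p * \<beta> (e2 p, t))"
    "deriv (deriv (a p)) t = snd p * reduced_force (1 / k2) (w t) (q t) (e2 p) (\<alpha> (e2 p, t)) (\<beta> (e2 p, t))"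
    if "p \<in> \<Omega>" for p t
  proof -
    show 1: "deriv (a p) = (\<lambda>t. snd p * \<beta> (e2 p, t))"
      unfolding a_def by (intro ext DERIV_imp_deriv DERIV_cmult \<alpha>_der e2U that)
    show "deriv (deriv (a p)) t = snd p * reduced_force (1 / k2) (w t) (q t) (e2 p) (\<alpha> (e2 p, t)) (\<beta> (e2 p, t))"
      unfolding 1 by (intro DERIV_imp_deriv DERIV_cmult \<beta>_der e2U that)
  qed
  have a_less: "a p t < 1" "0 < a p t" if "p \<in> \<Omega>" for p t
  proof -
    have "\<alpha> (e2 p, t) \<le> K" using K(2)[OF e2C[OF that], of t] by simp
    then have "snd p * \<alpha> (e2 p, t) \<le> snd p * K" using \<Omega>_delta[OF that] by (intro mult_left_mono) auto
    then show "a p t < 1" unfolding a_def using \<Omega>_delta[OF that] by linarith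
    show "0 < a p t" using \<Omega>_delta[OF that] \<alpha>_pos[OF e2U[OF that]] by (simp add: a_def)
  qed
  have recon: "reconstruction k1 d1 f1 k2 d2 f2 (c p) (\<epsilon> p) 1 (a p) (l1 p) (l2 p) (s1 p) (s2 p) (G p)" if p: "p \<in> \<Omega>" for p
  proof -
    let ?x = "\<lambda>t. \<alpha> (e2 p, t)" and ?y = "\<lambda>t. \<beta> (e2 p, t)"
    have snd_e2: "snd (e2 p) = (snd p)\<^sup>2" "fst (e2 p) = fst p" by (simp_all add: e2_def)
    note R = R_pos[OF e2U[OF p], unfolded snd_e2] and Z = Z_pos[OF e2U[OF p], unfolded snd_e2]
    have ax: "a p t = snd p * ?x t" "deriv (a p) t = snd p * ?y t" for t
      by (simp_all add: a_def a_der[OF p])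
    note prem = \<Omega>_delta(1)[OF p] ax \<alpha>_pos[OF e2U[OF p]] R Z
    have m: "0 < fst p ^ k2" using \<Omega>_mu[OF p] by simp
    have rate: "sqrt (\<epsilon> p) / (profile_F (c p) (\<epsilon> p) (a p) t * (a p t)\<^sup>2) = phase_rate1 (e2 p, t)" for t
      using phase_velocity_reduced[OF prem m] by (simp add: c_def \<epsilon>_def phase_rate1_def snd_e2)
    have smooth_a: "smooth_on UNIV (a p)"
    proof -
      have "smooth_on UNIV ?x"
        by (rule smooth_on_compose[OF \<alpha> open_UNIV open_domain])
          (use e2U[OF p] in \<open>auto intro!: smooth_on_Pair smooth_on_const smooth_on_ident simp del: mem_ball\<close>)
      then show ?thesis unfolding a_def by (intro smooth_on_mult smooth_on_const open_UNIV)
    qed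
    have warps: "reconstructed_warps k1 d1 k2 d2 (c p) (\<epsilon> p) (a p) (l1 p) (l2 p)"
      unfolding reconstructed_warps_def
    proof (intro allI conjI)
      fix t
      have eV: "e2 p \<in> V" using V(3) p by blast
      show "0 < l1 p t" "0 < l2 p t" using L_pos W_eq(1)[OF eV] by (simp_all add: l1_def l2_def)
      have "profile_F (c p) (\<epsilon> p) (a p) t = sqrt (1 / (fst p ^ k2 * X (e2 p, t)))"
        unfolding c_def \<epsilon>_def profile_F_reduced[OF prem m] X_def using prem by (simp add: snd_e2 field_simps)
      then show "l1 p t ^ k1 * l2 p t ^ k2 = profile_F (c p) (\<epsilon> p) (a p) t"
        using W_eq(2)[OF eV, of t] by (simp add: l1_def l2_def snd_e2)
      have "profile_T (c p) (a p) t = fst p * w t * X (e2 p, t) powr (1 / k2) - q t"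
      proof -
        have "deriv (deriv (a p)) t = snd p * reduced_force (1 / k2) (w t) (q t) (fst p, (snd p)\<^sup>2) (?x t) (?y t)"
          using a_der(2)[OF p, of t] by (simp add: e2_def)
        from profile_T_reduced[OF prem this] show ?thesis by (simp add: c_def X_def snd_e2)
      qed
      then show "d2 / (l2 p t)\<^sup>2 - d1 / (l1 p t)\<^sup>2 = profile_T (c p) (a p) t"
        using W_eq(3)[OF eV, of t] by (simp add: l1_def l2_def q_def snd_e2)
    qed
    have phases: "reconstructed_phases (c p) (\<epsilon> p) 1 (a p) (s1 p) (s2 p)"
      unfolding reconstructed_phases_def
    proof (intro allI conjI)
      fix t
      show "(s1 p has_real_derivative 1 * sqrt (\<epsilon> p) / (profile_F (c p) (\<epsilon> p) (a p) t * (a p t)\<^sup>2)) (at t)"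
        using F1(2)[OF e2U[OF p], of t] by (simp add: rate s1_def[abs_def])
      have b: "(profile_b (a p) t)\<^sup>2 = 1 - (snd p)\<^sup>2 * (?x t)\<^sup>2"
      proof -
        have "(a p t)\<^sup>2 \<le> 1" using a_less[OF p, of t] by (simp add: abs_square_le_1)
        then show ?thesis by (simp add: profile_b_def a_def power_mult_distrib)
      qed
      have "1 * c p * sqrt (\<epsilon> p) / (profile_F (c p) (\<epsilon> p) (a p) t * (profile_b (a p) t)\<^sup>2)
         = c p * (a p t)\<^sup>2 / (profile_b (a p) t)\<^sup>2 * (sqrt (\<epsilon> p) / (profile_F (c p) (\<epsilon> p) (a p) t * (a p t)\<^sup>2))"
        using a_less(2)[OF p, of t] by simp
      also have "\<dots> = phase_rate2 (e2 p, t)"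
        unfolding rate b using prem(1) by (simp add: phase_rate2_def c_def a_def snd_e2 power_mult_distrib)
      finally show "(s2 p has_real_derivative 1 * c p * sqrt (\<epsilon> p) / (profile_F (c p) (\<epsilon> p) (a p) t * (profile_b (a p) t)\<^sup>2)) (at t)"
        using F2(2)[OF e2U[OF p], of t] by (simp add: s2_def[abs_def])
    qed
    have "0 < \<epsilon> p" using m \<Omega>_delta(1)[OF p] by (simp add: \<epsilon>_def)
    moreover have "0 < profile_R (a p) t" for t
      unfolding profile_R_reduced[OF prem] by (rule R)
    ultimately show ?thesis
      unfolding reconstruction_def using smooth_a a_less[OF p] warps phases by (simp add: G_def)
  qed
  have smooth_family: "\<forall>u\<in>{a, l1, l2, s1, s2}. smooth_on (\<Omega> \<times> UNIV) (\<lambda>(p, t). u p t)"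
  proof -
    have U_sub: "e2 ` \<Omega> \<subseteq> U" using e2U by blast
    have "smooth_on (\<Omega> \<times> UNIV) (\<lambda>x. snd (fst x) * \<alpha> (e2 (fst x), snd x :: real))"
      by (intro smooth_on_mult lift[OF open_ball \<alpha> U_sub] smooth_on_fst smooth_on_snd smooth_on_ident \<Omega>)
    moreover have "smooth_on (\<Omega> \<times> UNIV) (\<lambda>x. L (snd x))"
      by (rule smooth_on_compose[OF L \<Omega>(2) open_UNIV]) (auto intro!: smooth_on_snd smooth_on_ident \<Omega>)
    ultimately show ?thesis
      using lift[OF V(1) W V(3)] lift[OF open_ball F1(1) U_sub] lift[OF open_ball F2(1) U_sub]
      by (simp add: a_def l1_def l2_def s1_def s2_def case_prod_beta')
  qed
  have smooth_c: "smooth_on \<Omega> c"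
    unfolding c_def by (intro smooth_on_divide smooth_on_const smooth_on_power smooth_on_snd smooth_on_ident \<Omega>)
      (simp only: \<Omega>_delta zero_less_power)
  have smooth_\<epsilon>: "smooth_on \<Omega> \<epsilon>"
    unfolding \<epsilon>_def by (intro smooth_on_divide smooth_on_power smooth_on_fst smooth_on_snd smooth_on_ident \<Omega>)
      (simp only: \<Omega>_mu zero_less_power)
  have per: "periodic P (a p)" "periodic P (profile_b (a p))" "periodic P (l1 p)" "periodic P (l2 p)" if "p \<in> \<Omega>" for p
  proof -
    have "e2 p \<in> V" using V(3) that by blast
    then show "periodic P (a p)" "periodic P (profile_b (a p))" "periodic P (l1 p)" "periodic P (l2 p)"
      by (simp_all add: periodic_def profile_b_def a_def l1_def l2_def \<alpha>_per[OF e2U[OF that]] W_per L_per)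
  qed
  have spiral: "doubly_spiral (c p)" if "p \<in> \<Omega>" for p
    using \<Omega>_delta(1)[OF that] by (simp add: doubly_spiral_def c_def)
  have limit: "uniform_limit ({l - r0<..<l + r0} \<times> UNIV)
      (\<lambda>\<delta> (\<mu>, t). (deriv ^^ j) (a (\<mu>, \<delta>)) t) (\<lambda>_. 0) (at_right 0)" for j
  proof -
    \<comment> \<open>The factor \<delta> commutes with time derivatives, so a bound for the
      derivative of \<alpha> over \<open>C\<close> gives convergence at rate \<delta>, for each
      order separately.\<close>
    obtain M where M: "M > 0" "\<And>p t. p \<in> C \<Longrightarrow> \<bar>iterated_rate j (p, t)\<bar> \<le> M"
      using periodic_family_bounded[OF P C restrict[OF smooth_on_iterated_rate] iterated_rate_periodic[OF CU]] by blast
    show ?thesis unfolding uniform_limit_iff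
    proof (intro allI impI)
      fix e :: real assume e: "e > 0"
      show "\<forall>\<^sub>F \<delta> in at_right 0. \<forall>x\<in>{l - r0<..<l + r0} \<times> UNIV. dist (case x of (\<mu>, t) \<Rightarrow> (deriv ^^ j) (a (\<mu>, \<delta>)) t) 0 < e"
        unfolding eventually_at_right_field
      proof (intro exI[of _ "min \<delta>0 (e / M)"] conjI allI impI ballI)
        fix \<delta> x assume \<delta>: "0 < \<delta>" "\<delta> < min \<delta>0 (e / M)" and x: "x \<in> {l - r0<..<l + r0} \<times> (UNIV :: real set)"
        obtain \<mu> t where xt: "x = (\<mu>, t)" by (cases x)
        have p: "(\<mu>, \<delta>) \<in> \<Omega>" using \<delta> x by (auto simp: \<Omega>_def xt)
        have "(deriv ^^ j) (a (\<mu>, \<delta>)) t = \<delta> * iterated_rate j (e2 (\<mu>, \<delta>), t)"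
          using deriv_funpow_scaled[OF e2U[OF p], of j \<delta>] by (simp add: a_def[abs_def])
        then have "\<bar>(deriv ^^ j) (a (\<mu>, \<delta>)) t\<bar> \<le> \<delta> * M"
          using M(2)[OF e2C[OF p], of t] \<delta>(1) by (simp add: abs_mult mult_left_mono)
        also have "\<dots> < e" using \<delta> M(1) by (simp add: field_simps)
        finally show "dist (case x of (\<mu>, t) \<Rightarrow> (deriv ^^ j) (a (\<mu>, \<delta>)) t) 0 < e" by (simp add: xt)
      qed (use \<delta>0 e M in auto)
    qed
  qed
  have bounds: "\<exists>m>0. \<exists>M. \<forall>p\<in>\<Omega>. \<forall>t. l1 p t \<in> {m..M} \<and> l2 p t \<in> {m..M}"
  proof -
    have CV: "p \<in> V" if "p \<in> C" for p using V(4) that by blast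
    have contW: "continuous_on (C \<times> UNIV) W"
      using smooth_on_imp_continuous_on[OF W] by (rule continuous_on_subset) (use V(4) in auto)
    have contL: "continuous_on (C \<times> UNIV) (\<lambda>x. L (snd x))"
      by (rule continuous_on_compose2[OF smooth_on_imp_continuous_on[OF L]]) (auto intro!: continuous_intros)
    have Wn: "W x \<noteq> 0" if "x \<in> C \<times> UNIV" for x using W_eq(1)[OF CV, of "fst x" "snd x"] that by auto
    obtain M1 where M1: "M1 > 0" "\<And>p t. p \<in> C \<Longrightarrow> \<bar>W (p, t)\<bar> \<le> M1"
      using periodic_family_bounded[OF P C contW W_per[OF CV]] by blast
    have contiW: "continuous_on (C \<times> UNIV) (\<lambda>x. inverse (W x))"
      by (rule continuous_on_inverse[OF contW]) (use Wn in blast)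
    have "inverse (W (p, t + P)) = inverse (W (p, t))" if "p \<in> C" for p t
      by (simp only: W_per[OF CV[OF that]])
    from periodic_family_bounded[OF P C contiW this]
    obtain M2 where M2: "M2 > 0" "\<And>p t. p \<in> C \<Longrightarrow> \<bar>inverse (W (p, t))\<bar> \<le> M2" by blast
    have "L (snd (p, t + P)) = L (snd (p, t))" if "p \<in> C" for p and t :: real
      by (simp add: L_per)
    from periodic_family_bounded[OF P C contL this]
    obtain M3 where M3: "M3 > 0" "\<And>p t. p \<in> C \<Longrightarrow> \<bar>L (snd (p, t))\<bar> \<le> M3" by blast
    have contiL: "continuous_on (C \<times> UNIV) (\<lambda>x. inverse (L (snd x)))"
      by (rule continuous_on_inverse[OF contL]) (simp add: L_nz)
    have "inverse (L (snd (p, t + P))) = inverse (L (snd (p, t)))" if "p \<in> C" for p and t :: real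
      by (simp add: L_per)
    from periodic_family_bounded[OF P C contiL this]
    obtain M4 where M4: "M4 > 0" "\<And>p t. p \<in> C \<Longrightarrow> \<bar>inverse (L (snd (p, t)))\<bar> \<le> M4" by blast
    \<comment> \<open>Bounds of the inverses over \<open>C\<close> act as lower bounds for the
      warps.\<close>
    define m where "m = min (1 / M2) (1 / M4)"
    have inv: "1 / M \<le> x" if "\<bar>inverse x\<bar> \<le> M" "0 < x" "0 < M" for x M :: real
      using that by (simp add: field_simps)
    have "l1 p t \<in> {m..max M1 M3} \<and> l2 p t \<in> {m..max M1 M3}" if "p \<in> \<Omega>" for p t
    proof -
      note C' = e2C[OF that]
      have "1 / M2 \<le> W (e2 p, t)" by (rule inv[OF M2(2)[OF C'] W_eq(1)[OF CV[OF C']] M2(1)])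
      moreover have "1 / M4 \<le> L t" using inv[OF _ L_pos M4(1)] M4(2)[OF C', of t] by simp
      ultimately show ?thesis
        using M1(2)[OF C', of t] M3(2)[OF C', of t] by (auto simp: l1_def l2_def m_def)
    qed
    moreover have "m > 0" using M2(1) M4(1) by (simp add: m_def)
    ultimately show ?thesis by blast
  qed
  have rank: "\<exists>D'. ((\<lambda>q. (phase_increment P (s1 q), phase_increment P (s2 q))) has_derivative D') (at p) \<and> dim (range D') = 2"
    if p: "p \<in> \<Omega>" for p
  proof -
    have inc: "phase_increment P (s1 q) = phase1 (e2 q)" "phase_increment P (s2 q) = phase2 (e2 q)" if "q \<in> \<Omega>" for q
    proof -
      have "deriv (s1 q) = (\<lambda>t. phase_rate1 (e2 q, t))" "deriv (s2 q) = (\<lambda>t. phase_rate2 (e2 q, t))"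
        unfolding s1_def s2_def by (intro ext DERIV_imp_deriv F1(2) F2(2) e2U that)+
      then show "phase_increment P (s1 q) = phase1 (e2 q)" "phase_increment P (s2 q) = phase2 (e2 q)"
        by (simp_all add: phase_increment_def phase1_def phase2_def)
    qed
    obtain D where D: "((\<lambda>p. (phase1 p, phase2 p)) has_derivative D) (at (e2 p))" "inj D"
      using immersion[OF C_ball[OF e2C[OF p]]] by blast
    define E where "E v = (fst v, 2 * snd p * snd v)" for v :: "real \<times> real"
    have E: "(e2 has_derivative E) (at p)"
      unfolding e2_def E_def by (rule derivative_eq_intros refl)+ (simp add: fun_eq_iff)
    \<comment> \<open>Here \<delta> > 0 is essential: the derivative of \<open>e2\<close>
      degenerates on \<delta> = 0.\<close>
    have "inj E" using \<Omega>_delta(1)[OF p] by (auto simp: inj_def E_def prod_eq_iff)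
    have DE: "((\<lambda>q. (phase1 (e2 q), phase2 (e2 q))) has_derivative D \<circ> E) (at p)"
      using diff_chain_at[OF E D(1)] by (simp add: o_def)
    then have "((\<lambda>q. (phase_increment P (s1 q), phase_increment P (s2 q))) has_derivative D \<circ> E) (at p)"
      by (rule has_derivative_transform_within_open[OF _ \<Omega>(1) p]) (simp add: inc)
    moreover have "dim (range (D \<circ> E)) = dim (UNIV :: (real \<times> real) set)"
      using has_derivative_linear[OF DE] inj_compose[OF D(2) \<open>inj E\<close>] by (intro dim_image_eq) (auto intro: inj_on_subset)
    ultimately show ?thesis by (auto simp: dim_UNIV)
  qed
  show ?thesis
    unfolding Let_def \<Omega>_def[symmetric]
  proof (rule exI[of _ l], rule conjI[OF l], rule exI[of _ \<delta>0], rule conjI[OF \<delta>0], rule exI[of _ r0], rule conjI[OF r0(1)],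
      rule exI[of _ c], rule exI[of _ \<epsilon>], rule exI[of _ a], rule exI[of _ l1], rule exI[of _ l2], rule exI[of _ s1],
      rule exI[of _ s2], rule exI[of _ G], fold \<Omega>_def, intro conjI)
    show "\<forall>p\<in>\<Omega>. reconstruction CARD('k1) d1 f1 CARD('k2) d2 f2 (c p) (\<epsilon> p) 1 (a p) (l1 p) (l2 p) (s1 p) (s2 p) (G p) \<and>
         doubly_spiral (c p) \<and> l1 p = L \<and> periodic P (a p) \<and> periodic P (profile_b (a p)) \<and>
         periodic P (l1 p) \<and> periodic P (l2 p)"
      using recon per spiral by (auto simp: k1_def k2_def l1_def)
  qed (use smooth_c smooth_\<epsilon> smooth_family limit bounds rank in blast)+
qed

end
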